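(* Let $L$ be a (left) Leibniz algebra over $\mathfrak{k}$ with left center $Z$, let $H\supseteq Z$ be an isotropic ideal of $L$, and let $(V,\tau)$ be an $H$-representation of $L$. Let $\mathcal{L}=S^\bullet(Z)\otimes L$ be the crossed product of $L$, $\mathcal{H}=S^\bullet(Z)\otimes H$, and $\mathcal{V}=S^\bullet(Z)\otimes V$ with its induced action $\nabla$ of $\mathcal{L}$. Then the $H$-standard complex of $L$ with coefficients in $\mathcal{V}$ (with $L$ acting by the restriction of $\nabla$ to $L\subseteq\mathcal{L}$) is isomorphic, as a cochain complex, to the $\mathcal{H}$-standard complex of the Courant-Dorfman algebra $\mathcal{L}$ with coefficients in $\mathcal{V}$: $$C^{\bullet}(L,H,\mathcal{V})\cong C^{\bullet}(\mathcal{L},\mathcal{H},\mathcal{V}).$$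
   Context: Throughout $\mathfrak{k}=\mathbb{R}$ or $\mathbb{C}$; unadorned tensor products are over $\mathfrak{k}$; a hat denotes omission; $\odot^k$ is the symmetric power over $\mathfrak{k}$. Leibniz side. A (left) Leibniz algebra is a $\mathfrak{k}$-vector space $L$ with a bilinear bracket $\circ$ satisfying $e_1\circ(e_2\circ e_3)=(e_1\circ e_2)\circ e_3+e_2\circ(e_1\circ e_3)$. Its left center is $Z=\{e: e\circ e'=0\ \forall e'\in L\}$; $(e_1,e_2)=e_1\circ e_2+e_2\circ e_1\in Z$. An isotropic ideal $H$ is a subspace with $e\circ h,h\circ e\in H$ and $(h,h')=0$ for $e\in L$, $h,h'\in H$. An $H$-representation is a vector space $W$ with linear $\tau:L\to gl(W)$ such that $\tau(e_1\circ e_2)=[\tau(e_1),\tau(e_2)]$ and $\tau(h)=0$ for $h\in H$. $C^n(L,H,W)$ is the space of sequences $\omega=(\omega_0,\dots,\omega_{[n/2]})$ of linear maps $\omega_k:(\otimes^{n-2k}L)\otimes(\odot^kH)\to W$ (set $\omega_k=0$ for other $k$) such that, for all $k,i$, $\omega_k(\dots,e_i,e_{i+1},\dots;h_1,\dots,h_k)+\omega_k(\dots,e_{i+1},e_i,\dots;h_1,\dots,h_k)=-\omega_{k+1}(\dots,\widehat{e_i},\widehat{e_{i+1}},\dots;(e_i,e_{i+1}),h_1,\dots,h_k)$. The differential is $d=d_0+\delta+d'$, where, for $\omega\in C^n$: $(d_0\omega)_k(e_1,\dots,e_{n+1-2k};h_1,\dots,h_k)=\sum_a(-1)^{a+1}\tau(e_a)\omega_k(\dots,\widehat{e_a},\dots;h_1,\dots,h_k)+\sum_{a<b}(-1)^a\omega_k(\dots,\widehat{e_a},\dots,e_a\circ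 e_b,\dots;h_1,\dots,h_k)$ with $e_a\circ e_b$ in the place of $e_b$; $(\delta\omega)_k(e_1,\dots,e_{n+1-2k};h_1,\dots,h_k)=\sum_j\omega_{k-1}(h_j,e_1,\dots,e_{n+1-2k};h_1,\dots,\widehat{h_j},\dots,h_k)$ (zero for $k=0$); $(d'\omega)_k(e_1,\dots,e_{n+1-2k};h_1,\dots,h_k)=\sum_{a,j}(-1)^{a+1}\omega_k(\dots,\widehat{e_a},\dots;h_1,\dots,\widehat{h_j},h_j\circ e_a,\dots,h_k)$ with $h_j\circ e_a$ in the place of $h_j$. Courant-Dorfman side. A Courant-Dorfman algebra $(\mathcal{E},R,\langle\cdot,\cdot\rangle,\partial,\circ)$ consists of a commutative $\mathfrak{k}$-algebra $R$, an $R$-module $\mathcal{E}$, a symmetric $R$-bilinear form $\langle\cdot,\cdot\rangle$ with values in $R$, a derivation $\partial:R\to\mathcal{E}$ and a $\mathfrak{k}$-bilinear bracket $\circ$ on $\mathcal{E}$ such that: (1) $e_1\circ(fe_2)=f(e_1\circ e_2)+\langle e_1,\partial f\rangle e_2$; (2) $\langle e_1,\partial\langle e_2,e_3\rangle\rangle=\langle e_1\circ e_2,e_3\rangle+\langle e_2,e_1\circ e_3\rangle$; (3) $e_1\circ e_2+e_2\circ e_1=\partial\langle e_1,e_2\rangle$; (4) $e_1\circ(e_2\circ e_3)=(e_1\circ e_2)\circ e_3+e_2\circ(e_1\circ e_3)$; (5) $\partial f\circ e=0$; (6) $\langle\partial f,\partial g\rangle=0$. Let $\rho(e)f=\langle e,\partial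 f\rangle$. Given an $R$-submodule $\mathcal{H}\supseteq\partial R$ that is an isotropic (i.e. $\langle\mathcal{H},\mathcal{H}\rangle=0$) two-sided ideal for $\circ$, an $\mathcal{H}$-representation is an $R$-module $\mathcal{V}$ with a $\mathfrak{k}$-linear map $e\mapsto\nabla_e$ into $\mathfrak{k}$-linear endomorphisms of $\mathcal{V}$ with $\nabla_{e_1\circ e_2}=[\nabla_{e_1},\nabla_{e_2}]$, $\nabla_\alpha=0$ for $\alpha\in\mathcal{H}$, $\nabla_{fe}=f\nabla_e$, $\nabla_e(fv)=(\rho(e)f)v+f\nabla_ev$. $C^n(\mathcal{E},\mathcal{H},\mathcal{V})$ is the space of sequences $\omega=(\omega_0,\dots,\omega_{[n/2]})$ of $\mathfrak{k}$-linear maps $\omega_k:(\otimes^{n-2k}\mathcal{E})\otimes(\odot^k\mathcal{H})\to\mathcal{V}$ ($\omega_k=0$ for other $k$) such that, for all $k$: 1) $\omega_k(\dots,e_a,e_{a+1},\dots;\alpha_1,\dots,\alpha_k)+\omega_k(\dots,e_{a+1},e_a,\dots;\alpha_1,\dots,\alpha_k)=-\omega_{k+1}(\dots,\widehat{e_a},\widehat{e_{a+1}},\dots;\partial\langle e_a,e_{a+1}\rangle,\alpha_1,\dots,\alpha_k)$; 2) $\omega_k(\dots,fe_a,\dots;\alpha_1,\dots,\alpha_k)=f\omega_k(\dots,e_a,\dots;\alpha_1,\dots,\alpha_k)+\sum_{b>a}(-1)^{b-a}\langle e_a,e_b\rangle\omega_{k+1}(\dots,\widehat{e_a},\dots,\widehat{e_b},\dots;\partial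 f,\alpha_1,\dots,\alpha_k)$; 3) $\omega_k$ is $R$-linear in each argument from $\mathcal{H}$. The differential $d=d_0+\delta+d'$ is given by the same three formulas as on the Leibniz side, with $e_i\in\mathcal{E}$, $h_i$ replaced by $\alpha_i\in\mathcal{H}$, and $\tau(e_a)$ replaced by $\nabla_{e_a}$. Crossed product. $S^\bullet(Z)$ is the symmetric algebra of $Z$; $\mathcal{L}=S^\bullet(Z)\otimes L$ (write $fe$ for $f\otimes e$) is a Courant-Dorfman algebra with $R=S^\bullet(Z)$, $\langle f_1e_1,f_2e_2\rangle=f_1f_2(e_1,e_2)$, $\partial(z_1\cdots z_k)=\sum_i(z_1\cdots\widehat{z_i}\cdots z_k)\partial z_i$ with $\partial z=1\otimes z$, and $f_1e_1\circ f_2e_2=f_1f_2(e_1\circ e_2)+\langle e_1,e_2\rangle f_2\partial f_1+\langle e_1,\partial f_2\rangle f_1e_2-\langle e_2,\partial f_1\rangle f_2e_1$. $\mathcal{H}=S^\bullet(Z)\otimes H$ is an isotropic ideal of $\mathcal{L}$, and $\mathcal{V}=S^\bullet(Z)\otimes V$ is an $\mathcal{H}$-representation of $\mathcal{L}$ via $\nabla_{f_1e}(f_2v)=f_1(\langle e,\partial f_2\rangle v+f_2\,\tau(e)v)$; restricted to $L$ it is an $H$-representation of $L$. *)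

theory Defs
  imports Complex_Main "HOL-Library.Multiset" "HOL-Library.Poly_Mapping" "HOL-Library.Function_Algebras"
begin

section \<open>Linear algebra over a field 'k\<close>

text \<open>
  Vector spaces over 'k are given by an explicit scalar multiplication, as in the locale
  \<^locale>\<open>vector_space\<close> of the library.  The main result takes 'k of class
  \<^class>\<open>real_normed_field\<close>: by the Gelfand-Mazur theorem these are exactly the fields
  isomorphic to \<^typ>\<open>real\<close> or \<^typ>\<open>complex\<close>, and both types are instances.  Maps out of tensor powers are rendered as multilinear maps,
  maps out of symmetric powers as symmetric multilinear maps.
\<close>

definition linear_on ::
    "('k \<Rightarrow> 'a::ab_group_add \<Rightarrow> 'a) \<Rightarrow> ('k \<Rightarrow> 'b::ab_group_add \<Rightarrow> 'b) \<Rightarrow> 'a set \<Rightarrow> ('a \<Rightarrow> 'b) \<Rightarrow> bool" where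
  "linear_on sA sB S f \<longleftrightarrow>
     (\<forall>x\<in>S. \<forall>y\<in>S. f (x + y) = f x + f y) \<and> (\<forall>c. \<forall>x\<in>S. f (sA c x) = sB c (f x))"

definition bilinear_map ::
    "('k::field \<Rightarrow> 'a::ab_group_add \<Rightarrow> 'a) \<Rightarrow> ('k \<Rightarrow> 'b::ab_group_add \<Rightarrow> 'b) \<Rightarrow>
     ('k \<Rightarrow> 'c::ab_group_add \<Rightarrow> 'c) \<Rightarrow> ('a \<Rightarrow> 'b \<Rightarrow> 'c) \<Rightarrow> bool" where
  "bilinear_map sA sB sC b \<longleftrightarrow>
     (\<forall>y. Vector_Spaces.linear sA sC (\<lambda>x. b x y)) \<and> (\<forall>x. Vector_Spaces.linear sB sC (b x))"

definition k_algebra :: "('k::field \<Rightarrow> 'r::comm_ring_1 \<Rightarrow> 'r) \<Rightarrow> bool" where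
  "k_algebra sR \<longleftrightarrow> vector_space sR \<and> (\<forall>c x y. sR c (x * y) = sR c x * y)"

text \<open>
  The finitely supported functions from 'x to 'k are the free vector space on 'x; \<open>lin_ext s f\<close> is
  the linear extension of \<open>f\<close> from the basis to the free vector space.
\<close>

definition free_scale :: "'k::field \<Rightarrow> ('x \<Rightarrow>\<^sub>0 'k) \<Rightarrow> ('x \<Rightarrow>\<^sub>0 'k)" where
  "free_scale c p = Poly_Mapping.map ((*) c) p"

definition lin_ext :: "('k::field \<Rightarrow> 'a::ab_group_add \<Rightarrow> 'a) \<Rightarrow> ('x \<Rightarrow> 'a) \<Rightarrow> ('x \<Rightarrow>\<^sub>0 'k) \<Rightarrow> 'a" where
  "lin_ext s f p = (\<Sum>x\<in>Poly_Mapping.keys p. s (Poly_Mapping.lookup p x) (f x))"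

subsection \<open>Tensor products\<close>

definition tensor_relations ::
    "('k::field \<Rightarrow> 'a::ab_group_add \<Rightarrow> 'a) \<Rightarrow> ('k \<Rightarrow> 'b::ab_group_add \<Rightarrow> 'b) \<Rightarrow> ('a \<times> 'b \<Rightarrow>\<^sub>0 'k) set" where
  "tensor_relations sA sB =
     {Poly_Mapping.single (a + a', b) 1 - Poly_Mapping.single (a, b) 1 - Poly_Mapping.single (a', b) 1
        | a a' b. True} \<union>
     {Poly_Mapping.single (a, b + b') 1 - Poly_Mapping.single (a, b) 1 - Poly_Mapping.single (a, b') 1
        | a b b'. True} \<union>
     {Poly_Mapping.single (sA c a, b) 1 - Poly_Mapping.single (a, b) c | a b c. True} \<union>
     {Poly_Mapping.single (a, sB c b) 1 - Poly_Mapping.single (a, b) c | a b c. True}"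

text \<open>
  \<open>(T, t)\<close> is the tensor product of \<open>A\<close> and \<open>B\<close>: the canonical map from the free vector space on
  \<open>A \<times> B\<close> to \<open>T\<close> induces an isomorphism from the quotient by the bilinearity relations onto \<open>T\<close>.
  The quotient is presented this way, instead of as a set of cosets, so that \<open>T\<close> can be a type.
\<close>

definition is_tensor_product ::
    "('k::field \<Rightarrow> 'a::ab_group_add \<Rightarrow> 'a) \<Rightarrow> ('k \<Rightarrow> 'b::ab_group_add \<Rightarrow> 'b) \<Rightarrow>
     ('k \<Rightarrow> 't::ab_group_add \<Rightarrow> 't) \<Rightarrow> ('a \<Rightarrow> 'b \<Rightarrow> 't) \<Rightarrow> bool" where
  "is_tensor_product sA sB sT t \<longleftrightarrow>
     vector_space sA \<and> vector_space sB \<and> vector_space sT \<and>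
     surj (lin_ext sT (case_prod t)) \<and>
     (\<forall>p. lin_ext sT (case_prod t) p = 0 \<longleftrightarrow> p \<in> module.span free_scale (tensor_relations sA sB))"

text \<open>
  The linear map out of the tensor product \<open>(T, t)\<close> that is induced by a bilinear map \<open>b\<close>: represent
  the argument by a formal sum of pairs and apply \<open>b\<close> to each pair.  For bilinear \<open>b\<close> the result
  does not depend on the representative.
\<close>

definition induced ::
    "('k::field \<Rightarrow> 't::ab_group_add \<Rightarrow> 't) \<Rightarrow> ('a \<Rightarrow> 'b \<Rightarrow> 't) \<Rightarrow>
     ('k \<Rightarrow> 'c::ab_group_add \<Rightarrow> 'c) \<Rightarrow> ('a \<Rightarrow> 'b \<Rightarrow> 'c) \<Rightarrow> 't \<Rightarrow> 'c" where
  "induced sT t sC b x = lin_ext sC (case_prod b) (SOME p. lin_ext sT (case_prod t) p = x)"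

text \<open>The module structure \<open>f (g \<otimes> b) = f g \<otimes> b\<close> on a tensor product whose left factor is an algebra.\<close>

definition tensor_action ::
    "('k::field \<Rightarrow> 't::ab_group_add \<Rightarrow> 't) \<Rightarrow> ('r::comm_ring_1 \<Rightarrow> 'b \<Rightarrow> 't) \<Rightarrow> 'r \<Rightarrow> 't \<Rightarrow> 't" where
  "tensor_action sT t f = induced sT t sT (\<lambda>g b. t (f * g) b)"

subsection \<open>The symmetric algebra of a subspace\<close>

text \<open>
  The free commutative algebra on the set \<open>Z\<close> has the finite multisets in \<open>Z\<close> as basis (monomials).
  The ideal generated by the linearity relations of \<open>Z\<close> is the linear span of the multiples of
  these relations by monomials \<open>M\<close>.
\<close>

definition free_comm_algebra :: "'l set \<Rightarrow> ('l multiset \<Rightarrow>\<^sub>0 'k::field) set" where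
  "free_comm_algebra Z = {p. \<forall>M\<in>Poly_Mapping.keys p. set_mset M \<subseteq> Z}"

definition sym_relations :: "('k::field \<Rightarrow> 'l::ab_group_add \<Rightarrow> 'l) \<Rightarrow> 'l set \<Rightarrow> ('l multiset \<Rightarrow>\<^sub>0 'k) set" where
  "sym_relations s Z =
     {Poly_Mapping.single (add_mset (z + z') M) 1 - Poly_Mapping.single (add_mset z M) 1
        - Poly_Mapping.single (add_mset z' M) 1 | z z' M. z \<in> Z \<and> z' \<in> Z \<and> set_mset M \<subseteq> Z} \<union>
     {Poly_Mapping.single (add_mset (s c z) M) 1 - Poly_Mapping.single (add_mset z M) c
        | c z M. z \<in> Z \<and> set_mset M \<subseteq> Z}"

text \<open>
  \<open>(R, \<iota>)\<close> is the symmetric algebra of the subspace \<open>Z\<close>: evaluation of polynomials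
  induces an isomorphism from the free commutative algebra on \<open>Z\<close> modulo the ideal above onto \<open>R\<close>.
  Only the values of \<open>\<iota>\<close> on \<open>Z\<close> matter.
\<close>

definition is_symmetric_algebra ::
    "('k::field \<Rightarrow> 'l::ab_group_add \<Rightarrow> 'l) \<Rightarrow> 'l set \<Rightarrow> ('k \<Rightarrow> 'r::comm_ring_1 \<Rightarrow> 'r) \<Rightarrow> ('l \<Rightarrow> 'r) \<Rightarrow> bool" where
  "is_symmetric_algebra s Z sR \<iota> \<longleftrightarrow>
     k_algebra sR \<and>
     lin_ext sR (\<lambda>M. \<Prod>z\<in>#M. \<iota> z) ` free_comm_algebra Z = UNIV \<and>
     (\<forall>p\<in>free_comm_algebra Z.
        lin_ext sR (\<lambda>M. \<Prod>z\<in>#M. \<iota> z) p = 0 \<longleftrightarrow> p \<in> module.span free_scale (sym_relations s Z))"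

section \<open>Cochain complexes and their isomorphisms\<close>

text \<open>
  A complex consists of subspaces \<open>C n\<close> of one ambient vector space and of differentials \<open>d n\<close>,
  which are only relevant on \<open>C n\<close>.
\<close>

definition cochain_complex ::
    "('k::field \<Rightarrow> 'c::ab_group_add \<Rightarrow> 'c) \<Rightarrow> (nat \<Rightarrow> 'c set) \<Rightarrow> (nat \<Rightarrow> 'c \<Rightarrow> 'c) \<Rightarrow> bool" where
  "cochain_complex s C d \<longleftrightarrow>
     vector_space s \<and>
     (\<forall>n. module.subspace s (C n)) \<and>
     (\<forall>n. linear_on s s (C n) (d n)) \<and>
     (\<forall>n. d n ` C n \<subseteq> C (Suc n)) \<and>
     (\<forall>n. \<forall>x\<in>C n. d (Suc n) (d n x) = 0)"

definition isomorphic_complexes ::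
    "('k::field \<Rightarrow> 'c::ab_group_add \<Rightarrow> 'c) \<Rightarrow> (nat \<Rightarrow> 'c set) \<Rightarrow> (nat \<Rightarrow> 'c \<Rightarrow> 'c) \<Rightarrow>
     ('k \<Rightarrow> 'e::ab_group_add \<Rightarrow> 'e) \<Rightarrow> (nat \<Rightarrow> 'e set) \<Rightarrow> (nat \<Rightarrow> 'e \<Rightarrow> 'e) \<Rightarrow> bool" where
  "isomorphic_complexes s C d s' C' d' \<longleftrightarrow>
     cochain_complex s C d \<and> cochain_complex s' C' d' \<and>
     (\<exists>\<phi>. \<forall>n. linear_on s s' (C n) (\<phi> n) \<and> bij_betw (\<phi> n) (C n) (C' n) \<and>
        (\<forall>x\<in>C n. \<phi> (Suc n) (d n x) = d' n (\<phi> n x)))"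

section \<open>Families of multilinear maps and the standard differential\<close>

text \<open>
  \<open>\<omega> k es hs\<close> is the value of the component \<open>\<omega>\<^sub>k\<close> on \<open>es = [e\<^sub>1, \<dots>, e\<^bsub>n - 2 k\<^esub>]\<close> and
  \<open>hs = [h\<^sub>1, \<dots>, h\<^sub>k]\<close>.  A family is set to 0 on all other arguments, so that equality of
  families is equality of functions.
\<close>

type_synonym ('e, 'w) family = "nat \<Rightarrow> 'e list \<Rightarrow> 'e list \<Rightarrow> 'w"

definition args :: "nat \<Rightarrow> 'e set \<Rightarrow> nat \<Rightarrow> 'e list \<Rightarrow> 'e list \<Rightarrow> bool" where
  "args n H k es hs \<longleftrightarrow> length es + 2 * k = n \<and> length hs = k \<and> set hs \<subseteq> H"

definition family_scale :: "('k \<Rightarrow> 'w \<Rightarrow> 'w) \<Rightarrow> 'k \<Rightarrow> ('e, 'w) family \<Rightarrow> ('e, 'w) family" where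
  "family_scale sW c \<omega> = (\<lambda>k es hs. sW c (\<omega> k es hs))"

definition multilinear_families ::
    "('k::field \<Rightarrow> 'e::ab_group_add \<Rightarrow> 'e) \<Rightarrow> 'e set \<Rightarrow> ('k \<Rightarrow> 'w::ab_group_add \<Rightarrow> 'w) \<Rightarrow> nat \<Rightarrow>
     ('e, 'w) family set" where
  "multilinear_families sE H sW n = {\<omega>.
     (\<forall>k es hs. \<not> args n H k es hs \<longrightarrow> \<omega> k es hs = 0) \<and>
     (\<forall>k xs x ys hs. args n H k (xs @ x # ys) hs \<longrightarrow>
        Vector_Spaces.linear sE sW (\<lambda>e. \<omega> k (xs @ e # ys) hs)) \<and>
     (\<forall>k es us u vs. args n H k es (us @ u # vs) \<longrightarrow>
        linear_on sE sW H (\<lambda>h. \<omega> k es (us @ h # vs))) \<and>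
     (\<forall>k es hs hs'. args n H k es hs \<and> mset hs' = mset hs \<longrightarrow> \<omega> k es hs' = \<omega> k es hs)}"

definition omit :: "nat \<Rightarrow> 'a list \<Rightarrow> 'a list" where
  "omit i xs = take i xs @ drop (Suc i) xs"

text \<open>
  List positions count from 0, so the sign of position \<open>a\<close> is the usual one for the index \<open>a + 1\<close>.
\<close>

definition d_zero ::
    "('e \<Rightarrow> 'e \<Rightarrow> 'e) \<Rightarrow> ('e \<Rightarrow> 'w \<Rightarrow> 'w) \<Rightarrow> ('k::field \<Rightarrow> 'w::ab_group_add \<Rightarrow> 'w) \<Rightarrow>
     ('e, 'w) family \<Rightarrow> ('e, 'w) family" where
  "d_zero brk act sW \<omega> k es hs =
     (\<Sum>a<length es. sW ((-1) ^ a) (act (es ! a) (\<omega> k (omit a es) hs))) +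
     (\<Sum>a<length es. \<Sum>b\<in>{a<..<length es}.
        sW ((-1) ^ Suc a) (\<omega> k (omit a (es[b := brk (es ! a) (es ! b)])) hs))"

definition d_delta :: "('e, 'w::ab_group_add) family \<Rightarrow> ('e, 'w) family" where
  "d_delta \<omega> k es hs = (\<Sum>j<length hs. \<omega> (k - 1) (hs ! j # es) (omit j hs))"

definition d_prime ::
    "('e \<Rightarrow> 'e \<Rightarrow> 'e) \<Rightarrow> ('k::field \<Rightarrow> 'w::ab_group_add \<Rightarrow> 'w) \<Rightarrow> ('e, 'w) family \<Rightarrow> ('e, 'w) family" where
  "d_prime brk sW \<omega> k es hs =
     (\<Sum>a<length es. \<Sum>j<length hs.
        sW ((-1) ^ a) (\<omega> k (omit a es) (hs[j := brk (hs ! j) (es ! a)])))"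

text \<open>The differential on families of degree \<open>n\<close>.\<close>

definition standard_d ::
    "('e \<Rightarrow> 'e \<Rightarrow> 'e) \<Rightarrow> 'e set \<Rightarrow> ('e \<Rightarrow> 'w \<Rightarrow> 'w) \<Rightarrow> ('k::field \<Rightarrow> 'w::ab_group_add \<Rightarrow> 'w) \<Rightarrow>
     nat \<Rightarrow> ('e, 'w) family \<Rightarrow> ('e, 'w) family" where
  "standard_d brk H act sW n \<omega> = (\<lambda>k es hs.
     if args (Suc n) H k es hs
     then d_zero brk act sW \<omega> k es hs + d_delta \<omega> k es hs + d_prime brk sW \<omega> k es hs
     else 0)"

section \<open>Leibniz algebras\<close>

locale leibniz_algebra = vector_space sL
  for sL :: "'k::field \<Rightarrow> 'l::ab_group_add \<Rightarrow> 'l" +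
  fixes br :: "'l \<Rightarrow> 'l \<Rightarrow> 'l"
  assumes bracket_bilinear: "bilinear_map sL sL sL br"
    and left_leibniz: "br x (br y z) = br (br x y) z + br y (br x z)"

definition left_center :: "('l::ab_group_add \<Rightarrow> 'l \<Rightarrow> 'l) \<Rightarrow> 'l set" where
  "left_center br = {e. \<forall>e'. br e e' = 0}"

definition sym_bracket :: "('l::ab_group_add \<Rightarrow> 'l \<Rightarrow> 'l) \<Rightarrow> 'l \<Rightarrow> 'l \<Rightarrow> 'l" where
  "sym_bracket br e e' = br e e' + br e' e"

definition isotropic_ideal ::
    "('k::field \<Rightarrow> 'l::ab_group_add \<Rightarrow> 'l) \<Rightarrow> ('l \<Rightarrow> 'l \<Rightarrow> 'l) \<Rightarrow> 'l set \<Rightarrow> bool" where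
  "isotropic_ideal sL br H \<longleftrightarrow>
     module.subspace sL H \<and>
     (\<forall>e. \<forall>h\<in>H. br e h \<in> H \<and> br h e \<in> H) \<and>
     (\<forall>h\<in>H. \<forall>h'\<in>H. sym_bracket br h h' = 0)"

definition leibniz_representation ::
    "('k::field \<Rightarrow> 'l::ab_group_add \<Rightarrow> 'l) \<Rightarrow> ('l \<Rightarrow> 'l \<Rightarrow> 'l) \<Rightarrow> 'l set \<Rightarrow>
     ('k \<Rightarrow> 'v::ab_group_add \<Rightarrow> 'v) \<Rightarrow> ('l \<Rightarrow> 'v \<Rightarrow> 'v) \<Rightarrow> bool" where
  "leibniz_representation sL br H sV \<tau> \<longleftrightarrow>
     bilinear_map sL sV sV \<tau> \<and>
     (\<forall>x y v. \<tau> (br x y) v = \<tau> x (\<tau> y v) - \<tau> y (\<tau> x v)) \<and>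
     (\<forall>h\<in>H. \<forall>v. \<tau> h v = 0)"

definition leibniz_cochains ::
    "('k::field \<Rightarrow> 'l::ab_group_add \<Rightarrow> 'l) \<Rightarrow> ('l \<Rightarrow> 'l \<Rightarrow> 'l) \<Rightarrow> 'l set \<Rightarrow>
     ('k \<Rightarrow> 'w::ab_group_add \<Rightarrow> 'w) \<Rightarrow> nat \<Rightarrow> ('l, 'w) family set" where
  "leibniz_cochains sL br H sW n = {\<omega> \<in> multilinear_families sL H sW n.
     \<forall>k xs x y ys hs. args n H k (xs @ x # y # ys) hs \<longrightarrow>
       \<omega> k (xs @ x # y # ys) hs + \<omega> k (xs @ y # x # ys) hs =
         - \<omega> (Suc k) (xs @ ys) (sym_bracket br x y # hs)}"

section \<open>Cochains of Courant-Dorfman algebras\<close>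

text \<open>
  \<open>sE\<close> and \<open>sW\<close> are the scalar multiplications by the base field, \<open>rE\<close> and \<open>rW\<close> those by the
  commutative algebra 'r.  In the second condition \<open>x\<close> stands at position \<open>a\<close> and \<open>ys ! b\<close> at
  position \<open>a + 1 + b\<close>.
\<close>

definition courant_dorfman_cochains ::
    "('k::field \<Rightarrow> 'e::ab_group_add \<Rightarrow> 'e) \<Rightarrow> ('r::comm_ring_1 \<Rightarrow> 'e \<Rightarrow> 'e) \<Rightarrow>
     ('e \<Rightarrow> 'e \<Rightarrow> 'r) \<Rightarrow> ('r \<Rightarrow> 'e) \<Rightarrow> 'e set \<Rightarrow>
     ('k \<Rightarrow> 'w::ab_group_add \<Rightarrow> 'w) \<Rightarrow> ('r \<Rightarrow> 'w \<Rightarrow> 'w) \<Rightarrow> nat \<Rightarrow> ('e, 'w) family set" where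
  "courant_dorfman_cochains sE rE form der H sW rW n = {\<omega> \<in> multilinear_families sE H sW n.
     (\<forall>k xs x y ys hs. args n H k (xs @ x # y # ys) hs \<longrightarrow>
       \<omega> k (xs @ x # y # ys) hs + \<omega> k (xs @ y # x # ys) hs =
         - \<omega> (Suc k) (xs @ ys) (der (form x y) # hs)) \<and>
     (\<forall>k xs x ys hs f. args n H k (xs @ x # ys) hs \<longrightarrow>
       \<omega> k (xs @ rE f x # ys) hs =
         rW f (\<omega> k (xs @ x # ys) hs) +
         (\<Sum>b<length ys. sW ((-1) ^ Suc b)
            (rW (form x (ys ! b)) (\<omega> (Suc k) (xs @ omit b ys) (der f # hs))))) \<and>
     (\<forall>k es us h vs f. args n H k es (us @ h # vs) \<longrightarrow>
       \<omega> k es (us @ rE f h # vs) = rW f (\<omega> k es (us @ h # vs)))}"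

section \<open>The crossed product\<close>

text \<open>
  Throughout, \<open>(sR, \<iota>)\<close> is the symmetric algebra of the left center of the Leibniz bracket \<open>br\<close>, and
  \<open>(sM, t)\<close> is the tensor product of this algebra with the Leibniz algebra, so that \<open>t f e\<close> is the
  element \<open>f e\<close> of the crossed product.
\<close>

definition crossed_form ::
    "('l::ab_group_add \<Rightarrow> 'l \<Rightarrow> 'l) \<Rightarrow> ('k::field \<Rightarrow> 'r::comm_ring_1 \<Rightarrow> 'r) \<Rightarrow> ('l \<Rightarrow> 'r) \<Rightarrow>
     ('k \<Rightarrow> 'm::ab_group_add \<Rightarrow> 'm) \<Rightarrow> ('r \<Rightarrow> 'l \<Rightarrow> 'm) \<Rightarrow> 'm \<Rightarrow> 'm \<Rightarrow> 'r" where
  "crossed_form br sR \<iota> sM t x y =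
     induced sM t sR (\<lambda>f\<^sub>1 e\<^sub>1. induced sM t sR (\<lambda>f\<^sub>2 e\<^sub>2. f\<^sub>1 * f\<^sub>2 * \<iota> (sym_bracket br e\<^sub>1 e\<^sub>2)) y) x"

text \<open>
  The derivation is given on monomials by the Leibniz rule and \<open>\<partial>z = 1 \<otimes> z\<close>; its argument is
  represented by a polynomial in the elements of the left center.
\<close>

definition crossed_der ::
    "('l::ab_group_add \<Rightarrow> 'l \<Rightarrow> 'l) \<Rightarrow> ('k::field \<Rightarrow> 'r::comm_ring_1 \<Rightarrow> 'r) \<Rightarrow> ('l \<Rightarrow> 'r) \<Rightarrow>
     ('k \<Rightarrow> 'm::ab_group_add \<Rightarrow> 'm) \<Rightarrow> ('r \<Rightarrow> 'l \<Rightarrow> 'm) \<Rightarrow> 'r \<Rightarrow> 'm" where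
  "crossed_der br sR \<iota> sM t f =
     lin_ext sM (\<lambda>M. \<Sum>z\<in>#M. tensor_action sM t (\<Prod>w\<in>#M - {#z#}. \<iota> w) (t 1 z))
       (SOME p. p \<in> free_comm_algebra (left_center br) \<and> lin_ext sR (\<lambda>M. \<Prod>z\<in>#M. \<iota> z) p = f)"

definition crossed_bracket ::
    "('l::ab_group_add \<Rightarrow> 'l \<Rightarrow> 'l) \<Rightarrow> ('k::field \<Rightarrow> 'r::comm_ring_1 \<Rightarrow> 'r) \<Rightarrow> ('l \<Rightarrow> 'r) \<Rightarrow>
     ('k \<Rightarrow> 'm::ab_group_add \<Rightarrow> 'm) \<Rightarrow> ('r \<Rightarrow> 'l \<Rightarrow> 'm) \<Rightarrow> 'm \<Rightarrow> 'm \<Rightarrow> 'm" where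
  "crossed_bracket br sR \<iota> sM t x y =
     induced sM t sM (\<lambda>f\<^sub>1 e\<^sub>1. induced sM t sM (\<lambda>f\<^sub>2 e\<^sub>2.
       t (f\<^sub>1 * f\<^sub>2) (br e\<^sub>1 e\<^sub>2)
       + tensor_action sM t (crossed_form br sR \<iota> sM t (t 1 e\<^sub>1) (t 1 e\<^sub>2) * f\<^sub>2) (crossed_der br sR \<iota> sM t f\<^sub>1)
       + t (crossed_form br sR \<iota> sM t (t 1 e\<^sub>1) (crossed_der br sR \<iota> sM t f\<^sub>2) * f\<^sub>1) e\<^sub>2
       - t (crossed_form br sR \<iota> sM t (t 1 e\<^sub>2) (crossed_der br sR \<iota> sM t f\<^sub>1) * f\<^sub>2) e\<^sub>1) y) x"

text \<open>
  Since tensoring over a field is exact, the tensor product of the symmetric algebra with the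
  subspace \<open>H\<close> is this subspace of the crossed product.
\<close>

definition extended_ideal ::
    "('k::field \<Rightarrow> 'm::ab_group_add \<Rightarrow> 'm) \<Rightarrow> ('r \<Rightarrow> 'l \<Rightarrow> 'm) \<Rightarrow> 'l set \<Rightarrow> 'm set" where
  "extended_ideal sM t H = module.span sM {t f h | f h. h \<in> H}"

text \<open>
  The induced action on \<open>(sW, tV)\<close>, the tensor product of the symmetric algebra with the
  representation \<open>\<tau>\<close>.
\<close>

definition extended_action ::
    "('l::ab_group_add \<Rightarrow> 'l \<Rightarrow> 'l) \<Rightarrow> ('k::field \<Rightarrow> 'r::comm_ring_1 \<Rightarrow> 'r) \<Rightarrow> ('l \<Rightarrow> 'r) \<Rightarrow>
     ('k \<Rightarrow> 'm::ab_group_add \<Rightarrow> 'm) \<Rightarrow> ('r \<Rightarrow> 'l \<Rightarrow> 'm) \<Rightarrow>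
     ('l \<Rightarrow> 'v \<Rightarrow> 'v) \<Rightarrow> ('k \<Rightarrow> 'w::ab_group_add \<Rightarrow> 'w) \<Rightarrow> ('r \<Rightarrow> 'v \<Rightarrow> 'w) \<Rightarrow> 'm \<Rightarrow> 'w \<Rightarrow> 'w" where
  "extended_action br sR \<iota> sM t \<tau> sW tV x w =
     induced sM t sW (\<lambda>f\<^sub>1 e. induced sW tV sW (\<lambda>f\<^sub>2 v.
       tensor_action sW tV f\<^sub>1
         (tV (crossed_form br sR \<iota> sM t (t 1 e) (crossed_der br sR \<iota> sM t f\<^sub>2)) v + tV f\<^sub>2 (\<tau> e v))) w) x"

end

theory Submission
  imports Defs
begin

text \<open>
  Restricting a cochain of the crossed product to \<open>L\<close> commutes with the differentials, because
  \<open>e \<mapsto> 1 \<otimes> e\<close> preserves the brackets, the ideals and the actions.  Conversely a cochain on \<open>L\<close> has exactly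
  one extension: writing \<open>i\<^sub>e\<close> for the insertion of \<open>e\<close> in the first slot and \<open>j\<^sub>h\<close> for the insertion of
  \<open>h \<in> H\<close>, the second axiom of cochains reads
  \<open>i\<^bsub>f e\<^esub> \<omega> = f i\<^sub>e \<omega> + \<langle>e, \<cdot>\<rangle> \<and> j\<^bsub>\<partial>f\<^esub> \<omega>\<close>, which determines \<open>\<omega>\<close> recursively from its values on \<open>L\<close>.

  That the differential preserves cochains and squares to zero rests on Cartan's formula
  \<open>i\<^sub>e d + d i\<^sub>e = L\<^sub>e\<close>: since a cochain is determined by its insertions and its values on no arguments from \<open>L\<close>,
  identities between operators follow by induction on the degree from their commutators with \<open>i\<^sub>e\<close>.
\<close>

section \<open>Sums over the elements of a list\<close>

text \<open>A Courant-Dorfman algebra is in particular a Leibniz algebra, and its cochains are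
  Leibniz cochains that satisfy two more conditions over R. Hence the Leibniz calculus is developed
  once and used twice, for L and for the crossed product, and d^2 = 0 needs no second proof.

  The arguments from H are the obstacle. The commutator of d with j_h is i_h when h acts by zero
  from the left. This is enough, as the cochain axioms themselves insert only (x, y) and \<partial>f
  into these slots, and both are left central.

  A direct proof that extension commutes with d would have to follow the recursion through every
  \<partial>f. Instead, extending d \<omega> and applying d to the extension of \<omega> give two
  cochains with the same restriction, and a cochain with zero restriction vanishes. The price is
  that d must be known beforehand to preserve the conditions over R, and this is where the formula
  for L_{f e} does the work.\<close>

text \<open>The entry and the list without it are passed together, so sums over pairs of distinct
  positions become nested sums with no index arithmetic.\<close>

primrec hsum :: "('a \<Rightarrow> 'a list \<Rightarrow> 'b::comm_monoid_add) \<Rightarrow> 'a list \<Rightarrow> 'b" where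
  "hsum F [] = 0"
| "hsum F (h # hs) = F h hs + hsum (\<lambda>x r. F x (h # r)) hs"

lemma omit_Cons_0 [simp]: "omit 0 (x # xs) = xs"
  by (simp add: omit_def)

lemma omit_Cons_Suc [simp]: "omit (Suc i) (x # xs) = x # omit i xs"
  by (simp add: omit_def)

lemma length_omit: "i < length xs \<Longrightarrow> length (omit i xs) = length xs - 1"
  by (simp add: omit_def)

lemma length_omit_le: "length (omit i xs) \<le> length xs"
  by (simp add: omit_def)

lemma mset_omit: "i < length xs \<Longrightarrow> mset xs = add_mset (xs ! i) (mset (omit i xs))"
proof (induction xs arbitrary: i)
  case (Cons a xs)
  then show ?case by (cases i) (auto simp: add_mset_commute)
qed simp

lemma mset_list_update_omit:
  "i < length xs \<Longrightarrow> mset (xs[i := y]) = add_mset y (mset (omit i xs))"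
proof (induction xs arbitrary: i)
  case (Cons a xs)
  then show ?case by (cases i) (auto simp: add_mset_commute)
qed simp

lemma hsum_conv_sum: "hsum F hs = (\<Sum>j<length hs. F (hs ! j) (omit j hs))"
  by (induction hs arbitrary: F) (simp_all add: sum.lessThan_Suc_shift del: sum.lessThan_Suc)

text \<open>The hypothesis keeps only the multiset of the list, which is all that is needed to see
  that the removed entry and the rest still lie in H and that the length drops by one.\<close>

lemma hsum_cong:
  assumes "\<And>x r. mset hs = add_mset x (mset r) \<Longrightarrow> F x r = G x r"
  shows "hsum F hs = hsum G hs"
  unfolding hsum_conv_sum by (rule sum.cong) (auto intro!: assms mset_omit)

lemma hsum_hom:
  assumes "T 0 = 0" "\<And>x y. T (x + y) = T x + T y"
  shows "T (hsum F hs) = hsum (\<lambda>x r. T (F x r)) hs"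
  by (induction hs arbitrary: F) (simp_all add: assms)

lemma hsum_add: "hsum (\<lambda>x r. F x r + G x r) hs = hsum F hs + hsum G hs"
  by (simp add: hsum_conv_sum sum.distrib)

lemma hsum_diff:
  fixes F :: "'a \<Rightarrow> 'a list \<Rightarrow> 'b::ab_group_add"
  shows "hsum (\<lambda>x r. F x r - G x r) hs = hsum F hs - hsum G hs"
  by (simp add: hsum_conv_sum sum_subtractf)

lemma hsum_minus:
  fixes F :: "'a \<Rightarrow> 'a list \<Rightarrow> 'b::ab_group_add"
  shows "hsum (\<lambda>x r. - F x r) hs = - hsum F hs"
  by (simp add: hsum_conv_sum sum_negf)

lemma hsum_zero [simp]: "hsum (\<lambda>x r. 0) hs = 0"
  by (simp add: hsum_conv_sum)

text \<open>Both sides run over ordered pairs of distinct positions, and the list that is left does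
  not depend on which of the two positions is removed first.\<close>

lemma hsum_swap:
  "hsum (\<lambda>x. hsum (\<lambda>y. P x y)) hs = hsum (\<lambda>x. hsum (\<lambda>y. P y x)) hs"
proof (induction hs arbitrary: P)
  case (Cons h hs)
  have "hsum (\<lambda>x r. hsum (\<lambda>y s. P x y (h # s)) r) hs = hsum (\<lambda>x r. hsum (\<lambda>y s. P y x (h # s)) r) hs"
    by (rule Cons.IH)
  then show ?case
    by (simp add: hsum_add add.left_commute)
qed simp

text \<open>The pairs (x, y) and (y, x) cancel; they are matched by induction, so nothing is divided
  by 2.\<close>

lemma hsum_alternating:
  fixes Q :: "'a \<Rightarrow> 'a \<Rightarrow> 'a list \<Rightarrow> 'b::ab_group_add"
  assumes "\<And>x y s. mset hs = add_mset x (add_mset y (mset s)) \<Longrightarrow> Q x y s + Q y x s = 0"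
  shows "hsum (\<lambda>x. hsum (\<lambda>y. Q x y)) hs = 0"
  using assms
proof (induction hs arbitrary: Q)
  case (Cons h hs)
  have 1: "hsum (\<lambda>x r. hsum (\<lambda>y s. Q x y (h # s)) r) hs = 0"
    by (intro Cons.IH Cons.prems) (simp add: add_mset_commute)
  have "hsum (\<lambda>y s. Q h y s + Q y h s) hs = hsum (\<lambda>y s. 0) hs"
    by (intro hsum_cong Cons.prems) simp
  then show ?case
    using 1 by (simp add: hsum_add)
qed simp

lemma hsum_perm:
  assumes sym: "\<And>x r r'. mset r = mset r' \<Longrightarrow> F x r = F x r'" and eq: "mset hs = mset hs'"
  shows "hsum F hs = hsum F hs'"
proof -
  \<comment> \<open>\<open>l\<close> picks one list for each multiset. As \<open>F\<close> sees the
    remaining entries only up to order, both sums become the same sum over a multiset.\<close>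
  define l :: "'a multiset \<Rightarrow> 'a list" where "l M = (SOME xs. mset xs = M)" for M
  have l: "mset (l M) = M" for M
    unfolding l_def by (rule someI_ex) (rule ex_mset)
  have gen: "hsum F hs = (\<Sum>x\<in>#mset hs. F x (l (mset hs - {#x#})))"
    if "\<And>x r r'. mset r = mset r' \<Longrightarrow> F x r = F x r'" for F :: "'a \<Rightarrow> 'a list \<Rightarrow> 'b" and hs
    using that
  proof (induction hs arbitrary: F)
    case Nil
    show ?case by simp
  next
    case (Cons h hs)
    have "hsum (\<lambda>x r. F x (h # r)) hs = (\<Sum>x\<in>#mset hs. F x (h # l (mset hs - {#x#})))"
      by (intro Cons.IH Cons.prems) simp
    also have "\<dots> = (\<Sum>x\<in>#mset hs. F x (l (add_mset h (mset hs) - {#x#})))"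
    proof (rule arg_cong[of _ _ sum_mset], rule image_mset_cong)
      fix x assume "x \<in># mset hs"
      then show "F x (h # l (mset hs - {#x#})) = F x (l (add_mset h (mset hs) - {#x#}))"
        by (intro Cons.prems) (simp add: l)
    qed
    moreover have "F h hs = F h (l (mset hs))"
      by (rule Cons.prems) (simp add: l)
    ultimately show ?case by simp
  qed
  have "hsum F hs = (\<Sum>x\<in>#mset hs. F x (l (mset hs - {#x#})))"
    by (rule gen) (rule sym)
  moreover have "hsum F hs' = (\<Sum>x\<in>#mset hs'. F x (l (mset hs' - {#x#})))"
    by (rule gen) (rule sym)
  ultimately show ?thesis by (simp only: eq)
qed

section \<open>The standard complex of a Leibniz algebra\<close>

text \<open>The operators i_e and, below, j_h of the overview. They are total: neither the degree of
  the family nor membership in H is checked, so they commute by definition.\<close>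

definition contr :: "'e \<Rightarrow> ('e, 'w) family \<Rightarrow> ('e, 'w) family" where
  "contr e \<omega> = (\<lambda>k es. \<omega> k (e # es))"

definition hcontr :: "'e \<Rightarrow> ('e, 'w) family \<Rightarrow> ('e, 'w) family" where
  "hcontr h \<omega> = (\<lambda>k es hs. \<omega> (Suc k) es (h # hs))"

lemma contr_apply [simp]: "contr e \<omega> k es hs = \<omega> k (e # es) hs"
  by (simp add: contr_def)

lemma hcontr_apply [simp]: "hcontr h \<omega> k es hs = \<omega> (Suc k) es (h # hs)"
  by (simp add: hcontr_def)

lemma family_scale_apply [simp]: "family_scale s c \<omega> k es hs = s c (\<omega> k es hs)"
  by (simp add: family_scale_def)

lemma contr_hcontr: "contr e (hcontr h \<omega>) = hcontr h (contr e \<omega>)"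
  by (simp add: fun_eq_iff)

lemma contr_zero [simp]: "contr e 0 = 0"
  and contr_add: "contr e (\<omega> + \<eta>) = contr e \<omega> + contr e \<eta>"
  and contr_diff: "contr e (\<omega>' - \<eta>') = contr e \<omega>' - contr e \<eta>'"
  and contr_minus: "contr e (- \<omega>') = - contr e \<omega>'"
  and contr_scale: "contr e (family_scale s c \<omega>) = family_scale s c (contr e \<omega>)"
  by (simp_all add: fun_eq_iff)

lemma hcontr_zero [simp]: "hcontr h 0 = 0"
  and hcontr_add: "hcontr h (\<omega> + \<eta>) = hcontr h \<omega> + hcontr h \<eta>"
  and hcontr_diff: "hcontr h (\<omega>' - \<eta>') = hcontr h \<omega>' - hcontr h \<eta>'"
  and hcontr_minus: "hcontr h (- \<omega>') = - hcontr h \<omega>'"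
  and hcontr_scale: "hcontr h (family_scale s c \<omega>) = family_scale s c (hcontr h \<omega>)"
  by (simp_all add: fun_eq_iff)

lemma family_apply: "\<omega> = \<eta> \<Longrightarrow> \<omega> k es hs = \<eta> k es hs"
  by simp

lemma family_ext:
  assumes "\<And>k hs. \<omega> k [] hs = \<eta> k [] hs" and "\<And>y. contr y \<omega> = contr y \<eta>"
  shows "\<omega> = \<eta>"
proof (intro ext)
  fix k es hs
  show "\<omega> k es hs = \<eta> k es hs"
  proof (cases es)
    case (Cons e es')
    then show ?thesis using family_apply[OF assms(2)[of e], of k es' hs] by simp
  qed (simp add: assms)
qed

section \<open>The symmetric bracket and the left center\<close>

context leibniz_algebra
begin

lemma br_add_left: "br (x + y) z = br x z + br y z"
  and br_add_right: "br z (x + y) = br z x + br z y"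
  and br_scale_left: "br (sL c x) z = sL c (br x z)"
  and br_scale_right: "br z (sL c x) = sL c (br z x)"
  using bracket_bilinear by (simp_all add: bilinear_map_def Vector_Spaces.linear_iff)

lemma sym_bracket_commute: "sym_bracket br x y = sym_bracket br y x"
  by (simp add: sym_bracket_def)

text \<open>Left multiplication is a derivation of the bracket, hence of its symmetrization.\<close>

lemma br_sym_bracket: "br e (sym_bracket br x y) = sym_bracket br (br e x) y + sym_bracket br x (br e y)"
  unfolding sym_bracket_def br_add_right left_leibniz[of e x y] left_leibniz[of e y x]
  by (simp add: algebra_simps)

text \<open>Left multiplication by x \<circ> y is the commutator of the left multiplications by x
  and y, so the contributions of x \<circ> y and y \<circ> x cancel.\<close>

lemma sym_bracket_left_center: "br (sym_bracket br x y) e = 0"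
  unfolding sym_bracket_def br_add_left using left_leibniz[of x y e] left_leibniz[of y x e]
  by (simp add: algebra_simps)

lemma subspace_left_center: "subspace (left_center br)"
proof -
  have "br 0 e = 0" for e using br_add_left[of 0 0 e] by simp
  then show ?thesis by (intro subspaceI) (simp_all add: left_center_def br_add_left br_scale_left)
qed

lemma sym_bracket_in_left_center: "sym_bracket br x y \<in> left_center br"
  by (simp add: left_center_def sym_bracket_left_center)

end

text \<open>The condition on symmetric brackets takes the place of
  \<open>left_center br \<subseteq> H\<close>: for the crossed product it reads
  \<partial>\<langle>x, y\<rangle> \<in> H and can be verified without determining the left
  center.\<close>

locale leibniz_complex = leibniz_algebra sL br
  for sL :: "'k::field \<Rightarrow> 'l::ab_group_add \<Rightarrow> 'l" and br +
  fixes H :: "'l set" and sW :: "'k \<Rightarrow> 'w::ab_group_add \<Rightarrow> 'w" and act :: "'l \<Rightarrow> 'w \<Rightarrow> 'w"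
  assumes ideal: "isotropic_ideal sL br H"
    and sym_bracket_in_H: "sym_bracket br x y \<in> H"
    and representation: "leibniz_representation sL br H sW act"
begin

sublocale W: vector_space sW
  using representation by (auto simp: leibniz_representation_def bilinear_map_def Vector_Spaces.linear_iff)

lemma act_add_left: "act (x + y) v = act x v + act y v"
  and act_add_right: "act x (v + w) = act x v + act x w"
  and act_scale_left: "act (sL c x) v = sW c (act x v)"
  and act_scale_right: "act x (sW c v) = sW c (act x v)"
  using representation by (simp_all add: leibniz_representation_def bilinear_map_def Vector_Spaces.linear_iff)

lemma act_zero_right [simp]: "act x 0 = 0"
  using act_scale_right[of x 0 0] by simp

lemma act_diff_right: "act x (v - w) = act x v - act x w"
  using act_add_right[of x "v - w" w] by (simp add: algebra_simps)

lemma act_br: "act (br x y) v = act x (act y v) - act y (act x v)"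
  and act_H: "h \<in> H \<Longrightarrow> act h v = 0"
  using representation by (simp_all add: leibniz_representation_def)

lemma H_subspace: "subspace H"
  and br_H_left: "h \<in> H \<Longrightarrow> br h e \<in> H"
  and br_H_right: "h \<in> H \<Longrightarrow> br e h \<in> H"
  and H_isotropic: "h \<in> H \<Longrightarrow> h' \<in> H \<Longrightarrow> sym_bracket br h h' = 0"
  using ideal by (auto simp: isotropic_ideal_def)

section \<open>Cochains and insertion of arguments\<close>

abbreviation cochains :: "nat \<Rightarrow> ('l, 'w) family set" where
  "cochains \<equiv> leibniz_cochains sL br H sW"

text \<open>Only the arguments from H are restricted. A condition on \<open>es\<close> would involve
  the degree, which changes under insertion.\<close>

abbreviation ok :: "nat \<Rightarrow> 'l list \<Rightarrow> bool" where
  "ok k hs \<equiv> length hs = k \<and> set hs \<subseteq> H"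

lemma cochain_zero_outside: "\<omega> \<in> cochains n \<Longrightarrow> \<not> args n H k es hs \<Longrightarrow> \<omega> k es hs = 0"
  by (simp add: leibniz_cochains_def multilinear_families_def)

lemma cochain_zero_not_ok: "\<omega> \<in> cochains n \<Longrightarrow> \<not> ok k hs \<Longrightarrow> \<omega> k es hs = 0"
  by (erule cochain_zero_outside) (auto simp: args_def)

text \<open>Whether \<open>args\<close> holds depends only on the multiset of the arguments from H,
  so outside it both sides are zero. The same device frees the following rules from side conditions
  on the degree, so that they can be used for rewriting.\<close>

lemma cochain_sym:
  assumes "\<omega> \<in> cochains n" "mset hs' = mset hs"
  shows "\<omega> k es hs' = \<omega> k es hs"
proof (cases "args n H k es hs")
  case False
  moreover have "\<not> args n H k es hs'"
    using False mset_eq_setD[OF assms(2)] mset_eq_length[OF assms(2)] by (simp add: args_def)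
  ultimately show ?thesis using assms(1) by (simp add: cochain_zero_outside)
next
  case True
  then show ?thesis using assms unfolding leibniz_cochains_def multilinear_families_def by blast
qed

lemma cochain_hadd:
  assumes "\<omega> \<in> cochains n" "h \<in> H" "h' \<in> H"
  shows "\<omega> k es ((h + h') # hs) = \<omega> k es (h # hs) + \<omega> k es (h' # hs)"
proof (cases "args n H k es (h # hs)")
  case False
  then have "\<not> args n H k es (h' # hs)" "\<not> args n H k es ((h + h') # hs)"
    using assms(2,3) by (auto simp: args_def)
  with False show ?thesis using assms(1) by (simp add: cochain_zero_outside)
next
  case True
  then have "args n H k es ([] @ h # hs)" by simp
  then have "linear_on sL sW H (\<lambda>h. \<omega> k es ([] @ h # hs))"
    using assms(1) unfolding leibniz_cochains_def multilinear_families_def by blast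
  then show ?thesis using assms(2,3) by (simp add: linear_on_def)
qed

lemma cochain_hscale:
  assumes "\<omega> \<in> cochains n" "h \<in> H"
  shows "\<omega> k es (sL c h # hs) = sW c (\<omega> k es (h # hs))"
proof (cases "args n H k es (h # hs)")
  case False
  then have "\<not> args n H k es (sL c h # hs)"
    using assms(2) subspace_scale[OF H_subspace] by (auto simp: args_def)
  with False show ?thesis using assms(1) by (simp add: cochain_zero_outside)
next
  case True
  then have "args n H k es ([] @ h # hs)" by simp
  then have "linear_on sL sW H (\<lambda>h. \<omega> k es ([] @ h # hs))"
    using assms(1) unfolding leibniz_cochains_def multilinear_families_def by blast
  then show ?thesis using assms(2) by (simp add: linear_on_def)
qed

lemma hcontr_add_left:
  "\<omega> \<in> cochains n \<Longrightarrow> h \<in> H \<Longrightarrow> h' \<in> H \<Longrightarrow> hcontr (h + h') \<omega> = hcontr h \<omega> + hcontr h' \<omega>"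
  by (simp add: fun_eq_iff cochain_hadd)

lemma hcontr_scale_left:
  "\<omega> \<in> cochains n \<Longrightarrow> h \<in> H \<Longrightarrow> hcontr (sL c h) \<omega> = family_scale sW c (hcontr h \<omega>)"
  by (simp add: fun_eq_iff cochain_hscale)

lemma hcontr_zero_left:
  assumes "\<omega> \<in> cochains n"
  shows "hcontr 0 \<omega> = 0"
  using hcontr_scale_left[OF assms subspace_0[OF H_subspace], of 0] by (simp add: fun_eq_iff)

lemma hcontr_commute:
  "\<omega> \<in> cochains n \<Longrightarrow> hcontr h (hcontr h' \<omega>) = hcontr h' (hcontr h \<omega>)"
  by (intro ext, unfold hcontr_apply, erule cochain_sym) (simp add: add_mset_commute)

lemma cochain_linear_head:
  assumes "\<omega> \<in> cochains n"
  shows "Vector_Spaces.linear sL sW (\<lambda>e. \<omega> k (e # es) hs)"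
proof (cases "args n H k (0 # es) hs")
  case False
  then have "\<not> args n H k (x # es) hs" for x by (simp add: args_def)
  then have "\<omega> k (x # es) hs = 0" for x using assms by (simp add: cochain_zero_outside)
  then show ?thesis by (simp add: Vector_Spaces.linear_iff vector_space_axioms W.vector_space_axioms)
next
  case True
  then have "args n H k ([] @ 0 # es) hs" by simp
  then have "Vector_Spaces.linear sL sW (\<lambda>e. \<omega> k ([] @ e # es) hs)"
    using assms unfolding leibniz_cochains_def multilinear_families_def by blast
  then show ?thesis by simp
qed

lemma contr_add_left:
  "\<omega> \<in> cochains n \<Longrightarrow> contr (x + y) \<omega> = contr x \<omega> + contr y \<omega>"
  using cochain_linear_head by (auto simp: fun_eq_iff Vector_Spaces.linear_iff)

lemma contr_scale_left:
  "\<omega> \<in> cochains n \<Longrightarrow> contr (sL c x) \<omega> = family_scale sW c (contr x \<omega>)"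
  using cochain_linear_head by (auto simp: fun_eq_iff Vector_Spaces.linear_iff)

text \<open>The cochain condition on two neighbouring arguments, taken at the head of the list,
  becomes an anticommutation relation of Clifford type.\<close>

lemma contr_anticommute:
  assumes "\<omega> \<in> cochains n"
  shows "contr y (contr x \<omega>) + contr x (contr y \<omega>) = - hcontr (sym_bracket br x y) \<omega>"
proof (intro ext)
  fix k es hs
  show "(contr y (contr x \<omega>) + contr x (contr y \<omega>)) k es hs = (- hcontr (sym_bracket br x y) \<omega>) k es hs"
  proof (cases "args n H k ([] @ x # y # es) hs")
    case True
    then have "\<omega> k ([] @ x # y # es) hs + \<omega> k ([] @ y # x # es) hs =
        - \<omega> (Suc k) ([] @ es) (sym_bracket br x y # hs)"
      using assms unfolding leibniz_cochains_def by blast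
    then show ?thesis by simp
  next
    case False
    then have "\<not> args n H k (x # y # es) hs" "\<not> args n H k (y # x # es) hs"
      "\<not> args n H (Suc k) es (sym_bracket br x y # hs)"
      by (auto simp: args_def)
    then show ?thesis using assms by (simp add: cochain_zero_outside)
  qed
qed

lemma contr_cochains:
  assumes "\<omega> \<in> cochains (Suc n)"
  shows "contr x \<omega> \<in> cochains n"
proof -
  have a: "args (Suc n) H k (x # es) hs \<longleftrightarrow> args n H k es hs" for k es hs
    by (simp add: args_def)
  have M: "\<omega> \<in> multilinear_families sL H sW (Suc n)"
    using assms by (simp add: leibniz_cochains_def)
  have "Vector_Spaces.linear sL sW (\<lambda>e. \<omega> k (x # xs @ e # ys) hs)"
    if "args n H k (xs @ y # ys) hs" for k xs y ys hs
  proof -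
    have "args (Suc n) H k ((x # xs) @ y # ys) hs" using that by (simp add: a)
    then have "Vector_Spaces.linear sL sW (\<lambda>e. \<omega> k ((x # xs) @ e # ys) hs)"
      using M unfolding multilinear_families_def by blast
    then show ?thesis by simp
  qed
  moreover have "linear_on sL sW H (\<lambda>h. \<omega> k (x # es) (us @ h # vs))"
    if "args n H k es (us @ u # vs)" for k es us u vs
    using M that[folded a] unfolding multilinear_families_def by blast
  moreover have "\<omega> k (x # es) hs = 0" if "\<not> args n H k es hs" for k es hs
    using M that[folded a] unfolding multilinear_families_def by blast
  moreover have "\<omega> k (x # es) hs' = \<omega> k (x # es) hs" if "args n H k es hs" "mset hs' = mset hs" for k es hs hs'
    using M that(1)[folded a] that(2) unfolding multilinear_families_def by blast
  ultimately have "contr x \<omega> \<in> multilinear_families sL H sW n"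
    unfolding multilinear_families_def contr_apply mem_Collect_eq by blast
  moreover have "\<omega> k (x # xs @ y # z # ys) hs + \<omega> k (x # xs @ z # y # ys) hs =
      - \<omega> (Suc k) (x # xs @ ys) (sym_bracket br y z # hs)"
    if "args n H k (xs @ y # z # ys) hs" for k xs y z ys hs
  proof -
    have "args (Suc n) H k ((x # xs) @ y # z # ys) hs" using that by (simp add: a)
    then have "\<omega> k ((x # xs) @ y # z # ys) hs + \<omega> k ((x # xs) @ z # y # ys) hs =
        - \<omega> (Suc k) ((x # xs) @ ys) (sym_bracket br y z # hs)"
      using assms unfolding leibniz_cochains_def by blast
    then show ?thesis by simp
  qed
  ultimately show ?thesis
    unfolding leibniz_cochains_def contr_apply mem_Collect_eq by blast
qed

lemma contr_cochains_0: "\<omega> \<in> cochains 0 \<Longrightarrow> contr x \<omega> = 0"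
  by (simp add: fun_eq_iff cochain_zero_outside args_def)

text \<open>Since the insertions are cochains of degree \<open>n - 1\<close>, every condition at a
  later argument is inherited from them; what remains is linearity and skew-symmetry at the head,
  and the behaviour in H on the empty list. Together with induction on the degree this criterion
  shows that an operator preserves cochains.\<close>

lemma cochains_I:
  assumes supp: "\<And>k es hs. \<not> args n H k es hs \<Longrightarrow> \<omega> k es hs = 0"
    and sym: "\<And>k hs hs'. ok k hs \<Longrightarrow> mset hs' = mset hs \<Longrightarrow> \<omega> k [] hs' = \<omega> k [] hs"
    and hadd: "\<And>k h h' hs. h \<in> H \<Longrightarrow> h' \<in> H \<Longrightarrow> ok k hs \<Longrightarrow>
      \<omega> (Suc k) [] ((h + h') # hs) = \<omega> (Suc k) [] (h # hs) + \<omega> (Suc k) [] (h' # hs)"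
    and hscale: "\<And>k c h hs. h \<in> H \<Longrightarrow> ok k hs \<Longrightarrow>
      \<omega> (Suc k) [] (sL c h # hs) = sW c (\<omega> (Suc k) [] (h # hs))"
    and add: "\<And>x y. contr (x + y) \<omega> = contr x \<omega> + contr y \<omega>"
    and scale: "\<And>c x. contr (sL c x) \<omega> = family_scale sW c (contr x \<omega>)"
    and skew: "\<And>x y. contr y (contr x \<omega>) + contr x (contr y \<omega>) = - hcontr (sym_bracket br x y) \<omega>"
    and step: "\<And>m x. n = Suc m \<Longrightarrow> contr x \<omega> \<in> cochains m"
  shows "\<omega> \<in> cochains n"
proof -
  have tail: "(\<lambda>k es. \<omega> k (a # es)) \<in> cochains m" if "n = Suc m" for a m
    using step[OF that, of a] by (simp add: contr_def)
  have n: "n = Suc (n - 1)" if "args n H k (a # es) hs" for k a es hs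
    using that by (simp add: args_def)
  have sym': "\<omega> k es hs' = \<omega> k es hs" if "args n H k es hs" "mset hs' = mset hs" for k es hs hs'
  proof (cases es)
    case Nil
    then show ?thesis using that by (auto simp: args_def intro!: sym)
  next
    case (Cons a es')
    then have "args n H k (a # es') hs" using that by simp
    from cochain_sym[OF tail[OF n[OF this], of a] that(2), of k es'] Cons
    show ?thesis by simp
  qed
  have hadd': "\<omega> k es ((h + h') # hs) = \<omega> k es (h # hs) + \<omega> k es (h' # hs)"
    if "args n H k es (h # hs)" "h' \<in> H" for k es h h' hs
  proof (cases es)
    case Nil
    then show ?thesis using that by (cases k) (auto simp: args_def intro!: hadd)
  next
    case (Cons a es')
    have "h \<in> H" using that by (simp add: args_def)
    have "args n H k (a # es') (h # hs)" using that Cons by simp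
    from cochain_hadd[OF tail[OF n[OF this], of a] \<open>h \<in> H\<close> that(2), of k es' hs] Cons
    show ?thesis by simp
  qed
  have hscale': "\<omega> k es (sL c h # hs) = sW c (\<omega> k es (h # hs))"
    if "args n H k es (h # hs)" for k es c h hs
  proof (cases es)
    case Nil
    then show ?thesis using that by (cases k) (auto simp: args_def intro!: hscale)
  next
    case (Cons a es')
    have "h \<in> H" using that by (simp add: args_def)
    have "args n H k (a # es') (h # hs)" using that Cons by simp
    from cochain_hscale[OF tail[OF n[OF this], of a] \<open>h \<in> H\<close>, of k es' c hs] Cons
    show ?thesis by simp
  qed
  have lin: "Vector_Spaces.linear sL sW (\<lambda>e. \<omega> k (xs @ e # ys) hs)"
    if A: "args n H k (xs @ x # ys) hs" for k xs x ys hs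
  proof (cases xs)
    case Nil
    have "\<omega> k ((u + v) # ys) hs = \<omega> k (u # ys) hs + \<omega> k (v # ys) hs" for u v
      using family_apply[OF add[of u v], of k ys hs] by simp
    moreover have "\<omega> k (sL c u # ys) hs = sW c (\<omega> k (u # ys) hs)" for u c
      using family_apply[OF scale[of c u], of k ys hs] by simp
    ultimately show ?thesis
      using Nil by (simp add: Vector_Spaces.linear_iff vector_space_axioms W.vector_space_axioms)
  next
    case (Cons a xs')
    then obtain m where m: "n = Suc m" "args m H k (xs' @ x # ys) hs"
      using A by (auto simp: args_def)
    have "Vector_Spaces.linear sL sW (\<lambda>e. \<omega> k (a # xs' @ e # ys) hs)"
      using tail[OF m(1), of a] m(2) unfolding leibniz_cochains_def multilinear_families_def by blast
    then show ?thesis using Cons by simp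
  qed
  have skew': "\<omega> k (xs @ x # y # ys) hs + \<omega> k (xs @ y # x # ys) hs =
         - \<omega> (Suc k) (xs @ ys) (sym_bracket br x y # hs)"
    if A: "args n H k (xs @ x # y # ys) hs" for k xs x y ys hs
  proof (cases xs)
    case Nil
    then show ?thesis
      using family_apply[OF skew[of y x], of k ys hs] by simp
  next
    case (Cons a xs')
    then obtain m where m: "n = Suc m" "args m H k (xs' @ x # y # ys) hs"
      using A by (auto simp: args_def)
    have "\<omega> k (a # xs' @ x # y # ys) hs + \<omega> k (a # xs' @ y # x # ys) hs =
         - \<omega> (Suc k) (a # xs' @ ys) (sym_bracket br x y # hs)"
      using tail[OF m(1), of a] m(2) unfolding leibniz_cochains_def by blast
    then show ?thesis using Cons by simp
  qed
  have hlin: "linear_on sL sW H (\<lambda>h. \<omega> k es (us @ h # vs))"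
    if "args n H k es (us @ u # vs)" for k es us u vs
  proof -
    have *: "args n H k es (h # us @ vs)" if "h \<in> H" for h
      using \<open>args n H k es (us @ u # vs)\<close> that by (auto simp: args_def)
    \<comment> \<open>By symmetry the slot under consideration may be moved to the front.\<close>
    have **: "\<omega> k es (us @ h # vs) = \<omega> k es (h # us @ vs)" if "h \<in> H" for h
      by (rule sym'[OF *[OF that]]) simp
    show ?thesis
      using * ** hadd' hscale' by (simp add: linear_on_def subspace_add[OF H_subspace] subspace_scale[OF H_subspace])
  qed
  have "\<omega> \<in> multilinear_families sL H sW n"
    unfolding multilinear_families_def
    by (intro CollectI conjI allI impI) (auto intro: supp lin hlin sym')
  then show ?thesis
    unfolding leibniz_cochains_def by (intro CollectI conjI allI impI) (auto intro: skew')
qed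


lemma zero_cochain: "0 \<in> cochains n"
proof (induction n)
  case 0
  show ?case by (rule cochains_I[where \<omega> = 0]) (simp_all add: fun_eq_iff)
next
  case (Suc n)
  have z: "(0 :: ('l, 'w) family) \<in> cochains n" by (rule Suc)
  show ?case
  proof (rule cochains_I[where \<omega> = 0])
    fix m x assume "Suc n = Suc m"
    then show "contr x 0 \<in> cochains m" using z by simp
  qed (simp_all add: fun_eq_iff)
qed

text \<open>In degree 0 the insertion is zero, and zero is a cochain of every degree, so the
  truncated \<open>n - 1\<close> does no harm.\<close>

lemma contr_cochains':
  assumes "\<omega> \<in> cochains n"
  shows "contr x \<omega> \<in> cochains (n - 1)"
proof (cases n)
  case 0
  with assms show ?thesis by (simp add: contr_cochains_0 zero_cochain)
next
  case (Suc m)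
  with assms show ?thesis using contr_cochains[of \<omega> m x] by simp
qed

lemma cochain_hswap: "\<omega> \<in> cochains n \<Longrightarrow> \<omega> k es (a # b # hs) = \<omega> k es (b # a # hs)"
  by (erule cochain_sym) (simp add: add_mset_commute)

lemma contr_swap:
  "\<omega> \<in> cochains n \<Longrightarrow> contr y (contr x \<omega>) = - hcontr (sym_bracket br x y) \<omega> - contr x (contr y \<omega>)"
  using contr_anticommute[of \<omega> n y x] by (simp add: eq_diff_eq)

lemma add_cochain: "\<omega> \<in> cochains n \<Longrightarrow> \<eta> \<in> cochains n \<Longrightarrow> \<omega> + \<eta> \<in> cochains n"
proof (induction n arbitrary: \<omega> \<eta> rule: less_induct)
  case (less n \<omega> \<eta>)
  note c = less.prems
  show ?case
  proof (rule cochains_I)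
    fix x y
    show "contr y (contr x (\<omega> + \<eta>)) + contr x (contr y (\<omega> + \<eta>)) = - hcontr (sym_bracket br x y) (\<omega> + \<eta>)"
      using contr_anticommute[OF c(1), of y x] contr_anticommute[OF c(2), of y x]
      by (simp add: contr_add hcontr_add algebra_simps)
  next
    fix k and hs hs' :: "'l list" assume "mset hs' = mset hs"
    then show "(\<omega> + \<eta>) k [] hs' = (\<omega> + \<eta>) k [] hs"
      using cochain_sym[OF c(1), of hs' hs k] cochain_sym[OF c(2), of hs' hs k] by simp
  next
    fix m x assume "n = Suc m"
    then show "contr x (\<omega> + \<eta>) \<in> cochains m"
      using c by (auto simp: contr_add intro!: less.IH contr_cochains)
  next
    fix a x
    show "contr (sL a x) (\<omega> + \<eta>) = family_scale sW a (contr x (\<omega> + \<eta>))"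
      by (simp add: contr_add contr_scale_left[OF c(1)] contr_scale_left[OF c(2)] fun_eq_iff W.scale_right_distrib)
  next
    fix x y
    show "contr (x + y) (\<omega> + \<eta>) = contr x (\<omega> + \<eta>) + contr y (\<omega> + \<eta>)"
      by (simp add: contr_add contr_add_left[OF c(1)] contr_add_left[OF c(2)])
  qed (simp_all add: contr_add contr_add_left[OF c(1)] contr_add_left[OF c(2)] cochain_zero_outside[OF c(1)]
        cochain_zero_outside[OF c(2)] cochain_hadd[OF c(1)] cochain_hadd[OF c(2)]
        cochain_hscale[OF c(1)] cochain_hscale[OF c(2)] W.scale_right_distrib)
qed

text \<open>Serves for the scalars of the field and, on the Courant-Dorfman side, for multiplication
  by elements of R.\<close>

lemma map_cochain:
  assumes add: "\<And>v w. T (v + w) = T v + T w" and scale: "\<And>c v. T (sW c v) = sW c (T v)"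
  shows "\<omega> \<in> cochains n \<Longrightarrow> (\<lambda>k es hs. T (\<omega> k es hs)) \<in> cochains n"
proof (induction n arbitrary: \<omega> rule: less_induct)
  case (less n \<omega>)
  note w = less.prems
  have zero: "T 0 = 0" using scale[of 0 0] by simp
  then have minus: "T (- v) = - T v" for v
    using add[of v "- v"] by (simp add: eq_neg_iff_add_eq_0 add.commute)
  show ?case
  proof (rule cochains_I)
    fix x y
    have "T (\<omega> k (x # y # es) hs) + T (\<omega> k (y # x # es) hs) = - T (\<omega> (Suc k) es (sym_bracket br x y # hs))" for k es hs
      using arg_cong[OF family_apply[OF contr_anticommute[OF w, of y x]], of T k es hs] by (simp add: add minus)
    then show "contr y (contr x (\<lambda>k es hs. T (\<omega> k es hs))) + contr x (contr y (\<lambda>k es hs. T (\<omega> k es hs))) =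
        - hcontr (sym_bracket br x y) (\<lambda>k es hs. T (\<omega> k es hs))"
      by (simp add: fun_eq_iff)
  next
    fix k and hs hs' :: "'l list" assume "mset hs' = mset hs"
    then show "T (\<omega> k [] hs') = T (\<omega> k [] hs)"
      using cochain_sym[OF w, of hs' hs k] by simp
  next
    fix m x assume m: "n = Suc m"
    then have "(\<lambda>k es hs. T (contr x \<omega> k es hs)) \<in> cochains m"
      using w by (intro less.IH contr_cochains) simp_all
    then show "contr x (\<lambda>k es hs. T (\<omega> k es hs)) \<in> cochains m" by (simp add: contr_def)
  next
    fix x y
    show "contr (x + y) (\<lambda>k es hs. T (\<omega> k es hs)) = contr x (\<lambda>k es hs. T (\<omega> k es hs)) + contr y (\<lambda>k es hs. T (\<omega> k es hs))"
      using family_apply[OF contr_add_left[OF w, of x y]] by (simp add: fun_eq_iff add)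
  next
    fix a x
    show "contr (sL a x) (\<lambda>k es hs. T (\<omega> k es hs)) = family_scale sW a (contr x (\<lambda>k es hs. T (\<omega> k es hs)))"
      using family_apply[OF contr_scale_left[OF w, of a x]] by (simp add: fun_eq_iff scale)
  qed (simp_all add: cochain_zero_outside[OF w] cochain_hadd[OF w] cochain_hscale[OF w] add scale zero)
qed

lemma scale_cochain: "\<omega> \<in> cochains n \<Longrightarrow> family_scale sW c \<omega> \<in> cochains n"
  unfolding family_scale_def by (rule map_cochain) (simp_all add: W.scale_right_distrib mult.commute)

lemma vector_space_family_scale: "vector_space (family_scale sW :: 'k \<Rightarrow> ('l, 'w) family \<Rightarrow> _)"
  by unfold_locales (simp_all add: fun_eq_iff W.scale_right_distrib W.scale_left_distrib)

lemma family_scale_minus_one: "family_scale sW (- 1) \<omega> = - \<omega>"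
  by (simp add: fun_eq_iff)

lemma minus_cochain: "\<omega> \<in> cochains n \<Longrightarrow> - \<omega> \<in> cochains n"
  using scale_cochain[of \<omega> n "- 1"] by (simp add: family_scale_minus_one)

lemma diff_cochain: "\<omega> \<in> cochains n \<Longrightarrow> \<eta> \<in> cochains n \<Longrightarrow> \<omega> - \<eta> \<in> cochains n"
  using add_cochain[OF _ minus_cochain, of \<omega> n \<eta>] by simp

lemma subspace_cochains: "module.subspace (family_scale sW) (cochains n)"
proof -
  interpret F: vector_space "family_scale sW :: 'k \<Rightarrow> ('l, 'w) family \<Rightarrow> _"
    by (rule vector_space_family_scale)
  show ?thesis
    by (rule F.subspaceI) (auto intro: zero_cochain add_cochain scale_cochain)
qed

text \<open>\<open>F\<close> and \<open>G\<close> may be any operators on families, linear or not.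
  In degree 0 all insertions are zero, so there the hypothesis of \<open>step\<close> is supplied by
  \<open>F 0 = G 0\<close>.\<close>

lemma cochain_op_eqI:
  assumes "\<omega> \<in> cochains n" and zero: "F 0 = G 0"
    and base: "\<And>\<omega> n k hs. \<omega> \<in> cochains n \<Longrightarrow> F \<omega> k [] hs = G \<omega> k [] hs"
    and step: "\<And>\<omega> n y. \<omega> \<in> cochains n \<Longrightarrow> F (contr y \<omega>) = G (contr y \<omega>) \<Longrightarrow> contr y (F \<omega>) = contr y (G \<omega>)"
  shows "F \<omega> = G \<omega>"
  using assms(1)
proof (induction n arbitrary: \<omega>)
  case 0
  show ?case
    by (rule family_ext) (auto intro: base[OF 0] step[OF 0] simp: contr_cochains_0[OF 0] zero)
next
  case (Suc n)
  show ?case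
    by (rule family_ext) (auto intro: base[OF Suc.prems] step[OF Suc.prems] Suc.IH contr_cochains[OF Suc.prems])
qed

text \<open>For \<open>n < 2\<close> no argument from H fits and \<open>hcontr h \<omega>\<close> is
  zero, so the truncated \<open>n - 2\<close> is correct as well.\<close>

lemma hcontr_cochains:
  assumes "\<omega> \<in> cochains n" "h \<in> H"
  shows "hcontr h \<omega> \<in> cochains (n - 2)"
  using assms(1)
proof (induction n arbitrary: \<omega> rule: less_induct)
  case (less n)
  note c = less.prems
  show ?case
  proof (rule cochains_I)
    fix k es hs assume "\<not> args (n - 2) H k es hs"
    then have "\<not> args n H (Suc k) es (h # hs)" by (auto simp: args_def)
    then show "hcontr h \<omega> k es hs = 0" using c by (simp add: cochain_zero_outside)
  next
    fix k and hs hs' :: "'l list" assume "mset hs' = mset hs"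
    then show "hcontr h \<omega> k [] hs' = hcontr h \<omega> k [] hs"
      unfolding hcontr_apply by (intro cochain_sym[OF c]) simp
  next
    fix k h1 h2 hs assume h: "h1 \<in> H" "h2 \<in> H"
    show "hcontr h \<omega> (Suc k) [] ((h1 + h2) # hs) = hcontr h \<omega> (Suc k) [] (h1 # hs) + hcontr h \<omega> (Suc k) [] (h2 # hs)"
      by (simp add: cochain_hswap[OF c, where a = h] cochain_hadd[OF c h])
  next
    fix k a h1 hs assume h: "h1 \<in> H"
    show "hcontr h \<omega> (Suc k) [] (sL a h1 # hs) = sW a (hcontr h \<omega> (Suc k) [] (h1 # hs))"
      by (simp add: cochain_hswap[OF c, where a = h] cochain_hscale[OF c h])
  next
    fix x y
    show "contr (x + y) (hcontr h \<omega>) = contr x (hcontr h \<omega>) + contr y (hcontr h \<omega>)"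
      by (simp add: contr_hcontr contr_add_left[OF c] hcontr_add)
  next
    fix a x
    show "contr (sL a x) (hcontr h \<omega>) = family_scale sW a (contr x (hcontr h \<omega>))"
      by (simp add: contr_hcontr contr_scale_left[OF c] hcontr_scale)
  next
    fix x y
    show "contr y (contr x (hcontr h \<omega>)) + contr x (contr y (hcontr h \<omega>)) =
        - hcontr (sym_bracket br x y) (hcontr h \<omega>)"
      using arg_cong[OF contr_anticommute[OF c, of y x], of "hcontr h"]
      by (simp add: contr_hcontr hcontr_add hcontr_minus hcontr_commute[OF c, of h])
  next
    fix m x assume m: "n - 2 = Suc m"
    then have "n = Suc (n - 1)" "n - 1 - 2 = m" "n - 1 < n" by auto
    then show "contr x (hcontr h \<omega>) \<in> cochains m"
      unfolding contr_hcontr using less.IH[of "n - 1" "contr x \<omega>"] contr_cochains'[OF c, of x] by metis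
  qed
qed

lemma hcontr_cochains_0:
  assumes "\<omega> \<in> cochains n" "n < 2"
  shows "hcontr h \<omega> = 0"
  using assms by (simp add: fun_eq_iff cochain_zero_outside args_def)

section \<open>Lie derivative and differential\<close>

text \<open>
  Cartan's formula is built into the recursion for the differential;
  \<open>standard_d_eq_dif\<close> identifies the result with the standard differential on cochains.
\<close>

primrec lie_raw :: "'l \<Rightarrow> 'l list \<Rightarrow> ('l, 'w) family \<Rightarrow> nat \<Rightarrow> 'l list \<Rightarrow> 'w" where
  "lie_raw e [] \<omega> k hs = act e (\<omega> k [] hs) - hsum (\<lambda>x r. \<omega> k [] (br e x # r)) hs"
| "lie_raw e (y # es) \<omega> k hs = lie_raw e es (contr y \<omega>) k hs - \<omega> k (br e y # es) hs"

text \<open>The recursion has no access to the degree, so only the arguments from H are cut off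
  here; vanishing in the wrong degree follows for cochains by induction on
  \<open>es\<close>.\<close>

definition lie :: "'l \<Rightarrow> ('l, 'w) family \<Rightarrow> ('l, 'w) family" where
  "lie e \<omega> = (\<lambda>k es hs. if ok k hs then lie_raw e es \<omega> k hs else 0)"

text \<open>Without arguments from L the sums in d_0 and d' are empty and \<delta> alone remains.
  For \<open>k = 0\<close> and admissible \<open>hs\<close> there is nothing to sum over, so the
  truncated \<open>k - 1\<close> is never evaluated.\<close>

primrec dif_raw :: "'l list \<Rightarrow> ('l, 'w) family \<Rightarrow> nat \<Rightarrow> 'l list \<Rightarrow> 'w" where
  "dif_raw [] \<omega> k hs = hsum (\<lambda>x r. \<omega> (k - 1) [x] r) hs"
| "dif_raw (e # es) \<omega> k hs = lie_raw e es \<omega> k hs - dif_raw es (contr e \<omega>) k hs"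

definition dif :: "('l, 'w) family \<Rightarrow> ('l, 'w) family" where
  "dif \<omega> = (\<lambda>k es hs. if ok k hs then dif_raw es \<omega> k hs else 0)"

lemma lie_not_ok: "\<not> ok k hs \<Longrightarrow> lie e \<omega> k es hs = 0"
  and lie_Nil: "ok k hs \<Longrightarrow> lie e \<omega> k [] hs = act e (\<omega> k [] hs) - hsum (\<lambda>x r. \<omega> k [] (br e x # r)) hs"
  and dif_not_ok: "\<not> ok k hs \<Longrightarrow> dif \<omega> k es hs = 0"
  and dif_Nil: "ok k hs \<Longrightarrow> dif \<omega> k [] hs = hsum (\<lambda>x r. \<omega> (k - 1) [x] r) hs"
  by (auto simp: lie_def dif_def)

text \<open>The term \<omega>(e \<circ> y, ...) is cut off on the left but not on the right, which
  is why \<omega> must vanish where \<open>ok\<close> fails. Beyond that \<omega> is arbitrary,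
  because the rule is also applied to \<open>dif \<omega>\<close> before that is known to be a
  cochain.\<close>

lemma contr_lie_if_zero_not_ok:
  assumes "\<And>k es hs. \<not> ok k hs \<Longrightarrow> \<omega> k es hs = 0"
  shows "contr y (lie e \<omega>) = lie e (contr y \<omega>) - contr (br e y) \<omega>"
  by (intro ext) (auto simp: lie_def assms)

lemma contr_lie:
  "\<omega> \<in> cochains n \<Longrightarrow> contr y (lie e \<omega>) = lie e (contr y \<omega>) - contr (br e y) \<omega>"
  by (rule contr_lie_if_zero_not_ok) (rule cochain_zero_not_ok)

lemma contr_dif: "contr y (dif \<omega>) = lie y \<omega> - dif (contr y \<omega>)"
  by (intro ext) (auto simp: lie_def dif_def)

lemma lie_raw_add: "lie_raw e es (\<omega> + \<eta>) k hs = lie_raw e es \<omega> k hs + lie_raw e es \<eta> k hs"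
  by (induction es arbitrary: \<omega> \<eta>) (simp_all add: act_add_right hsum_add contr_add)

lemma lie_raw_scale: "lie_raw e es (family_scale sW c \<omega>) k hs = sW c (lie_raw e es \<omega> k hs)"
proof (induction es arbitrary: \<omega>)
  case Nil
  show ?case
    using hsum_hom[of "sW c" "\<lambda>x r. \<omega> k [] (br e x # r)" hs]
    by (simp add: act_scale_right W.scale_right_distrib W.scale_right_diff_distrib)
qed (simp add: contr_scale W.scale_right_diff_distrib)

lemma lie_add: "lie e (\<omega> + \<eta>) = lie e \<omega> + lie e \<eta>"
  by (intro ext) (simp add: lie_def lie_raw_add)

lemma lie_scale: "lie e (family_scale sW c \<omega>) = family_scale sW c (lie e \<omega>)"
  by (intro ext) (simp add: lie_def lie_raw_scale)

lemma lie_zero [simp]: "lie e 0 = 0"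
  using lie_add[of e 0 0] by simp

lemma lie_minus: "lie e (- \<omega>) = - lie e \<omega>"
  using lie_scale[of e "- 1" \<omega>] by (simp add: family_scale_minus_one)

lemma lie_diff: "lie e (\<omega> - \<eta>) = lie e \<omega> - lie e \<eta>"
  using lie_add[of e \<omega> "- \<eta>"] by (simp add: lie_minus)

lemma dif_raw_add: "dif_raw es (\<omega> + \<eta>) k hs = dif_raw es \<omega> k hs + dif_raw es \<eta> k hs"
  by (induction es arbitrary: \<omega> \<eta>) (simp_all add: hsum_add contr_add lie_raw_add)

lemma dif_raw_scale: "dif_raw es (family_scale sW c \<omega>) k hs = sW c (dif_raw es \<omega> k hs)"
proof (induction es arbitrary: \<omega>)
  case Nil
  show ?case
    using hsum_hom[of "sW c" "\<lambda>x r. \<omega> (k - 1) [x] r" hs] by (simp add: W.scale_right_distrib)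
qed (simp add: contr_scale lie_raw_scale W.scale_right_diff_distrib)

lemma dif_add: "dif (\<omega> + \<eta>) = dif \<omega> + dif \<eta>"
  by (intro ext) (simp add: dif_def dif_raw_add)

lemma dif_scale: "dif (family_scale sW c \<omega>) = family_scale sW c (dif \<omega>)"
  by (intro ext) (simp add: dif_def dif_raw_scale)

lemma dif_zero [simp]: "dif 0 = 0"
  using dif_add[of 0 0] by simp

lemma dif_minus: "dif (- \<omega>) = - dif \<omega>"
  using dif_scale[of "- 1" \<omega>] by (simp add: family_scale_minus_one)

lemma dif_diff: "dif (\<omega> - \<eta>) = dif \<omega> - dif \<eta>"
  using dif_add[of \<omega> "- \<eta>"] by (simp add: dif_minus)

lemma mset_ok:
  assumes "mset hs = add_mset x (mset r)" "ok k hs"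
  shows "x \<in> H \<and> ok (k - 1) r \<and> k = Suc (k - 1)"
  using mset_eq_setD[of hs "x # r"] mset_eq_length[of hs "x # r"] assms by auto

section \<open>The Cartan calculus\<close>

lemma lie_add_left:
  assumes "\<omega> \<in> cochains n"
  shows "lie (x + y) \<omega> = lie x \<omega> + lie y \<omega>"
  using assms
proof (rule cochain_op_eqI)
  fix \<omega> n k hs assume c: "\<omega> \<in> cochains n"
  show "lie (x + y) \<omega> k [] hs = (lie x \<omega> + lie y \<omega>) k [] hs"
  proof (cases "ok k hs")
    case True
    have "hsum (\<lambda>a r. \<omega> k [] (br (x + y) a # r)) hs =
        hsum (\<lambda>a r. \<omega> k [] (br x a # r) + \<omega> k [] (br y a # r)) hs"
      proof (rule hsum_cong)
      fix a r assume "mset hs = add_mset a (mset r)"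
      from mset_ok[OF this True] have "a \<in> H" by simp
      then show "\<omega> k [] (br (x + y) a # r) = \<omega> k [] (br x a # r) + \<omega> k [] (br y a # r)"
        by (simp add: br_add_left cochain_hadd[OF c] br_H_right)
    qed
    with True show ?thesis by (simp add: lie_Nil act_add_left hsum_add)
  qed (simp add: lie_not_ok)
next
  fix \<omega> n z assume c: "\<omega> \<in> cochains n" and "lie (x + y) (contr z \<omega>) = lie x (contr z \<omega>) + lie y (contr z \<omega>)"
  then show "contr z (lie (x + y) \<omega>) = contr z (lie x \<omega> + lie y \<omega>)"
    by (simp add: contr_add contr_lie[OF c] br_add_left contr_add_left[OF c])
next
  show "lie (x + y) 0 = lie x 0 + lie y 0" by simp
qed

lemma lie_scale_left:
  assumes "\<omega> \<in> cochains n"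
  shows "lie (sL a x) \<omega> = family_scale sW a (lie x \<omega>)"
  using assms
proof (rule cochain_op_eqI)
  fix \<omega> n k hs assume c: "\<omega> \<in> cochains n"
  show "lie (sL a x) \<omega> k [] hs = family_scale sW a (lie x \<omega>) k [] hs"
  proof (cases "ok k hs")
    case True
    have "hsum (\<lambda>b r. \<omega> k [] (br (sL a x) b # r)) hs = hsum (\<lambda>b r. sW a (\<omega> k [] (br x b # r))) hs"
      proof (rule hsum_cong)
      fix b r assume "mset hs = add_mset b (mset r)"
      from mset_ok[OF this True] have "b \<in> H" by simp
      then show "\<omega> k [] (br (sL a x) b # r) = sW a (\<omega> k [] (br x b # r))"
        by (simp add: br_scale_left cochain_hscale[OF c] br_H_right)
    qed
    with True show ?thesis
      by (simp add: lie_Nil act_scale_left W.scale_right_diff_distrib W.scale_right_distrib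
          hsum_hom[of "sW a"])
  qed (simp add: lie_not_ok)
next
  fix \<omega> n z assume c: "\<omega> \<in> cochains n" and "lie (sL a x) (contr z \<omega>) = family_scale sW a (lie x (contr z \<omega>))"
  then show "contr z (lie (sL a x) \<omega>) = contr z (family_scale sW a (lie x \<omega>))"
    by (simp add: contr_scale contr_lie[OF c] br_scale_left contr_scale_left[OF c]
        fun_eq_iff W.scale_right_diff_distrib)
next
  show "lie (sL a x) 0 = family_scale sW a (lie x 0)" by (simp add: fun_eq_iff)
qed

lemma hcontr_lie:
  assumes "\<omega> \<in> cochains n" and h: "h \<in> H"
  shows "hcontr h (lie e \<omega>) = lie e (hcontr h \<omega>) - hcontr (br e h) \<omega>"
  using assms(1)
proof (rule cochain_op_eqI)
  fix \<omega> n k hs assume c: "\<omega> \<in> cochains n"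
  show "hcontr h (lie e \<omega>) k [] hs = (lie e (hcontr h \<omega>) - hcontr (br e h) \<omega>) k [] hs"
  proof (cases "ok k hs")
    case True
    then show ?thesis using h by (simp add: lie_Nil cochain_hswap[OF c, of _ _ _ h])
  next
    case False
    have "\<omega> (Suc k) [] (br e h # hs) = 0"
      by (rule cochain_zero_not_ok[OF c]) (use False in auto)
    moreover have "lie e \<omega> (Suc k) [] (h # hs) = 0"
      by (rule lie_not_ok) (use False in auto)
    ultimately show ?thesis using False by (simp add: lie_not_ok)
  qed
next
  fix \<omega> n y assume c: "\<omega> \<in> cochains n"
    and "hcontr h (lie e (contr y \<omega>)) = lie e (hcontr h (contr y \<omega>)) - hcontr (br e h) (contr y \<omega>)"
  then show "contr y (hcontr h (lie e \<omega>)) = contr y (lie e (hcontr h \<omega>) - hcontr (br e h) \<omega>)"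
    by (simp add: contr_hcontr contr_diff contr_lie[OF c] hcontr_diff contr_lie[OF hcontr_cochains[OF c h]])
next
  show "hcontr h (lie e 0) = lie e (hcontr h 0) - hcontr (br e h) 0" by simp
qed

lemma lie_zero_outside:
  assumes "\<omega> \<in> cochains n" "\<not> args n H k es hs"
  shows "lie e \<omega> k es hs = 0"
proof -
  have "lie_raw e es \<omega> k hs = 0" if "ok k hs" "length es + 2 * k \<noteq> n" "\<omega> \<in> cochains n" for \<omega> n
    using that
  proof (induction es arbitrary: \<omega> n)
    case Nil
    then show ?case by (simp add: cochain_zero_outside[OF Nil(3)] args_def)
  next
    case (Cons y es)
    have "lie_raw e es (contr y \<omega>) k hs = 0"
    proof (cases n)
      case 0
      then show ?thesis using Cons.prems contr_cochains_0[of \<omega> y] lie_raw_scale[of e es 0 0 k hs]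
        by (simp add: family_scale_def zero_fun_def)
    next
      case (Suc m)
      then show ?thesis using Cons.prems by (intro Cons.IH[of m] contr_cochains) auto
    qed
    then show ?case using Cons.prems by (simp add: cochain_zero_outside[OF Cons.prems(3)] args_def)
  qed
  from this[OF _ _ assms(1)] show ?thesis using assms(2) by (auto simp: lie_def args_def)
qed

text \<open>Skew-symmetry is the condition with content. Inserting x and y around
  \<open>lie e\<close> yields (e \<circ> x, y) and (x, e \<circ> y), whose sum is e \<circ> (x, y),
  the correction in \<open>hcontr_lie\<close>.\<close>

lemma lie_cochains: "\<omega> \<in> cochains n \<Longrightarrow> lie e \<omega> \<in> cochains n"
proof (induction n arbitrary: \<omega> rule: less_induct)
  case (less n)
  note c = less.prems
  show ?case
  proof (rule cochains_I)
    fix k es hs assume "\<not> args n H k es hs"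
    then show "lie e \<omega> k es hs = 0" by (rule lie_zero_outside[OF c])
  next
    fix k hs hs' assume ok: "ok k hs" and m: "mset hs' = mset hs"
    have "hsum (\<lambda>x r. \<omega> k [] (br e x # r)) hs' = hsum (\<lambda>x r. \<omega> k [] (br e x # r)) hs"
      by (rule hsum_perm[OF _ m]) (rule cochain_sym[OF c], simp)
    moreover have "ok k hs'" using ok m by (metis mset_eq_setD size_mset)
    ultimately show "lie e \<omega> k [] hs' = lie e \<omega> k [] hs"
      using ok cochain_sym[OF c m] by (simp add: lie_Nil)
  next
    fix k h1 h2 hs assume h: "h1 \<in> H" "h2 \<in> H" and ok: "ok k hs"
    show "lie e \<omega> (Suc k) [] ((h1 + h2) # hs) = lie e \<omega> (Suc k) [] (h1 # hs) + lie e \<omega> (Suc k) [] (h2 # hs)"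
      using h ok br_H_right[OF h(1), of e] br_H_right[OF h(2), of e]
      by (simp add: lie_Nil subspace_add[OF H_subspace] cochain_hswap[OF c, where a = "br e _"]
          cochain_hadd[OF c] br_add_right act_add_right hsum_add)
  next
    fix k a h hs assume h: "h \<in> H" and ok: "ok k hs"
    show "lie e \<omega> (Suc k) [] (sL a h # hs) = sW a (lie e \<omega> (Suc k) [] (h # hs))"
      using h ok br_H_right[OF h(1), of e]
      by (simp add: lie_Nil subspace_scale[OF H_subspace] cochain_hswap[OF c, where a = "br e _"]
          cochain_hscale[OF c] br_scale_right act_scale_right hsum_hom[of "sW a"] W.scale_right_distrib
          W.scale_right_diff_distrib)
  next
    fix x y
    show "contr (x + y) (lie e \<omega>) = contr x (lie e \<omega>) + contr y (lie e \<omega>)"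
      by (simp add: contr_lie[OF c] contr_add_left[OF c] br_add_right lie_add)
  next
    fix a x
    show "contr (sL a x) (lie e \<omega>) = family_scale sW a (contr x (lie e \<omega>))"
      by (simp add: contr_lie[OF c] contr_scale_left[OF c] br_scale_right lie_scale)
         (simp add: fun_eq_iff W.scale_right_diff_distrib)
  next
    fix x y
    have "lie e (contr y (contr x \<omega>)) = - lie e (hcontr (sym_bracket br x y) \<omega>) - lie e (contr x (contr y \<omega>))"
      by (simp add: contr_swap[OF c, of y x] lie_diff lie_minus)
    moreover have "hcontr (br e (sym_bracket br x y)) \<omega> =
        hcontr (sym_bracket br (br e x) y) \<omega> + hcontr (sym_bracket br x (br e y)) \<omega>"
      by (simp add: br_sym_bracket hcontr_add_left[OF c] sym_bracket_in_H)
    ultimately show "contr y (contr x (lie e \<omega>)) + contr x (contr y (lie e \<omega>)) =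
        - hcontr (sym_bracket br x y) (lie e \<omega>)"
      by (simp add: hcontr_lie[OF c sym_bracket_in_H] contr_lie[OF c] contr_diff contr_lie[OF contr_cochains'[OF c]]
          contr_swap[OF c, of "br e y" x] contr_swap[OF c, of y "br e x"])
  next
    fix m x assume "n = Suc m"
    then show "contr x (lie e \<omega>) \<in> cochains m"
      using c by (auto simp: contr_lie[OF c] intro!: diff_cochain less.IH contr_cochains)
  qed
qed

lemma cochain_add_head: "\<omega> \<in> cochains n \<Longrightarrow> \<omega> k ((x + y) # es) hs = \<omega> k (x # es) hs + \<omega> k (y # es) hs"
  and cochain_scale_head: "\<omega> \<in> cochains n \<Longrightarrow> \<omega> k (sL a x # es) hs = sW a (\<omega> k (x # es) hs)"
  using cochain_linear_head[of \<omega> n k es hs] by (auto simp: Vector_Spaces.linear_iff)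

lemma lie_lie_Nil:
  assumes "\<omega> \<in> cochains n" and ok: "ok k hs"
  shows "lie e (lie f \<omega>) k [] hs =
    act e (act f (\<omega> k [] hs)) - hsum (\<lambda>x r. act e (\<omega> k [] (br f x # r))) hs
    - hsum (\<lambda>x r. act f (\<omega> k [] (br e x # r))) hs
    + hsum (\<lambda>x r. \<omega> k [] (br f (br e x) # r)) hs
    + hsum (\<lambda>x. hsum (\<lambda>y s. \<omega> k [] (br f y # br e x # s))) hs"
proof -
  have "hsum (\<lambda>x r. lie f \<omega> k [] (br e x # r)) hs = hsum (\<lambda>x r. act f (\<omega> k [] (br e x # r))
      - (\<omega> k [] (br f (br e x) # r) + hsum (\<lambda>y s. \<omega> k [] (br f y # br e x # s)) r)) hs"
  proof (rule hsum_cong)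
    fix x r assume "mset hs = add_mset x (mset r)"
    from mset_ok[OF this ok] have "ok k (br e x # r)" by (auto simp: br_H_right)
    then show "lie f \<omega> k [] (br e x # r) = act f (\<omega> k [] (br e x # r))
      - (\<omega> k [] (br f (br e x) # r) + hsum (\<lambda>y s. \<omega> k [] (br f y # br e x # s)) r)"
      by (simp add: lie_Nil)
  qed
  then show ?thesis
    using ok by (simp add: lie_Nil act_diff_right hsum_hom[of "act e"] act_add_right hsum_diff hsum_add)
qed

lemma lie_commutator:
  assumes "\<omega> \<in> cochains n"
  shows "lie e (lie f \<omega>) - lie f (lie e \<omega>) = lie (br e f) \<omega>"
  using assms
proof (rule cochain_op_eqI)
  fix \<omega> n k hs assume c: "\<omega> \<in> cochains n"
  show "(lie e (lie f \<omega>) - lie f (lie e \<omega>)) k [] hs = lie (br e f) \<omega> k [] hs"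
  proof (cases "ok k hs")
    case True
    have 1: "hsum (\<lambda>x. hsum (\<lambda>y s. \<omega> k [] (br f y # br e x # s))) hs =
        hsum (\<lambda>x. hsum (\<lambda>y s. \<omega> k [] (br e y # br f x # s))) hs"
      by (subst hsum_swap, subst cochain_hswap[OF c]) (rule refl)
    have "hsum (\<lambda>x r. \<omega> k [] (br e (br f x) # r)) hs =
        hsum (\<lambda>x r. \<omega> k [] (br (br e f) x # r) + \<omega> k [] (br f (br e x) # r)) hs"
    proof (rule hsum_cong)
      fix x r assume "mset hs = add_mset x (mset r)"
      from mset_ok[OF this True] have "x \<in> H" by simp
      then show "\<omega> k [] (br e (br f x) # r) = \<omega> k [] (br (br e f) x # r) + \<omega> k [] (br f (br e x) # r)"
        by (simp add: left_leibniz[of e f x] cochain_hadd[OF c] br_H_right)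
    qed
    with 1 True show ?thesis
      unfolding minus_apply lie_lie_Nil[OF c True] by (simp add: lie_Nil act_br hsum_add)
  qed (simp add: lie_not_ok)
next
  fix \<omega> n y assume c: "\<omega> \<in> cochains n"
    and IH: "lie e (lie f (contr y \<omega>)) - lie f (lie e (contr y \<omega>)) = lie (br e f) (contr y \<omega>)"
  show "contr y (lie e (lie f \<omega>) - lie f (lie e \<omega>)) = contr y (lie (br e f) \<omega>)"
    unfolding contr_diff contr_lie[OF c] contr_lie[OF lie_cochains[OF c]] IH[symmetric]
      left_leibniz[of e f y] contr_add_left[OF c] lie_diff
    by simp
next
  show "lie e (lie f 0) - lie f (lie e 0) = lie (br e f) 0" by simp
qed

text \<open>The summand of \<delta> in which z moves to the front is i_z; the others form
  \<open>dif (hcontr z \<omega>)\<close>. That z is left central enters when y is inserted: then (z,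
  y) = y \<circ> z, and the term produced by moving i_z past i_y is the correction in
  \<open>hcontr_lie\<close>.\<close>

lemma hcontr_dif:
  assumes "\<omega> \<in> cochains n" and z: "z \<in> H" "\<And>e. br z e = 0"
  shows "hcontr z (dif \<omega>) = dif (hcontr z \<omega>) + contr z \<omega>"
  using assms(1)
proof (rule cochain_op_eqI)
  fix \<omega> n k hs assume c: "\<omega> \<in> cochains n"
  show "hcontr z (dif \<omega>) k [] hs = (dif (hcontr z \<omega>) + contr z \<omega>) k [] hs"
  proof (cases "ok k hs")
    case True
    have "hsum (\<lambda>x r. \<omega> k [x] (z # r)) hs = hsum (\<lambda>x r. \<omega> (Suc (k - 1)) [x] (z # r)) hs"
    proof (rule hsum_cong)
      fix x r assume "mset hs = add_mset x (mset r)"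
      from mset_ok[OF this True] show "\<omega> k [x] (z # r) = \<omega> (Suc (k - 1)) [x] (z # r)" by simp
    qed
    with True z show ?thesis by (simp add: dif_Nil)
  next
    case False
    have "\<omega> k [z] hs = 0"
      by (rule cochain_zero_not_ok[OF c False])
    moreover have "dif \<omega> (Suc k) [] (z # hs) = 0"
      by (rule dif_not_ok) (use False in auto)
    ultimately show ?thesis using False by (simp add: dif_not_ok)
  qed
next
  fix \<omega> n y assume c: "\<omega> \<in> cochains n"
    and IH: "hcontr z (dif (contr y \<omega>)) = dif (hcontr z (contr y \<omega>)) + contr z (contr y \<omega>)"
  have "sym_bracket br z y = br y z" using z by (simp add: sym_bracket_def)
  then show "contr y (hcontr z (dif \<omega>)) = contr y (dif (hcontr z \<omega>) + contr z \<omega>)"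
    by (simp add: contr_hcontr contr_dif hcontr_diff contr_add IH hcontr_lie[OF c z(1)] contr_swap[OF c, of y z])
next
  show "hcontr z (dif 0) = dif (hcontr z 0) + contr z 0" by simp
qed

lemma contr_lie_dif: "contr y (lie e (dif \<omega>)) = lie e (contr y (dif \<omega>)) - contr (br e y) (dif \<omega>)"
  by (rule contr_lie_if_zero_not_ok) (rule dif_not_ok)

text \<open>After inserting y and using the induction hypothesis, the difference of the two sides is
  [L_e, L_y] - L_{e \<circ> y}, applied to \<omega>.\<close>

lemma lie_dif:
  assumes "\<omega> \<in> cochains n"
  shows "lie e (dif \<omega>) = dif (lie e \<omega>)"
  using assms
proof (rule cochain_op_eqI)
  fix \<omega> n k hs assume c: "\<omega> \<in> cochains n"
  show "lie e (dif \<omega>) k [] hs = dif (lie e \<omega>) k [] hs"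
  proof (cases "ok k hs")
    case True
    have "hsum (\<lambda>x r. dif \<omega> k [] (br e x # r)) hs =
        hsum (\<lambda>x r. \<omega> (k - 1) [br e x] r + hsum (\<lambda>y s. \<omega> (k - 1) [y] (br e x # s)) r) hs"
    proof (rule hsum_cong)
      fix x r assume "mset hs = add_mset x (mset r)"
      from mset_ok[OF this True] have "ok k (br e x # r)" by (auto simp: br_H_right)
      then show "dif \<omega> k [] (br e x # r) =
          \<omega> (k - 1) [br e x] r + hsum (\<lambda>y s. \<omega> (k - 1) [y] (br e x # s)) r"
        by (simp add: dif_Nil)
    qed
    moreover have "hsum (\<lambda>x r. lie e \<omega> (k - 1) [x] r) hs =
        hsum (\<lambda>x r. act e (\<omega> (k - 1) [x] r) - hsum (\<lambda>y s. \<omega> (k - 1) [x] (br e y # s)) r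
          - \<omega> (k - 1) [br e x] r) hs"
    proof (rule hsum_cong)
      fix x r assume "mset hs = add_mset x (mset r)"
      from mset_ok[OF this True] have "ok (k - 1) r" by simp
      then show "lie e \<omega> (k - 1) [x] r = act e (\<omega> (k - 1) [x] r)
          - hsum (\<lambda>y s. \<omega> (k - 1) [x] (br e y # s)) r - \<omega> (k - 1) [br e x] r"
        by (simp add: lie_def)
    qed
    \<comment> \<open>Of two arguments from H one becomes an argument from L and the other is acted
      on by e; the order in which they are removed does not matter.\<close>
    moreover have "hsum (\<lambda>x. hsum (\<lambda>y s. \<omega> (k - 1) [y] (br e x # s))) hs =
        hsum (\<lambda>x. hsum (\<lambda>y s. \<omega> (k - 1) [x] (br e y # s))) hs"
      by (rule hsum_swap)
    ultimately show ?thesis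
      using True by (simp add: lie_Nil dif_Nil hsum_hom[of "act e"] act_add_right hsum_add hsum_diff algebra_simps)
  qed (simp add: lie_not_ok dif_not_ok)
next
  fix \<omega> n y assume c: "\<omega> \<in> cochains n" and IH: "lie e (dif (contr y \<omega>)) = dif (lie e (contr y \<omega>))"
  show "contr y (lie e (dif \<omega>)) = contr y (dif (lie e \<omega>))"
    unfolding contr_lie_dif contr_dif contr_lie[OF c] lie_diff dif_diff IH
      lie_commutator[OF c, symmetric]
    by simp
next
  show "lie e (dif 0) = dif (lie e 0)" by simp
qed

lemma dif_zero_outside:
  assumes "\<omega> \<in> cochains n" "\<not> args (Suc n) H k es hs"
  shows "dif \<omega> k es hs = 0"
  using assms
proof (induction es arbitrary: \<omega> n)
  case Nil
  show ?case
  proof (cases "ok k hs")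
    case True
    have "hsum (\<lambda>x r. \<omega> (k - 1) [x] r) hs = hsum (\<lambda>x r. 0) hs"
    proof (rule hsum_cong)
      fix x r assume "mset hs = add_mset x (mset r)"
      from mset_ok[OF this True] have "k = Suc (k - 1)" by simp
      with Nil(2) True show "\<omega> (k - 1) [x] r = 0"
        by (intro cochain_zero_outside[OF Nil(1)]) (auto simp: args_def)
    qed
    with True show ?thesis by (simp add: dif_Nil)
  qed (simp add: dif_not_ok)
next
  case (Cons e es)
  have "lie e \<omega> k es hs = 0"
    by (rule lie_zero_outside[OF Cons.prems(1)]) (use Cons.prems(2) in \<open>simp add: args_def\<close>)
  moreover have "dif (contr e \<omega>) k es hs = 0"
  proof (cases n)
    case 0
    then show ?thesis using Cons.prems(1) by (simp add: contr_cochains_0)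
  next
    case (Suc m)
    have "contr e \<omega> \<in> cochains m" using contr_cochains Cons.prems(1) Suc by blast
    moreover have "\<not> args (Suc m) H k es hs" using Cons.prems(2) Suc by (auto simp: args_def)
    ultimately show ?thesis by (rule Cons.IH)
  qed
  moreover have "dif \<omega> k (e # es) hs = lie e \<omega> k es hs - dif (contr e \<omega>) k es hs"
    by (simp add: dif_def lie_def)
  ultimately show ?case by simp
qed

text \<open>Inserting x and y symmetrically and applying Cartan's formula twice leaves, up to sign,
  i_{x \<circ> y} + i_{y \<circ> x} = i_{(x, y)} and d j_{(x, y)}. Since (x, y) is left central,
  \<open>hcontr_dif\<close> combines them into j_{(x, y)} d.\<close>

lemma dif_cochains: "\<omega> \<in> cochains n \<Longrightarrow> dif \<omega> \<in> cochains (Suc n)"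
proof (induction n arbitrary: \<omega> rule: less_induct)
  case (less n)
  note c = less.prems
  show ?case
  proof (rule cochains_I)
    fix k es hs assume "\<not> args (Suc n) H k es hs"
    then show "dif \<omega> k es hs = 0" by (rule dif_zero_outside[OF c])
  next
    fix k hs hs' assume ok: "ok k hs" and m: "mset hs' = mset hs"
    have "hsum (\<lambda>x r. \<omega> (k - 1) [x] r) hs' = hsum (\<lambda>x r. \<omega> (k - 1) [x] r) hs"
      by (rule hsum_perm[OF _ m]) (rule cochain_sym[OF c])
    moreover have "ok k hs'" using ok mset_eq_setD[OF m] mset_eq_length[OF m] by simp
    ultimately show "dif \<omega> k [] hs' = dif \<omega> k [] hs"
      using ok by (simp add: dif_Nil)
  next
    fix k h1 h2 hs assume h: "h1 \<in> H" "h2 \<in> H" and ok: "ok k hs"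
    then show "dif \<omega> (Suc k) [] ((h1 + h2) # hs) = dif \<omega> (Suc k) [] (h1 # hs) + dif \<omega> (Suc k) [] (h2 # hs)"
      by (simp add: dif_Nil subspace_add[OF H_subspace] cochain_hadd[OF c] cochain_add_head[OF c] hsum_add)
  next
    fix k a h hs assume h: "h \<in> H" and ok: "ok k hs"
    then show "dif \<omega> (Suc k) [] (sL a h # hs) = sW a (dif \<omega> (Suc k) [] (h # hs))"
      by (simp add: dif_Nil subspace_scale[OF H_subspace] cochain_hscale[OF c] cochain_scale_head[OF c]
          hsum_hom[of "sW a"] W.scale_right_distrib)
  next
    fix x y
    show "contr (x + y) (dif \<omega>) = contr x (dif \<omega>) + contr y (dif \<omega>)"
      by (simp add: contr_dif contr_add_left[OF c] lie_add_left[OF c] dif_add)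
  next
    fix a x
    show "contr (sL a x) (dif \<omega>) = family_scale sW a (contr x (dif \<omega>))"
      by (simp add: contr_dif contr_scale_left[OF c] lie_scale_left[OF c] dif_scale)
         (simp add: fun_eq_iff W.scale_right_diff_distrib)
  next
    fix x y
    have "contr (sym_bracket br x y) \<omega> = contr (br x y) \<omega> + contr (br y x) \<omega>"
      by (simp add: sym_bracket_def contr_add_left[OF c])
    moreover have "dif (contr y (contr x \<omega>)) = - dif (hcontr (sym_bracket br x y) \<omega>) - dif (contr x (contr y \<omega>))"
      by (simp add: contr_swap[OF c, of y x] dif_diff dif_minus)
    ultimately show "contr y (contr x (dif \<omega>)) + contr x (contr y (dif \<omega>)) = - hcontr (sym_bracket br x y) (dif \<omega>)"
      by (simp add: contr_dif contr_diff contr_lie[OF c]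
          hcontr_dif[OF c sym_bracket_in_H sym_bracket_left_center])
  next
    fix m x assume m: "Suc n = Suc m"
    have "dif (contr x \<omega>) \<in> cochains m"
    proof (cases n)
      case 0
      with c show ?thesis by (simp add: contr_cochains_0 zero_cochain)
    next
      case (Suc p)
      then have "dif (contr x \<omega>) \<in> cochains (Suc p)"
        using c by (intro less.IH contr_cochains) auto
      then show ?thesis using m Suc by simp
    qed
    then show "contr x (dif \<omega>) \<in> cochains m"
      using m lie_cochains[OF c] by (simp add: contr_dif diff_cochain)
  qed
qed

text \<open>The inductive step is i_y d d = (L_y d - d L_y) + d d i_y. Without arguments from L a
  double sum over H is left, and it is alternating because H is isotropic.\<close>

lemma dif_dif:
  assumes "\<omega> \<in> cochains n"
  shows "dif (dif \<omega>) = 0"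
  using assms
proof (rule cochain_op_eqI)
  fix \<omega> n k hs assume c: "\<omega> \<in> cochains n"
  show "dif (dif \<omega>) k [] hs = 0 k [] hs"
  proof (cases "ok k hs")
    case True
    \<comment> \<open>\<open>Q\<close> collects what happens to the second argument y once x stands
      in the slot for L: y is acted on by x or becomes an argument from L itself. The action of x on
      W is zero since x \<in> H.\<close>
    define Q where "Q x y s = \<omega> (k - 1) [] (br x y # s) + \<omega> (k - 1 - 1) [x, y] s" for x y s
    have "hsum (\<lambda>x r. dif \<omega> (k - 1) [x] r) hs = hsum (\<lambda>x r. - hsum (Q x) r) hs"
    proof (rule hsum_cong)
      fix x r assume "mset hs = add_mset x (mset r)"
      from mset_ok[OF this True] have "x \<in> H" "ok (k - 1) r" by simp_all
      then show "dif \<omega> (k - 1) [x] r = - hsum (Q x) r"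
        by (simp add: dif_def act_H Q_def[abs_def] hsum_add)
    qed
    moreover have "hsum (\<lambda>x r. hsum (Q x) r) hs = 0"
    proof (rule hsum_alternating)
      fix x y s assume m: "mset hs = add_mset x (add_mset y (mset s))"
      have h: "x \<in> H" "y \<in> H"
        using mset_eq_setD[of hs "x # y # s"] m True by auto
      have z: "\<omega> i [] (0 # s) = 0" for i
        using family_apply[OF hcontr_zero_left[OF c], of "i - 1" "[]" s]
        by (cases i) (auto intro: cochain_zero_not_ok[OF c])
      have "\<omega> (k - 1) [] (br x y # s) + \<omega> (k - 1) [] (br y x # s) = 0"
        using H_isotropic[OF h] cochain_hadd[OF c, of "br x y" "br y x" "k - 1" "[]" s] z
        by (simp add: sym_bracket_def br_H_left h)
      moreover have "\<omega> (k - 1 - 1) [x, y] s + \<omega> (k - 1 - 1) [y, x] s = 0"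
        using family_apply[OF contr_anticommute[OF c, of x y], of "k - 1 - 1" "[]" s]
        by (simp add: H_isotropic h z add.commute)
      ultimately show "Q x y s + Q y x s = 0"
        unfolding Q_def by (simp add: add_eq_0_iff)
    qed
    ultimately show ?thesis using True by (simp add: dif_Nil hsum_minus)
  qed (simp add: dif_not_ok)
next
  fix \<omega> n y assume c: "\<omega> \<in> cochains n" and IH: "dif (dif (contr y \<omega>)) = 0"
  then show "contr y (dif (dif \<omega>)) = contr y 0"
    by (simp add: contr_dif dif_diff lie_dif[OF c])
next
  show "dif (dif 0) = 0" by simp
qed

section \<open>Comparison with the three-part differential\<close>

lemma lie_raw_conv_sum:
  "lie_raw e es \<omega> k hs = act e (\<omega> k es hs) - (\<Sum>b<length es. \<omega> k (es[b := br e (es ! b)]) hs)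
    - hsum (\<lambda>x r. \<omega> k es (br e x # r)) hs"
proof (induction es arbitrary: \<omega>)
  case (Cons a es)
  have "lie_raw e es (contr a \<omega>) k hs = act e (contr a \<omega> k es hs)
      - (\<Sum>b<length es. contr a \<omega> k (es[b := br e (es ! b)]) hs) - hsum (\<lambda>x r. contr a \<omega> k es (br e x # r)) hs"
    by (rule Cons.IH)
  then show ?case by (simp add: sum.lessThan_Suc_shift del: sum.lessThan_Suc)
qed simp

text \<open>Position 0 contributes the terms in which e acts; all other positions are shifted by
  one, which changes every sign.\<close>

lemma d_zero_Cons:
  "d_zero br act sW \<omega> k (e # es) hs = act e (\<omega> k es hs) - (\<Sum>b<length es. \<omega> k (es[b := br e (es ! b)]) hs)
    - d_zero br act sW (contr e \<omega>) k es hs"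
proof -
  have img: "{Suc a<..<Suc m} = Suc ` {a<..<m}" "{0<..<Suc m} = Suc ` {..<m}" for a m
    by (auto intro!: image_eqI[where f = Suc and b = x and x = "x - 1" for x])
  show ?thesis
    unfolding d_zero_def length_Cons sum.lessThan_Suc_shift img
    by (simp add: sum.reindex sum_negf sum_subtractf algebra_simps)
qed

lemma d_prime_Cons:
  "d_prime br sW \<omega> k (e # es) hs = (\<Sum>j<length hs. \<omega> k es (hs[j := br (hs ! j) e]))
    - d_prime br sW (contr e \<omega>) k es hs"
  unfolding d_prime_def length_Cons sum.lessThan_Suc_shift
  by (simp add: sum_negf)

text \<open>\<delta> puts h in front of e, whereas inserting e beforehand puts it behind. Exchanging
  the two costs the term with (h, e) as an argument from H.\<close>

lemma d_delta_Cons: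
  assumes c: "\<omega> \<in> cochains n" and ok: "ok k hs"
  shows "d_delta \<omega> k (e # es) hs = - hsum (\<lambda>x r. \<omega> k es (sym_bracket br x e # r)) hs
    - d_delta (contr e \<omega>) k es hs"
proof -
  have "hsum (\<lambda>x r. \<omega> (k - 1) (x # e # es) r) hs =
      hsum (\<lambda>x r. - \<omega> k es (sym_bracket br x e # r) - \<omega> (k - 1) (e # x # es) r) hs"
  proof (rule hsum_cong)
    fix x r assume "mset hs = add_mset x (mset r)"
    \<comment> \<open>The list \<open>hs\<close> is not empty here, so \<open>k\<close> is positive
      and the truncated subtraction is a true one.\<close>
    from mset_ok[OF this ok] have "Suc (k - 1) = k" by simp
    then show "\<omega> (k - 1) (x # e # es) r = - \<omega> k es (sym_bracket br x e # r) - \<omega> (k - 1) (e # x # es) r"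
      using family_apply[OF contr_swap[OF c, of e x], of "k - 1" es r]
        family_apply[OF contr_swap[OF c, of x e], of "k - 1" es r]
      by (simp add: sym_bracket_commute)
  qed
  then show ?thesis
    unfolding d_delta_def hsum_conv_sum[symmetric] hsum_conv_sum[of "\<lambda>x r. _ (k - 1) (x # _) r", symmetric]
    by (simp add: hsum_conv_sum sum_subtractf sum_negf)
qed

text \<open>Write (h, e) = h \<circ> e + e \<circ> h in the correction from \<delta>: the part with
  h \<circ> e cancels the part of d' in which e is removed, and the part with e \<circ> h is the
  action of \<open>lie e\<close> on the arguments from H.\<close>

lemma dif_raw_conv_sum:
  assumes "\<omega> \<in> cochains n" and ok: "ok k hs"
  shows "d_zero br act sW \<omega> k es hs + d_delta \<omega> k es hs + d_prime br sW \<omega> k es hs = dif_raw es \<omega> k hs"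
  using assms(1)
proof (induction es arbitrary: \<omega> n)
  case Nil
  show ?case by (simp add: d_zero_def d_prime_def d_delta_def hsum_conv_sum)
next
  case (Cons e es)
  note c = Cons.prems
  have "hsum (\<lambda>x r. \<omega> k es (sym_bracket br x e # r)) hs =
      hsum (\<lambda>x r. \<omega> k es (br x e # r) + \<omega> k es (br e x # r)) hs"
  proof (rule hsum_cong)
    fix x r assume "mset hs = add_mset x (mset r)"
    from mset_ok[OF this ok] have "x \<in> H" by simp
    then show "\<omega> k es (sym_bracket br x e # r) = \<omega> k es (br x e # r) + \<omega> k es (br e x # r)"
      unfolding sym_bracket_def by (simp add: cochain_hadd[OF c] br_H_left br_H_right)
  qed
  moreover have "(\<Sum>j<length hs. \<omega> k es (hs[j := br (hs ! j) e])) = hsum (\<lambda>x r. \<omega> k es (br x e # r)) hs"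
    unfolding hsum_conv_sum
    by (intro sum.cong refl cochain_sym[OF c]) (simp add: mset_list_update_omit)
  moreover have "dif_raw es (contr e \<omega>) k hs = d_zero br act sW (contr e \<omega>) k es hs
      + d_delta (contr e \<omega>) k es hs + d_prime br sW (contr e \<omega>) k es hs"
    by (rule Cons.IH[OF contr_cochains'[OF c], symmetric])
  ultimately show ?case
    by (simp add: d_zero_Cons d_prime_Cons d_delta_Cons[OF c ok] lie_raw_conv_sum hsum_add)
qed

lemma standard_d_eq_dif:
  assumes "\<omega> \<in> cochains n"
  shows "standard_d br H act sW n \<omega> = dif \<omega>"
proof (intro ext)
  fix k es hs
  show "standard_d br H act sW n \<omega> k es hs = dif \<omega> k es hs"
  proof (cases "args (Suc n) H k es hs")
    case True
    then have "ok k hs" by (simp add: args_def)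
    with True show ?thesis
      by (simp add: standard_d_def dif_raw_conv_sum[OF assms] dif_def)
  qed (simp add: standard_d_def dif_zero_outside[OF assms])
qed

lemma cochain_complex: "cochain_complex (family_scale sW) cochains (standard_d br H act sW)"
  unfolding cochain_complex_def linear_on_def
  by (auto simp: vector_space_family_scale subspace_cochains standard_d_eq_dif add_cochain scale_cochain
      dif_add dif_scale dif_cochains dif_dif)

end

section \<open>The standard complex of a Courant-Dorfman algebra\<close>

text \<open>\<open>emb\<close> is the structure map of the algebra R; through it field scalars are
  treated as elements of R. The Leibniz identity and the flatness of \<nabla> come from the parent
  locale.\<close>

locale courant_dorfman_complex = leibniz_complex sE br H sW nab
  for sE :: "'k::field \<Rightarrow> 'e::ab_group_add \<Rightarrow> 'e" and br H
    and sW :: "'k \<Rightarrow> 'w::ab_group_add \<Rightarrow> 'w" and nab +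
  fixes emb :: "'k \<Rightarrow> 'r::comm_ring_1" and rE :: "'r \<Rightarrow> 'e \<Rightarrow> 'e" and rW :: "'r \<Rightarrow> 'w \<Rightarrow> 'w"
    and form :: "'e \<Rightarrow> 'e \<Rightarrow> 'r" and der :: "'r \<Rightarrow> 'e"
  assumes E_module: "module rE" and W_module: "module rW"
    and sE_eq: "sE c x = rE (emb c) x" and sW_eq: "sW c w = rW (emb c) w"
    and form_add_left: "form (x + y) z = form x z + form y z"
    and form_rE_left: "form (rE f x) y = f * form x y"
    and form_commute: "form x y = form y x"
    and der_add: "der (f + g) = der f + der g"
    and der_mult: "der (f * g) = rE f (der g) + rE g (der f)"
    and br_rE_right: "br x (rE f y) = rE f (br x y) + rE (form x (der f)) y"
    and form_invariant: "form x (der (form y z)) = form (br x y) z + form y (br x z)"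
    and sym_bracket_eq: "sym_bracket br x y = der (form x y)"
    and br_der_left: "br (der f) x = 0"
    and der_in_H: "der f \<in> H"
    and rE_in_H: "h \<in> H \<Longrightarrow> rE f h \<in> H"
    and form_H: "h \<in> H \<Longrightarrow> h' \<in> H \<Longrightarrow> form h h' = 0"
    and nab_rE: "nab (rE f x) w = rW f (nab x w)"
    and nab_rW: "nab x (rW f w) = rW (form x (der f)) w + rW f (nab x w)"
begin

sublocale ME: module rE by (rule E_module)
sublocale MW: module rW by (rule W_module)

lemma form_add_right: "form z (x + y) = form z x + form z y"
  unfolding form_commute[of z "x + y"] form_commute[of z x] form_commute[of z y] by (rule form_add_left)

lemma form_rE_right: "form y (rE f x) = f * form y x"
  unfolding form_commute[of y "rE f x"] form_commute[of y x] by (rule form_rE_left)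

lemma form_sE_right: "form y (sE c x) = emb c * form y x"
  by (simp add: sE_eq form_rE_right)

lemma rW_sW: "rW f (sW c w) = sW c (rW f w)"
  by (simp add: sW_eq mult.commute)

lemma br_der_right: "br x (der f) = der (form x (der f))"
  using sym_bracket_eq[of x "der f"] by (simp add: sym_bracket_def br_der_left)

text \<open>Exchange the arguments at the cost of \<partial>\<langle>f x, y\<rangle>, apply the rule
  in the second argument, and expand \<partial> by the product rule.\<close>

lemma br_rE_left: "br (rE f x) y = rE f (br x y) - rE (form y (der f)) x + rE (form x y) (der f)"
proof -
  have 1: "br (rE f x) y = der (form (rE f x) y) - br y (rE f x)"
    using sym_bracket_eq[of "rE f x" y] by (simp add: sym_bracket_def eq_diff_eq)
  have 2: "der (form x y) = br x y + br y x"
    using sym_bracket_eq[of x y] by (simp add: sym_bracket_def)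
  show ?thesis
    unfolding 1 by (simp add: form_rE_left der_mult br_rE_right 2 ME.scale_right_distrib)
qed

abbreviation mul :: "'r \<Rightarrow> ('e, 'w) family \<Rightarrow> ('e, 'w) family" where
  "mul \<equiv> family_scale rW"

lemma mul_zero [simp]: "mul f 0 = 0"
  and mul_add: "mul f (\<omega> + \<eta>) = mul f \<omega> + mul f \<eta>"
  and mul_diff: "mul f (\<omega> - \<eta>) = mul f \<omega> - mul f \<eta>"
  and mul_minus: "mul f (- \<omega>) = - mul f \<omega>"
  and mul_add_left: "mul (f + g) \<omega> = mul f \<omega> + mul g \<omega>"
  and mul_mul: "mul f (mul g \<omega>) = mul (f * g) \<omega>"
  by (simp_all add: fun_eq_iff MW.scale_right_distrib MW.scale_left_distrib MW.scale_right_diff_distrib)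

lemma scale_eq_mul: "family_scale sW c \<omega> = mul (emb c) \<omega>"
  by (simp add: fun_eq_iff sW_eq)

section \<open>Exterior multiplication by a pairing\<close>

text \<open>The sum in the second axiom of cochains is \<open>wedge x (hcontr (der f) \<omega>)\<close>.\<close>

primrec wedge_raw :: "'e \<Rightarrow> 'e list \<Rightarrow> ('e, 'w) family \<Rightarrow> nat \<Rightarrow> 'e list \<Rightarrow> 'w" where
  "wedge_raw x [] \<eta> k hs = 0"
| "wedge_raw x (y # es) \<eta> k hs = - rW (form x y) (\<eta> k es hs) - wedge_raw x es (contr y \<eta>) k hs"

definition wedge :: "'e \<Rightarrow> ('e, 'w) family \<Rightarrow> ('e, 'w) family" where
  "wedge x \<eta> = (\<lambda>k es hs. wedge_raw x es \<eta> k hs)"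

lemma wedge_Nil [simp]: "wedge x \<eta> k [] hs = 0"
  and wedge_Cons: "wedge x \<eta> k (y # es) hs = - rW (form x y) (\<eta> k es hs) - wedge x (contr y \<eta>) k es hs"
  by (simp_all add: wedge_def)

lemma contr_wedge: "contr y (wedge x \<eta>) = - mul (form x y) \<eta> - wedge x (contr y \<eta>)"
  by (intro ext) (simp add: wedge_Cons)

lemma wedge_conv_sum:
  "wedge x \<eta> k ys hs = (\<Sum>b<length ys. sW ((-1) ^ Suc b) (rW (form x (ys ! b)) (\<eta> k (omit b ys) hs)))"
proof (induction ys arbitrary: \<eta>)
  case (Cons y ys)
  have "wedge x (contr y \<eta>) k ys hs =
      (\<Sum>b<length ys. sW ((-1) ^ Suc b) (rW (form x (ys ! b)) (contr y \<eta> k (omit b ys) hs)))"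
    by (rule Cons.IH)
  then show ?case
    by (simp add: wedge_Cons sum.lessThan_Suc_shift sum_negf del: sum.lessThan_Suc)
qed simp

text \<open>With the sign absorbed into the coefficient, everything is expressed through the action
  of R alone, and algebra in R suffices to rearrange it.\<close>

lemma wedge_conv_rW_sum:
  "wedge x \<eta> k ys hs = (\<Sum>b<length ys. rW ((-1) ^ Suc b * form x (ys ! b)) (\<eta> k (omit b ys) hs))"
proof (induction ys arbitrary: \<eta>)
  case (Cons y ys)
  have "wedge x (contr y \<eta>) k ys hs =
      (\<Sum>b<length ys. rW ((-1) ^ Suc b * form x (ys ! b)) (contr y \<eta> k (omit b ys) hs))"
    by (rule Cons.IH)
  then show ?case
    by (simp add: wedge_Cons sum.lessThan_Suc_shift sum_negf MW.scale_minus_left del: sum.lessThan_Suc)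
qed simp

lemma wedge_add: "wedge x (\<omega> + \<eta>) = wedge x \<omega> + wedge x \<eta>"
  by (intro ext) (simp add: wedge_conv_rW_sum MW.scale_right_distrib sum.distrib sum_subtractf sum_negf)

lemma wedge_mul: "wedge x (mul f \<eta>) = mul f (wedge x \<eta>)"
  by (intro ext) (simp add: wedge_conv_rW_sum MW.scale_sum_right ac_simps)

lemma wedge_zero [simp]: "wedge x 0 = 0"
  using wedge_add[of x 0 0] by simp

lemma wedge_minus: "wedge x (- \<eta>) = - wedge x \<eta>"
  using wedge_add[of x \<eta> "- \<eta>"] by (simp add: eq_neg_iff_add_eq_0 add.commute)

lemma wedge_diff: "wedge x (\<omega> - \<eta>) = wedge x \<omega> - wedge x \<eta>"
  using wedge_add[of x \<omega> "- \<eta>"] by (simp add: wedge_minus)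

lemma wedge_add_left: "wedge (x + y) \<eta> = wedge x \<eta> + wedge y \<eta>"
  by (intro ext) (simp add: wedge_conv_rW_sum form_add_left distrib_left MW.scale_left_distrib
      MW.scale_left_diff_distrib sum.distrib sum_subtractf sum_negf)

lemma wedge_rE_left: "wedge (rE f x) \<eta> = mul f (wedge x \<eta>)"
  by (intro ext) (simp add: wedge_conv_rW_sum form_rE_left MW.scale_sum_right ac_simps)

lemma hcontr_wedge: "hcontr h (wedge x \<eta>) = wedge x (hcontr h \<eta>)"
  by (intro ext) (simp add: wedge_conv_rW_sum)

text \<open>The rule concerns all families, so the induction runs over the list instead of the
  degree.\<close>

lemma wedge_anticommute_apply: "wedge x (wedge y \<eta>) k es hs = - wedge y (wedge x \<eta>) k es hs"
proof (induction es arbitrary: \<eta>)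
  case (Cons a es)
  have "wedge x (wedge y (contr a \<eta>)) k es hs = - wedge y (wedge x (contr a \<eta>)) k es hs"
    by (rule Cons.IH)
  then show ?case
    by (simp add: wedge_Cons contr_wedge wedge_diff wedge_minus wedge_mul)
qed simp

lemma wedge_anticommute: "wedge x (wedge y \<eta>) = - wedge y (wedge x \<eta>)"
  by (intro ext) (simp add: wedge_anticommute_apply[of x y])

lemma mul_cochain: "\<omega> \<in> cochains n \<Longrightarrow> mul f \<omega> \<in> cochains n"
  unfolding family_scale_def by (rule map_cochain) (simp_all add: MW.scale_right_distrib rW_sW)

lemma wedge_cochain: "\<eta> \<in> cochains n \<Longrightarrow> wedge x \<eta> \<in> cochains (Suc n)"
proof (induction n arbitrary: \<eta> rule: less_induct)
  case (less n \<eta>)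
  note c = less.prems
  show ?case
  proof (rule cochains_I)
    fix k es hs assume a: "\<not> args (Suc n) H k es hs"
    have "\<eta> k (omit b es) hs = 0" if "b < length es" for b
      by (rule cochain_zero_outside[OF c]) (use a that in \<open>auto simp: args_def length_omit\<close>)
    then show "wedge x \<eta> k es hs = 0" by (simp add: wedge_conv_sum)
  next
    fix y z
    show "contr (y + z) (wedge x \<eta>) = contr y (wedge x \<eta>) + contr z (wedge x \<eta>)"
      by (simp add: contr_wedge contr_add_left[OF c] form_add_right mul_add_left wedge_add)
  next
    fix a y
    show "contr (sE a y) (wedge x \<eta>) = family_scale sW a (contr y (wedge x \<eta>))"
      by (simp add: contr_wedge contr_scale_left[OF c] form_sE_right scale_eq_mul mul_diff mul_minus mul_mul wedge_mul)
  next
    fix y z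
    have "wedge x (contr z (contr y \<eta>)) = - wedge x (hcontr (sym_bracket br y z) \<eta>) - wedge x (contr y (contr z \<eta>))"
      by (simp add: contr_swap[OF c, of z y] wedge_diff wedge_minus)
    then show "contr z (contr y (wedge x \<eta>)) + contr y (contr z (wedge x \<eta>)) = - hcontr (sym_bracket br y z) (wedge x \<eta>)"
      by (simp add: contr_wedge contr_diff contr_minus contr_scale hcontr_wedge)
  next
    fix m y assume m: "Suc n = Suc m"
    have "wedge x (contr y \<eta>) \<in> cochains m"
    proof (cases n)
      case 0
      with c show ?thesis by (simp add: contr_cochains_0 zero_cochain)
    next
      case (Suc p)
      then have "wedge x (contr y \<eta>) \<in> cochains (Suc p)"
        using c by (intro less.IH contr_cochains) auto
      then show ?thesis using m Suc by simp
    qed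
    then show "contr y (wedge x \<eta>) \<in> cochains m"
      using m c by (auto simp: contr_wedge intro!: diff_cochain minus_cochain mul_cochain)
  qed simp_all
qed

section \<open>Courant-Dorfman cochains\<close>

abbreviation cd :: "nat \<Rightarrow> ('e, 'w) family set" where
  "cd \<equiv> courant_dorfman_cochains sE rE form der H sW rW"

text \<open>By the third axiom (x, y) = \<partial>\<langle>x, y\<rangle>, so the skew-symmetry
  conditions agree. Everything proved for Leibniz cochains applies, and only the behaviour under
  multiplication by R has to be followed.\<close>

lemma cd_cochain: "\<omega> \<in> cd n \<Longrightarrow> \<omega> \<in> cochains n"
  by (simp add: courant_dorfman_cochains_def leibniz_cochains_def sym_bracket_eq)

lemma cd_contr_rE:
  assumes "\<omega> \<in> cd n"
  shows "contr (rE f x) \<omega> = mul f (contr x \<omega>) + wedge x (hcontr (der f) \<omega>)"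
proof (intro ext)
  fix k es hs
  show "contr (rE f x) \<omega> k es hs = (mul f (contr x \<omega>) + wedge x (hcontr (der f) \<omega>)) k es hs"
  proof (cases "args n H k ([] @ x # es) hs")
    case True
    then have "\<omega> k ([] @ rE f x # es) hs = rW f (\<omega> k ([] @ x # es) hs) +
         (\<Sum>b<length es. sW ((-1) ^ Suc b)
            (rW (form x (es ! b)) (\<omega> (Suc k) ([] @ omit b es) (der f # hs))))"
      using assms unfolding courant_dorfman_cochains_def by blast
    then show ?thesis by (simp add: wedge_conv_sum)
  next
    case False
    note z = cochain_zero_outside[OF cd_cochain[OF assms]]
    have "\<omega> k (x # es) hs = 0" "\<omega> k (rE f x # es) hs = 0"
      using False by (auto intro!: z simp: args_def)
    moreover have "\<omega> (Suc k) (omit b es) (der f # hs) = 0" if "b < length es" for b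
      using False that by (intro z) (auto simp: args_def length_omit)
    ultimately show ?thesis by (simp add: wedge_conv_sum)
  qed
qed

lemma cd_hcontr_rE:
  assumes "\<omega> \<in> cd n" "h \<in> H"
  shows "hcontr (rE f h) \<omega> = mul f (hcontr h \<omega>)"
proof (intro ext)
  fix k es hs
  show "hcontr (rE f h) \<omega> k es hs = mul f (hcontr h \<omega>) k es hs"
  proof (cases "args n H (Suc k) es ([] @ h # hs)")
    case True
    then have "\<omega> (Suc k) es ([] @ rE f h # hs) = rW f (\<omega> (Suc k) es ([] @ h # hs))"
      using assms(1) unfolding courant_dorfman_cochains_def by blast
    then show ?thesis by simp
  next
    case False
    note z = cochain_zero_outside[OF cd_cochain[OF assms(1)]]
    have "\<omega> (Suc k) es (h # hs) = 0" "\<omega> (Suc k) es (rE f h # hs) = 0"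
      using False assms(2) by (auto intro!: z simp: args_def)
    then show ?thesis by simp
  qed
qed

lemma contr_cd:
  assumes "\<omega> \<in> cd (Suc n)"
  shows "contr y \<omega> \<in> cd n"
proof -
  have a: "args (Suc n) H k (y # es) hs \<longleftrightarrow> args n H k es hs" for k es hs
    by (simp add: args_def)
  have 2: "\<omega> k (y # xs @ rE f x # ys) hs =
         rW f (\<omega> k (y # xs @ x # ys) hs) +
         (\<Sum>b<length ys. sW ((-1) ^ Suc b)
            (rW (form x (ys ! b)) (\<omega> (Suc k) (y # xs @ omit b ys) (der f # hs))))"
    if "args n H k (xs @ x # ys) hs" for k xs x ys hs f
  proof -
    have "args (Suc n) H k ((y # xs) @ x # ys) hs" using that by (simp add: a)
    then have "\<omega> k ((y # xs) @ rE f x # ys) hs =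
         rW f (\<omega> k ((y # xs) @ x # ys) hs) +
         (\<Sum>b<length ys. sW ((-1) ^ Suc b)
            (rW (form x (ys ! b)) (\<omega> (Suc k) ((y # xs) @ omit b ys) (der f # hs))))"
      using assms unfolding courant_dorfman_cochains_def by blast
    then show ?thesis by simp
  qed
  have 3: "\<omega> k (y # es) (us @ rE f h # vs) = rW f (\<omega> k (y # es) (us @ h # vs))"
    if "args n H k es (us @ h # vs)" for k es us h vs f
  proof -
    have "args (Suc n) H k (y # es) (us @ h # vs)" using that by (simp add: a)
    then show ?thesis using assms unfolding courant_dorfman_cochains_def by blast
  qed
  have "contr y \<omega> \<in> cochains n" using contr_cochains[OF cd_cochain[OF assms]] .
  with 2 3 show ?thesis
    unfolding courant_dorfman_cochains_def leibniz_cochains_def sym_bracket_eq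
    by (auto simp del: power_Suc)
qed

text \<open>As for Leibniz cochains, the conditions at later arguments are inherited from the
  insertions; linearity over R in H is checked on the empty list, in the first slot.\<close>

lemma cd_I:
  assumes c: "\<omega> \<in> cochains n"
    and head: "\<And>f x. contr (rE f x) \<omega> = mul f (contr x \<omega>) + wedge x (hcontr (der f) \<omega>)"
    and base: "\<And>k h hs f. h \<in> H \<Longrightarrow> ok k hs \<Longrightarrow> \<omega> (Suc k) [] (rE f h # hs) = rW f (\<omega> (Suc k) [] (h # hs))"
    and step: "\<And>m x. n = Suc m \<Longrightarrow> contr x \<omega> \<in> cd m"
  shows "\<omega> \<in> cd n"
proof -
  have 2: "\<omega> k (xs @ rE f x # ys) hs =
         rW f (\<omega> k (xs @ x # ys) hs) +
         (\<Sum>b<length ys. sW ((-1) ^ Suc b)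
            (rW (form x (ys ! b)) (\<omega> (Suc k) (xs @ omit b ys) (der f # hs))))"
    if A: "args n H k (xs @ x # ys) hs" for k xs x ys hs f
  proof (cases xs)
    case Nil
    then show ?thesis
      using family_apply[OF head[of f x], of k ys hs] by (simp add: wedge_conv_sum)
  next
    case (Cons a xs')
    then obtain m where m: "n = Suc m" "args m H k (xs' @ x # ys) hs"
      using A by (auto simp: args_def)
    have "contr a \<omega> k (xs' @ rE f x # ys) hs =
         rW f (contr a \<omega> k (xs' @ x # ys) hs) +
         (\<Sum>b<length ys. sW ((-1) ^ Suc b)
            (rW (form x (ys ! b)) (contr a \<omega> (Suc k) (xs' @ omit b ys) (der f # hs))))"
      using step[OF m(1), of a] m(2) unfolding courant_dorfman_cochains_def by blast
    then show ?thesis using Cons by simp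
  qed
  have 3: "\<omega> k es (us @ rE f h # vs) = rW f (\<omega> k es (us @ h # vs))"
    if A: "args n H k es (us @ h # vs)" for k es us h vs f
  proof (cases es)
    case Nil
    have h: "h \<in> H" "ok (k - 1) (us @ vs)" "k = Suc (k - 1)"
      using A by (auto simp: args_def)
    have "\<omega> k [] (rE f h # us @ vs) = rW f (\<omega> k [] (h # us @ vs))"
      using base[OF h(1,2), of f] h(3) by simp
    moreover have "\<omega> k [] (us @ g # vs) = \<omega> k [] (g # us @ vs)" for g
      by (rule cochain_sym[OF c]) simp
    ultimately show ?thesis using Nil by simp
  next
    case (Cons a es')
    then obtain m where m: "n = Suc m" "args m H k es' (us @ h # vs)"
      using A by (auto simp: args_def)
    have "contr a \<omega> k es' (us @ rE f h # vs) = rW f (contr a \<omega> k es' (us @ h # vs))"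
      using step[OF m(1), of a] m(2) unfolding courant_dorfman_cochains_def by blast
    then show ?thesis using Cons by simp
  qed
  show ?thesis
    unfolding courant_dorfman_cochains_def
  proof (intro CollectI conjI allI impI)
    show "\<omega> \<in> multilinear_families sE H sW n"
      using c by (simp add: leibniz_cochains_def)
    fix k xs x y ys hs assume "args n H k (xs @ x # y # ys) hs"
    then show "\<omega> k (xs @ x # y # ys) hs + \<omega> k (xs @ y # x # ys) hs = - \<omega> (Suc k) (xs @ ys) (der (form x y) # hs)"
      using c unfolding leibniz_cochains_def sym_bracket_eq by blast
  qed (auto intro: 2 3 simp del: power_Suc)
qed

lemma zero_cd: "0 \<in> cd n"
proof (induction n)
  case 0
  show ?case by (rule cd_I[where \<omega> = 0]) (simp_all add: zero_cochain)
next
  case (Suc n)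
  have z: "(0 :: ('e, 'w) family) \<in> cd n" by (rule Suc)
  show ?case by (rule cd_I[where \<omega> = 0]) (use z in \<open>simp_all add: zero_cochain\<close>)
qed

lemma contr_cd': 
  assumes "\<omega> \<in> cd n"
  shows "contr x \<omega> \<in> cd (n - 1)"
proof (cases n)
  case 0
  with assms show ?thesis using contr_cochains_0[OF cd_cochain, of \<omega> x] by (simp add: zero_cd)
next
  case (Suc m)
  with assms show ?thesis using contr_cd[of \<omega> m x] by simp
qed

lemma add_cd: "\<omega> \<in> cd n \<Longrightarrow> \<eta> \<in> cd n \<Longrightarrow> \<omega> + \<eta> \<in> cd n"
proof (induction n arbitrary: \<omega> \<eta> rule: less_induct)
  case (less n \<omega> \<eta>)
  note c = less.prems
  show ?case
  proof (rule cd_I)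
    show "\<omega> + \<eta> \<in> cochains n" using c by (intro add_cochain cd_cochain)
    fix f x
    show "contr (rE f x) (\<omega> + \<eta>) = mul f (contr x (\<omega> + \<eta>)) + wedge x (hcontr (der f) (\<omega> + \<eta>))"
      by (simp add: contr_add hcontr_add mul_add wedge_add cd_contr_rE[OF c(1)] cd_contr_rE[OF c(2)])
  next
    fix k h hs f assume h: "h \<in> H"
    show "(\<omega> + \<eta>) (Suc k) [] (rE f h # hs) = rW f ((\<omega> + \<eta>) (Suc k) [] (h # hs))"
      using family_apply[OF cd_hcontr_rE[OF c(1) h, of f], of k "[]" hs]
        family_apply[OF cd_hcontr_rE[OF c(2) h, of f], of k "[]" hs]
      by (simp add: MW.scale_right_distrib)
  next
    fix m x assume "n = Suc m"
    then show "contr x (\<omega> + \<eta>) \<in> cd m"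
      using c by (auto simp: contr_add intro!: less.IH contr_cd)
  qed
qed

lemma mul_cd: "\<omega> \<in> cd n \<Longrightarrow> mul g \<omega> \<in> cd n"
proof (induction n arbitrary: \<omega> rule: less_induct)
  case (less n \<omega>)
  note c = less.prems
  show ?case
  proof (rule cd_I)
    show "mul g \<omega> \<in> cochains n" using c by (intro mul_cochain cd_cochain)
    fix f x
    show "contr (rE f x) (mul g \<omega>) = mul f (contr x (mul g \<omega>)) + wedge x (hcontr (der f) (mul g \<omega>))"
      by (simp add: contr_scale hcontr_scale mul_add mul_mul mult.commute wedge_mul cd_contr_rE[OF c])
  next
    fix k h hs f assume h: "h \<in> H"
    show "mul g \<omega> (Suc k) [] (rE f h # hs) = rW f (mul g \<omega> (Suc k) [] (h # hs))"
      using family_apply[OF cd_hcontr_rE[OF c h, of f], of k "[]" hs]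
      by (simp add: mult.commute)
  next
    fix m x assume "n = Suc m"
    then show "contr x (mul g \<omega>) \<in> cd m"
      using c by (auto simp: contr_scale intro!: less.IH contr_cd)
  qed
qed

lemma scale_cd: "\<omega> \<in> cd n \<Longrightarrow> family_scale sW c \<omega> \<in> cd n"
  by (simp add: scale_eq_mul mul_cd)

lemma minus_cd: "\<omega> \<in> cd n \<Longrightarrow> - \<omega> \<in> cd n"
  using scale_cd[of \<omega> n "- 1"] by (simp add: family_scale_minus_one)

lemma diff_cd: "\<omega> \<in> cd n \<Longrightarrow> \<eta> \<in> cd n \<Longrightarrow> \<omega> - \<eta> \<in> cd n"
  using add_cd[OF _ minus_cd, of \<omega> n \<eta>] by simp

lemma hcontr_cd: "\<omega> \<in> cd n \<Longrightarrow> h \<in> H \<Longrightarrow> hcontr h \<omega> \<in> cd (n - 2)"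
proof (induction n arbitrary: \<omega> rule: less_induct)
  case (less n \<omega>)
  note c = less.prems(1) and h = less.prems(2)
  show ?case
  proof (rule cd_I)
    show "hcontr h \<omega> \<in> cochains (n - 2)" using c h by (intro hcontr_cochains cd_cochain)
    fix f x
    show "contr (rE f x) (hcontr h \<omega>) = mul f (contr x (hcontr h \<omega>)) + wedge x (hcontr (der f) (hcontr h \<omega>))"
      by (simp add: contr_hcontr cd_contr_rE[OF c] hcontr_add hcontr_scale hcontr_wedge hcontr_commute[OF cd_cochain[OF c], of "der f"])
  next
    fix k h' hs f assume h': "h' \<in> H"
    show "hcontr h \<omega> (Suc k) [] (rE f h' # hs) = rW f (hcontr h \<omega> (Suc k) [] (h' # hs))"
      using family_apply[OF cd_hcontr_rE[OF c h', of f], of "Suc k" "[]" "h # hs"]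
      by (simp add: cochain_hswap[OF cd_cochain[OF c], where a = h])
  next
    fix m x assume m: "n - 2 = Suc m"
    then have "n - 1 < n" "n - 1 - 2 = m" by auto
    then show "contr x (hcontr h \<omega>) \<in> cd m"
      unfolding contr_hcontr using less.IH[of "n - 1" "contr x \<omega>"] contr_cd'[OF c, of x] h by metis
  qed
qed

text \<open>Moving \<langle>y, \<cdot>\<rangle> past \<langle>x, \<cdot>\<rangle> changes the sign,
  as the rule for inserting into \<open>wedge x \<eta>\<close> demands.\<close>

lemma wedge_cd: "\<eta> \<in> cd n \<Longrightarrow> wedge x \<eta> \<in> cd (Suc n)"
proof (induction n arbitrary: \<eta> rule: less_induct)
  case (less n \<eta>)
  note c = less.prems
  show ?case
  proof (rule cd_I)
    show "wedge x \<eta> \<in> cochains (Suc n)" using c by (intro wedge_cochain cd_cochain)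
    fix f y
    show "contr (rE f y) (wedge x \<eta>) = mul f (contr y (wedge x \<eta>)) + wedge y (hcontr (der f) (wedge x \<eta>))"
      by (simp add: contr_wedge cd_contr_rE[OF c] form_rE_right wedge_add wedge_mul hcontr_wedge mul_diff mul_minus mul_mul
          wedge_anticommute[of y x])
  next
    fix m y assume m: "Suc n = Suc m"
    have "wedge x (contr y \<eta>) \<in> cd m"
    proof (cases n)
      case 0
      with c show ?thesis by (simp add: contr_cochains_0[OF cd_cochain] zero_cd)
    next
      case (Suc p)
      then have "wedge x (contr y \<eta>) \<in> cd (Suc p)"
        using c by (intro less.IH contr_cd) auto
      then show ?thesis using m Suc by simp
    qed
    then show "contr y (wedge x \<eta>) \<in> cd m"
      using m c by (auto simp: contr_wedge intro!: diff_cd minus_cd mul_cd)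
  qed simp
qed

section \<open>Compatibility of the calculus with multiplication by R\<close>

lemma lie_mul:
  assumes "\<eta> \<in> cochains n"
  shows "lie e (mul f \<eta>) = mul (form e (der f)) \<eta> + mul f (lie e \<eta>)"
  using assms
proof (rule cochain_op_eqI)
  fix \<eta> n k hs assume c: "\<eta> \<in> cochains n"
  show "lie e (mul f \<eta>) k [] hs = (mul (form e (der f)) \<eta> + mul f (lie e \<eta>)) k [] hs"
  proof (cases "ok k hs")
    case True
    then show ?thesis
      by (simp add: lie_Nil nab_rW hsum_hom[of "rW f"] MW.scale_right_distrib MW.scale_right_diff_distrib)
  next
    case False
    then show ?thesis by (simp add: lie_not_ok cochain_zero_not_ok[OF c])
  qed
next
  fix \<eta> n y assume c: "\<eta> \<in> cochains n"
    and IH: "lie e (mul f (contr y \<eta>)) = mul (form e (der f)) (contr y \<eta>) + mul f (lie e (contr y \<eta>))"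
  then show "contr y (lie e (mul f \<eta>)) = contr y (mul (form e (der f)) \<eta> + mul f (lie e \<eta>))"
    by (simp add: contr_lie[OF mul_cochain[OF c]] contr_lie[OF c] contr_scale contr_add mul_diff)
next
  show "lie e (mul f 0) = mul (form e (der f)) 0 + mul f (lie e 0)" by simp
qed

text \<open>Invariance of the pairing says that \<open>lie e\<close> takes \<langle>x,
  \<cdot>\<rangle> to \<langle>e \<circ> x, \<cdot>\<rangle>; the rule is the derivation property
  for the product.\<close>

lemma lie_wedge:
  assumes "\<eta> \<in> cochains n"
  shows "lie e (wedge x \<eta>) = wedge (br e x) \<eta> + wedge x (lie e \<eta>)"
  using assms
proof (rule cochain_op_eqI)
  fix \<eta> n k hs assume c: "\<eta> \<in> cochains n"
  show "lie e (wedge x \<eta>) k [] hs = (wedge (br e x) \<eta> + wedge x (lie e \<eta>)) k [] hs"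
    by (cases "ok k hs") (simp_all add: lie_Nil lie_not_ok)
next
  fix \<eta> n y assume c: "\<eta> \<in> cochains n"
    and IH: "lie e (wedge x (contr y \<eta>)) = wedge (br e x) (contr y \<eta>) + wedge x (lie e (contr y \<eta>))"
  then show "contr y (lie e (wedge x \<eta>)) = contr y (wedge (br e x) \<eta> + wedge x (lie e \<eta>))"
    by (simp add: contr_lie[OF wedge_cochain[OF c]] contr_lie[OF c] contr_wedge contr_add lie_diff lie_minus
        lie_mul[OF c] wedge_diff form_invariant mul_add_left)
next
  show "lie e (wedge x 0) = wedge (br e x) 0 + wedge x (lie e 0)" by simp
qed

text \<open>\<open>wedge\<close> starts with a minus sign, so \<open>- wedge (der f)\<close> is
  multiplication from the left by the 1-form df = \<langle>\<partial>f, \<cdot>\<rangle>, and this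
  is the usual product rule.\<close>

lemma dif_mul:
  assumes "\<eta> \<in> cochains n"
  shows "dif (mul f \<eta>) = mul f (dif \<eta>) - wedge (der f) \<eta>"
  using assms
proof (rule cochain_op_eqI)
  fix \<eta> n k hs assume c: "\<eta> \<in> cochains n"
  show "dif (mul f \<eta>) k [] hs = (mul f (dif \<eta>) - wedge (der f) \<eta>) k [] hs"
    by (cases "ok k hs") (simp_all add: dif_Nil dif_not_ok hsum_hom[of "rW f"] MW.scale_right_distrib)
next
  fix \<eta> n y assume c: "\<eta> \<in> cochains n"
    and IH: "dif (mul f (contr y \<eta>)) = mul f (dif (contr y \<eta>)) - wedge (der f) (contr y \<eta>)"
  then show "contr y (dif (mul f \<eta>)) = contr y (mul f (dif \<eta>) - wedge (der f) \<eta>)"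
    by (simp add: contr_dif contr_scale contr_diff contr_wedge lie_mul[OF c] mul_diff form_commute[of "der f"])
next
  show "dif (mul f 0) = mul f (dif 0) - wedge (der f) 0" by simp
qed

text \<open>The variant for identities whose base case uses linearity over R in the arguments from
  H.\<close>

lemma cd_op_eqI:
  assumes "\<omega> \<in> cd n" and zero: "F 0 = G 0"
    and base: "\<And>\<omega> n k hs. \<omega> \<in> cd n \<Longrightarrow> F \<omega> k [] hs = G \<omega> k [] hs"
    and step: "\<And>\<omega> n y. \<omega> \<in> cd n \<Longrightarrow> F (contr y \<omega>) = G (contr y \<omega>) \<Longrightarrow> contr y (F \<omega>) = contr y (G \<omega>)"
  shows "F \<omega> = G \<omega>"
  using assms(1)
proof (induction n arbitrary: \<omega>)
  case 0
  show ?case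
    by (rule family_ext) (auto intro: base[OF 0] step[OF 0] simp: contr_cochains_0[OF cd_cochain[OF 0]] zero)
next
  case (Suc n)
  show ?case
    by (rule family_ext) (auto intro: base[OF Suc.prems] step[OF Suc.prems] Suc.IH contr_cd[OF Suc.prems])
qed

text \<open>Multiplying x by f produces e \<circ> \<partial>f in a slot of H and (\<rho>(e) f) x at
  the head. As e \<circ> \<partial>f = \<partial>(\<rho>(e) f), the second axiom for the function
  \<rho>(e) f accounts for both.\<close>

lemma lie_cd: "\<omega> \<in> cd n \<Longrightarrow> lie e \<omega> \<in> cd n"
proof (induction n arbitrary: \<omega> rule: less_induct)
  case (less n \<omega>)
  note c = less.prems
  note c' = cd_cochain[OF c]
  show ?case
  proof (rule cd_I)
    show "lie e \<omega> \<in> cochains n" using c' by (rule lie_cochains)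
    fix f x
    have "contr (rE (form e (der f)) x) \<omega> = mul (form e (der f)) (contr x \<omega>) + wedge x (hcontr (br e (der f)) \<omega>)"
      by (simp add: cd_contr_rE[OF c] br_der_right)
    then show "contr (rE f x) (lie e \<omega>) = mul f (contr x (lie e \<omega>)) + wedge x (hcontr (der f) (lie e \<omega>))"
      by (simp add: contr_lie[OF c'] hcontr_lie[OF c' der_in_H] br_rE_right contr_add_left[OF c'] cd_contr_rE[OF c, of f]
          lie_add lie_mul[OF contr_cochains'[OF c']] lie_wedge[OF hcontr_cochains[OF c' der_in_H]] mul_diff wedge_diff)
  next
    fix k h hs f assume h: "h \<in> H" and ok: "ok k hs"
    have "\<omega> (Suc k) [] (rE f h # hs) = rW f (\<omega> (Suc k) [] (h # hs))" if "h \<in> H" for f h hs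
      using family_apply[OF cd_hcontr_rE[OF c that, of f], of k "[]" hs] by simp
    then show "lie e \<omega> (Suc k) [] (rE f h # hs) = rW f (lie e \<omega> (Suc k) [] (h # hs))"
      using h ok by (simp add: lie_Nil rE_in_H br_rE_right cochain_hadd[OF c'] br_H_right nab_rW
          cochain_hswap[OF c', where a = "br e _"] hsum_hom[of "rW f"] MW.scale_right_distrib MW.scale_right_diff_distrib)
  next
    fix m x assume "n = Suc m"
    then show "contr x (lie e \<omega>) \<in> cd m"
      using c by (auto simp: contr_lie[OF c'] intro!: diff_cd less.IH contr_cd)
  qed
qed

lemma wedge_der_form: "wedge (der (form x y)) \<eta> = wedge (br x y) \<eta> + wedge (br y x) \<eta>"
  by (simp add: sym_bracket_eq[symmetric] sym_bracket_def wedge_add_left)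

text \<open>
  By Cartan's formula and \<open>hcontr_dif\<close>, this identity is the second axiom for \<open>dif \<omega>\<close> at the first argument.
\<close>

lemma lie_rE_left:
  assumes "\<omega> \<in> cd n"
  shows "lie (rE f x) \<omega> = mul f (lie x \<omega>) - wedge (der f) (contr x \<omega>) + dif (wedge x (hcontr (der f) \<omega>))
    + wedge x (dif (hcontr (der f) \<omega>)) + wedge x (contr (der f) \<omega>)"
  using assms
proof (rule cd_op_eqI)
  fix \<omega> n k hs assume c: "\<omega> \<in> cd n"
  note c' = cd_cochain[OF c]
  show "lie (rE f x) \<omega> k [] hs = (mul f (lie x \<omega>) - wedge (der f) (contr x \<omega>) + dif (wedge x (hcontr (der f) \<omega>))
    + wedge x (dif (hcontr (der f) \<omega>)) + wedge x (contr (der f) \<omega>)) k [] hs"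
  proof (cases "ok k hs")
    case True
    have "hsum (\<lambda>h r. \<omega> k [] (br (rE f x) h # r)) hs =
        hsum (\<lambda>h r. rW f (\<omega> k [] (br x h # r)) + rW (form x h) (\<omega> (Suc (k - 1)) [] (der f # r))) hs"
    proof (rule hsum_cong)
      fix h r assume "mset hs = add_mset h (mset r)"
      from mset_ok[OF this True] have h: "h \<in> H" and k: "Suc (k - 1) = k" by simp_all
      have r: "\<omega> k [] (rE f g # r) = rW f (\<omega> k [] (g # r))" if "g \<in> H" for f g
        using family_apply[OF cd_hcontr_rE[OF c that, of f], of "k - 1" "[]" r] k by simp
      \<comment> \<open>The term with \<langle>h, \<partial>f\<rangle> vanishes, as both arguments
        lie in the isotropic H.\<close>
      have "br (rE f x) h = rE f (br x h) + rE (form x h) (der f)"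
        by (simp add: br_rE_left form_H[OF h der_in_H])
      then show "\<omega> k [] (br (rE f x) h # r) =
          rW f (\<omega> k [] (br x h # r)) + rW (form x h) (\<omega> (Suc (k - 1)) [] (der f # r))"
        unfolding k by (simp add: cochain_hadd[OF c'] br_H_right h der_in_H rE_in_H r)
    qed
    with True show ?thesis
      by (simp add: lie_Nil dif_Nil nab_rE hsum_add hsum_minus hsum_hom[of "rW f"] MW.scale_right_distrib
          MW.scale_right_diff_distrib wedge_Cons)
  next
    case False
    then show ?thesis by (simp add: lie_not_ok dif_not_ok)
  qed
next
  fix \<omega> n y assume c: "\<omega> \<in> cd n"
    and IH: "lie (rE f x) (contr y \<omega>) = mul f (lie x (contr y \<omega>)) - wedge (der f) (contr x (contr y \<omega>))
      + dif (wedge x (hcontr (der f) (contr y \<omega>)))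
      + wedge x (dif (hcontr (der f) (contr y \<omega>))) + wedge x (contr (der f) (contr y \<omega>))"
  note c' = cd_cochain[OF c]
  note h' = hcontr_cochains[OF c' der_in_H]
  have 1: "contr (br (rE f x) y) \<omega> = mul f (contr (br x y) \<omega>) + wedge (br x y) (hcontr (der f) \<omega>)
      - mul (form y (der f)) (contr x \<omega>) - wedge x (hcontr (der (form y (der f))) \<omega>)
      + mul (form x y) (contr (der f) \<omega>) + wedge (der f) (hcontr (der (form x y)) \<omega>)"
  proof -
    have "contr (a - b) \<omega> = contr a \<omega> - contr b \<omega>" for a b
      using contr_add_left[OF c', of "a - b" b] by (simp add: algebra_simps)
    then show ?thesis
      by (simp add: br_rE_left contr_add_left[OF c'] cd_contr_rE[OF c])
  qed
  have 2: "contr y (contr x \<omega>) = - hcontr (der (form x y)) \<omega> - contr x (contr y \<omega>)"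
    using contr_swap[OF c', of y x] by (simp add: sym_bracket_eq)
  have 3: "contr y (contr (der f) \<omega>) = - hcontr (der (form y (der f))) \<omega> - contr (der f) (contr y \<omega>)"
    using contr_swap[OF c', of y "der f"] by (simp add: sym_bracket_eq form_commute[of y])
  \<comment> \<open>The product rule for \<open>dif\<close> produces \<partial>\<langle>x,
    y\<rangle>, which splits as x \<circ> y + y \<circ> x: the first half meets fact 1, the second
    the derivative of \<open>wedge x\<close> along y.\<close>
  have 4: "dif (contr y (wedge x (hcontr (der f) \<omega>))) = - mul (form x y) (dif (hcontr (der f) \<omega>))
      + wedge (br x y) (hcontr (der f) \<omega>) + wedge (br y x) (hcontr (der f) \<omega>)
      - dif (wedge x (hcontr (der f) (contr y \<omega>)))"
    by (simp add: contr_wedge dif_diff dif_minus dif_mul[OF h'] wedge_der_form contr_hcontr)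
  show "contr y (lie (rE f x) \<omega>) = contr y (mul f (lie x \<omega>) - wedge (der f) (contr x \<omega>)
    + dif (wedge x (hcontr (der f) \<omega>)) + wedge x (dif (hcontr (der f) \<omega>)) + wedge x (contr (der f) \<omega>))"
    unfolding contr_lie[OF c'] IH 1 contr_add contr_diff contr_scale contr_dif
    unfolding 4 unfolding contr_wedge lie_wedge[OF h'] 2 3
    by (simp add: mul_diff wedge_diff wedge_minus contr_hcontr contr_dif form_commute[of y])
next
  show "lie (rE f x) 0 = mul f (lie x 0) - wedge (der f) (contr x 0) + dif (wedge x (hcontr (der f) 0))
    + wedge x (dif (hcontr (der f) 0)) + wedge x (contr (der f) 0)" by simp
qed

lemma dif_cd: "\<omega> \<in> cd n \<Longrightarrow> dif \<omega> \<in> cd (Suc n)"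
proof (induction n arbitrary: \<omega> rule: less_induct)
  case (less n \<omega>)
  note c = less.prems
  note c' = cd_cochain[OF c]
  show ?case
  proof (rule cd_I)
    show "dif \<omega> \<in> cochains (Suc n)" using c' by (rule dif_cochains)
    fix f x
    show "contr (rE f x) (dif \<omega>) = mul f (contr x (dif \<omega>)) + wedge x (hcontr (der f) (dif \<omega>))"
      \<comment> \<open>The terms \<open>dif (wedge x (hcontr (der f) \<omega>))\<close> and
        \<open>wedge (der f) (contr x \<omega>)\<close> cancel. The two wedges that are left combine
        to \<open>wedge x (hcontr (der f) (dif \<omega>))\<close>, since \<partial>f is left
        central.\<close>
      by (simp add: contr_dif lie_rE_left[OF c] cd_contr_rE[OF c] dif_add dif_mul[OF contr_cochains'[OF c']]
          hcontr_dif[OF c' der_in_H br_der_left] mul_diff wedge_add)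
  next
    fix k h hs f assume h: "h \<in> H" and ok: "ok k hs"
    \<comment> \<open>The wedge term of the second axiom has no further argument to pair
      with.\<close>
    have "\<omega> k [rE f h] hs = rW f (\<omega> k [h] hs)"
      using family_apply[OF cd_contr_rE[OF c, of f h], of k "[]" hs] by simp
    moreover have "hsum (\<lambda>x r. \<omega> k [x] (rE f h # r)) hs = hsum (\<lambda>x r. rW f (\<omega> k [x] (h # r))) hs"
    proof (rule hsum_cong)
      fix x r assume "mset hs = add_mset x (mset r)"
      from mset_ok[OF this ok] have k: "Suc (k - 1) = k" by simp
      then show "\<omega> k [x] (rE f h # r) = rW f (\<omega> k [x] (h # r))"
        using family_apply[OF cd_hcontr_rE[OF c h, of f], of "k - 1" "[x]" r] by simp
    qed
    ultimately show "dif \<omega> (Suc k) [] (rE f h # hs) = rW f (dif \<omega> (Suc k) [] (h # hs))"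
      using h ok by (simp add: dif_Nil rE_in_H MW.scale_right_distrib hsum_hom[of "rW f"])
  next
    fix m x assume m: "Suc n = Suc m"
    have "dif (contr x \<omega>) \<in> cd m"
    proof (cases n)
      case 0
      with c' show ?thesis by (simp add: contr_cochains_0 zero_cd)
    next
      case (Suc p)
      then have "dif (contr x \<omega>) \<in> cd (Suc p)"
        using c by (intro less.IH contr_cd) auto
      then show ?thesis using m Suc by simp
    qed
    then show "contr x (dif \<omega>) \<in> cd m"
      using m lie_cd[OF c] by (simp add: contr_dif diff_cd)
  qed
qed

lemma subspace_cd: "module.subspace (family_scale sW) (cd n)"
proof -
  interpret F: vector_space "family_scale sW :: 'k \<Rightarrow> ('e, 'w) family \<Rightarrow> _"
    by (rule vector_space_family_scale)
  show ?thesis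
    by (rule F.subspaceI) (auto intro: zero_cd add_cd scale_cd)
qed

lemma cochain_complex_cd: "cochain_complex (family_scale sW) cd (standard_d br H nab sW)"
proof -
  have "standard_d br H nab sW n \<omega> = dif \<omega>" if "\<omega> \<in> cd n" for \<omega> n
    using that by (intro standard_d_eq_dif cd_cochain)
  then show ?thesis
    unfolding cochain_complex_def linear_on_def
    by (auto simp: vector_space_family_scale subspace_cd add_cd scale_cd dif_add dif_scale dif_cd
        intro: dif_dif cd_cochain)
qed

end

section \<open>Tensor products and symmetric algebras\<close>

lemma lookup_free_scale [simp]: "Poly_Mapping.lookup (free_scale c p) x = c * Poly_Mapping.lookup p x"
  by (simp add: free_scale_def Poly_Mapping.map.rep_eq when_def)

lemma vector_space_free_scale: "vector_space (free_scale :: 'k::field \<Rightarrow> ('x \<Rightarrow>\<^sub>0 'k) \<Rightarrow> _)"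
  by unfold_locales (auto intro!: poly_mapping_eqI simp: lookup_add algebra_simps)

context vector_space
begin

lemma lin_ext_superset:
  assumes "finite A" "Poly_Mapping.keys p \<subseteq> A"
  shows "lin_ext scale f p = (\<Sum>x\<in>A. scale (Poly_Mapping.lookup p x) (f x))"
  unfolding lin_ext_def using assms by (intro sum.mono_neutral_left) (auto simp: in_keys_iff)

lemma lin_ext_add: "lin_ext scale f (p + q) = lin_ext scale f p + lin_ext scale f q"
proof -
  let ?A = "Poly_Mapping.keys p \<union> Poly_Mapping.keys q"
  have "lin_ext scale f (p + q) = (\<Sum>x\<in>?A. scale (Poly_Mapping.lookup (p + q) x) (f x))"
    by (rule lin_ext_superset) (auto simp: Poly_Mapping.keys_add)
  moreover have "lin_ext scale f p = (\<Sum>x\<in>?A. scale (Poly_Mapping.lookup p x) (f x))"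
    by (rule lin_ext_superset) auto
  moreover have "lin_ext scale f q = (\<Sum>x\<in>?A. scale (Poly_Mapping.lookup q x) (f x))"
    by (rule lin_ext_superset) auto
  ultimately show ?thesis by (simp add: lookup_add scale_left_distrib sum.distrib)
qed

lemma lin_ext_scale: "lin_ext scale f (free_scale c p) = scale c (lin_ext scale f p)"
proof -
  have "lin_ext scale f (free_scale c p) =
      (\<Sum>x\<in>Poly_Mapping.keys p. scale (Poly_Mapping.lookup (free_scale c p) x) (f x))"
    by (rule lin_ext_superset) (auto simp: in_keys_iff)
  then show ?thesis by (simp add: lin_ext_def scale_sum_right)
qed

lemma lin_ext_zero [simp]: "lin_ext scale f 0 = 0"
  by (simp add: lin_ext_def)

lemma lin_ext_diff: "lin_ext scale f (p - q) = lin_ext scale f p - lin_ext scale f q"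
  using lin_ext_add[of f "p - q" q] by simp

lemma lin_ext_single [simp]: "lin_ext scale f (Poly_Mapping.single x c) = scale c (f x)"
  by (cases "c = 0") (simp_all add: lin_ext_def)

lemma lin_ext_span:
  assumes "p \<in> module.span free_scale S" and "\<And>r. r \<in> S \<Longrightarrow> lin_ext scale f r = 0"
  shows "lin_ext scale f p = 0"
proof -
  interpret F: vector_space free_scale by (rule vector_space_free_scale)
  show ?thesis
    using assms(1) by (induction rule: F.span_induct_alt) (simp_all add: lin_ext_add lin_ext_scale assms(2))
qed

lemma lin_ext_add_fun: "lin_ext scale (\<lambda>x. f x + g x) p = lin_ext scale f p + lin_ext scale g p"
  by (simp add: lin_ext_def scale_right_distrib sum.distrib)

end

lemma lin_ext_hom:
  assumes "\<And>x y. T (x + y) = T x + T y" "\<And>c x. T (s c x) = s' c (T x)"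
  shows "T (lin_ext s f p) = lin_ext s' (\<lambda>x. T (f x)) p"
proof -
  have "T 0 = 0" using assms(1)[of 0 0] by simp
  then have "T (\<Sum>x\<in>Poly_Mapping.keys p. s (Poly_Mapping.lookup p x) (f x)) =
      (\<Sum>x\<in>Poly_Mapping.keys p. T (s (Poly_Mapping.lookup p x) (f x)))"
    using sum_comp_morphism[of T "\<lambda>x. s (Poly_Mapping.lookup p x) (f x)" "Poly_Mapping.keys p"] assms(1)
    by (simp add: o_def)
  then show ?thesis by (simp add: lin_ext_def assms(2))
qed

lemma bilinear_mapI:
  assumes "vector_space sA" "vector_space sB" "vector_space sC"
    and "\<And>x y z. b (x + y) z = b x z + b y z" "\<And>c x z. b (sA c x) z = sC c (b x z)"
    and "\<And>x y z. b z (x + y) = b z x + b z y" "\<And>c x z. b z (sB c x) = sC c (b z x)"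
  shows "bilinear_map sA sB sC b"
  using assms by (simp add: bilinear_map_def Vector_Spaces.linear_iff)

section \<open>The universal property of the tensor product\<close>

locale tensor_product =
  fixes sA :: "'k::field \<Rightarrow> 'a::ab_group_add \<Rightarrow> 'a" and sB :: "'k \<Rightarrow> 'b::ab_group_add \<Rightarrow> 'b"
    and sT :: "'k \<Rightarrow> 't::ab_group_add \<Rightarrow> 't" and t :: "'a \<Rightarrow> 'b \<Rightarrow> 't"
  assumes tensor_product: "is_tensor_product sA sB sT t"
begin

sublocale A: vector_space sA
  using tensor_product by (simp add: is_tensor_product_def)

sublocale B: vector_space sB
  using tensor_product by (simp add: is_tensor_product_def)

sublocale T: vector_space sT
  using tensor_product by (simp add: is_tensor_product_def)

lemma relation_zero: "r \<in> tensor_relations sA sB \<Longrightarrow> lin_ext sT (case_prod t) r = 0"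
proof -
  interpret F: vector_space "free_scale :: 'k \<Rightarrow> ('a \<times> 'b \<Rightarrow>\<^sub>0 'k) \<Rightarrow> _" by (rule vector_space_free_scale)
  assume "r \<in> tensor_relations sA sB"
  then have "r \<in> F.span (tensor_relations sA sB)" by (rule F.span_base)
  then show ?thesis using tensor_product by (simp add: is_tensor_product_def)
qed

lemma t_add_left: "t (a + a') b = t a b + t a' b"
proof -
  have "lin_ext sT (case_prod t) (Poly_Mapping.single (a + a', b) 1 - Poly_Mapping.single (a, b) 1
      - Poly_Mapping.single (a', b) 1) = 0"
    by (rule relation_zero) (unfold tensor_relations_def, blast)
  then have "t (a + a') b - t a b - t a' b = 0" by (simp add: T.lin_ext_diff)
  then show ?thesis by (simp add: algebra_simps)
qed

lemma t_add_right: "t a (b + b') = t a b + t a b'"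
proof -
  have "lin_ext sT (case_prod t) (Poly_Mapping.single (a, b + b') 1 - Poly_Mapping.single (a, b) 1
      - Poly_Mapping.single (a, b') 1) = 0"
    by (rule relation_zero) (unfold tensor_relations_def, blast)
  then have "t a (b + b') - t a b - t a b' = 0" by (simp add: T.lin_ext_diff)
  then show ?thesis by (simp add: algebra_simps)
qed

lemma t_scale_left: "t (sA c a) b = sT c (t a b)"
proof -
  have "lin_ext sT (case_prod t) (Poly_Mapping.single (sA c a, b) 1 - Poly_Mapping.single (a, b) c) = 0"
    by (rule relation_zero) (unfold tensor_relations_def, blast)
  then show ?thesis by (simp add: T.lin_ext_diff)
qed

lemma t_scale_right: "t a (sB c b) = sT c (t a b)"
proof -
  have "lin_ext sT (case_prod t) (Poly_Mapping.single (a, sB c b) 1 - Poly_Mapping.single (a, b) c) = 0"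
    by (rule relation_zero) (unfold tensor_relations_def, blast)
  then show ?thesis by (simp add: T.lin_ext_diff)
qed

lemma t_zero_left [simp]: "t 0 b = 0"
  using t_add_left[of 0 0 b] by simp

lemma t_zero_right [simp]: "t a 0 = 0"
  using t_add_right[of a 0 0] by simp

lemma t_minus_left: "t (- a) b = - t a b"
  using t_add_left[of a "- a" b] by (simp add: eq_neg_iff_add_eq_0 add.commute)

lemma t_diff_left: "t (a - a') b = t a b - t a' b"
  using t_add_left[of a "- a'" b] by (simp add: t_minus_left)

text \<open>Multiples of pure tensors are pure, the scalar being absorbed by the left factor, and
  zero is pure; so closure under addition is enough.\<close>

lemma tensor_induct [case_names add tensor]:
  assumes add: "\<And>x y. P x \<Longrightarrow> P y \<Longrightarrow> P (x + y)" and tensor: "\<And>a b. P (t a b)"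
  shows "P x"
proof -
  have "surj (lin_ext sT (case_prod t))"
    using tensor_product by (simp add: is_tensor_product_def)
  then obtain p where x: "x = lin_ext sT (case_prod t) p" by auto
  have "P (\<Sum>u\<in>A. sT (Poly_Mapping.lookup p u) (case_prod t u))" if "finite A" for A
    using that
  proof (induction A)
    case empty
    show ?case using tensor[of 0 0] by simp
  next
    case (insert u A)
    obtain a b where "u = (a, b)" by (cases u)
    then have "P (sT (Poly_Mapping.lookup p u) (case_prod t u))"
      using tensor[of "sA (Poly_Mapping.lookup p u) a" b] by (simp add: t_scale_left)
    then show ?case using insert by (simp add: add)
  qed
  then show ?thesis unfolding x lin_ext_def by simp
qed

text \<open>Two representatives differ by an element of the span of the bilinearity relations, and
  the linear extension of a bilinear map kills these.\<close>

lemma induced_eq_lin_ext: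
  assumes b: "bilinear_map sA sB sC b" and x: "lin_ext sT (case_prod t) p = x"
  shows "induced sT t sC b x = lin_ext sC (case_prod b) p"
proof -
  interpret C: vector_space sC using b by (simp add: bilinear_map_def Vector_Spaces.linear_iff)
  define q where "q = (SOME p. lin_ext sT (case_prod t) p = x)"
  have "lin_ext sT (case_prod t) q = x"
    unfolding q_def using x by (rule someI)
  then have "lin_ext sT (case_prod t) (q - p) = 0"
    by (simp add: T.lin_ext_diff x)
  then have "q - p \<in> module.span free_scale (tensor_relations sA sB)"
    using tensor_product by (simp add: is_tensor_product_def)
  moreover have "lin_ext sC (case_prod b) r = 0" if "r \<in> tensor_relations sA sB" for r
    using that b unfolding tensor_relations_def bilinear_map_def Vector_Spaces.linear_iff
    by (auto simp: C.lin_ext_diff)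
  ultimately have "lin_ext sC (case_prod b) (q - p) = 0"
    by (rule C.lin_ext_span)
  then show ?thesis by (simp add: C.lin_ext_diff induced_def q_def)
qed

lemma lin_ext_surj: obtains p where "lin_ext sT (case_prod t) p = x"
  using tensor_product unfolding is_tensor_product_def by (metis surj_def)

lemma induced_t:
  assumes "bilinear_map sA sB sC b"
  shows "induced sT t sC b (t x y) = b x y"
proof -
  interpret C: vector_space sC using assms by (simp add: bilinear_map_def Vector_Spaces.linear_iff)
  show ?thesis
    using induced_eq_lin_ext[OF assms, of "Poly_Mapping.single (x, y) 1" "t x y"] by simp
qed

lemma induced_add:
  assumes "bilinear_map sA sB sC b"
  shows "induced sT t sC b (x + y) = induced sT t sC b x + induced sT t sC b y"
proof -
  interpret C: vector_space sC using assms by (simp add: bilinear_map_def Vector_Spaces.linear_iff)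
  obtain p where p: "lin_ext sT (case_prod t) p = x" by (rule lin_ext_surj)
  obtain q where q: "lin_ext sT (case_prod t) q = y" by (rule lin_ext_surj)
  have "lin_ext sT (case_prod t) (p + q) = x + y" by (simp add: T.lin_ext_add p q)
  then show ?thesis
    by (simp add: induced_eq_lin_ext[OF assms] induced_eq_lin_ext[OF assms p] induced_eq_lin_ext[OF assms q] C.lin_ext_add)
qed

lemma induced_scale:
  assumes "bilinear_map sA sB sC b"
  shows "induced sT t sC b (sT c x) = sC c (induced sT t sC b x)"
proof -
  interpret C: vector_space sC using assms by (simp add: bilinear_map_def Vector_Spaces.linear_iff)
  obtain p where p: "lin_ext sT (case_prod t) p = x" by (rule lin_ext_surj)
  have "lin_ext sT (case_prod t) (free_scale c p) = sT c x" by (simp add: T.lin_ext_scale p)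
  then show ?thesis
    by (simp add: induced_eq_lin_ext[OF assms] induced_eq_lin_ext[OF assms p] C.lin_ext_scale)
qed

end

text \<open>\<open>induced\<close> chooses its representative from the tensor alone, so all maps,
  bilinear or not, are evaluated on the same one. Additivity in the map can therefore be used before
  bilinearity is established.\<close>

lemma induced_add_fun:
  assumes "vector_space sC"
  shows "induced sT t sC (\<lambda>x y. b x y + b' x y) z = induced sT t sC b z + induced sT t sC b' z"
proof -
  interpret C: vector_space sC by (rule assms)
  show ?thesis
    unfolding induced_def by (simp add: C.lin_ext_add_fun[symmetric] case_prod_unfold)
qed

lemma induced_hom:
  assumes "\<And>x y. T (x + y) = T x + T y" "\<And>c x. T (sC c x) = sD c (T x)"
  shows "T (induced sT t sC b z) = induced sT t sD (\<lambda>x y. T (b x y)) z"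
  unfolding induced_def
  using lin_ext_hom[of T sC sD "case_prod b", OF assms] by (simp add: case_prod_unfold)

text \<open>The pairing, the bracket and the action are all nested extensions of this form. For
  fixed z the inner extension is bilinear in (a, b), since it is so on pure tensors and additive in
  z.\<close>

lemma
  assumes "tensor_product sA sB sT t" and "tensor_product sA' sB' sT' t'"
    and right: "\<And>a b. bilinear_map sA' sB' sC (F a b)"
    and left: "\<And>a' b'. bilinear_map sA sB sC (\<lambda>a b. F a b a' b')"
    and I: "\<And>x y. I x y = induced sT t sC (\<lambda>a b. induced sT' t' sC (F a b) y) x"
  shows induced2_t: "I (t a b) (t' a' b') = F a b a' b'"
    and induced2_add_left: "I (x + y) z = I x z + I y z"
    and induced2_scale_left: "I (sT c x) z = sC c (I x z)"
    and induced2_add_right: "I x (z + z') = I x z + I x z'"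
proof -
  interpret T: tensor_product sA sB sT t by fact
  interpret T': tensor_product sA' sB' sT' t' by fact
  interpret C: vector_space sC using left by (simp add: bilinear_map_def Vector_Spaces.linear_iff)
  define G where "G a b = induced sT' t' sC (F a b)" for a b
  have G_t: "G a b (t' a' b') = F a b a' b'" for a b a' b'
    unfolding G_def by (rule T'.induced_t[OF right])
  have G_add: "G a b (z + z') = G a b z + G a b z'" for a b z z'
    unfolding G_def by (rule T'.induced_add[OF right])
  note lin = left[unfolded bilinear_map_def Vector_Spaces.linear_iff]
  have bil: "bilinear_map sA sB sC (\<lambda>a b. G a b z)" for z
  proof (rule bilinear_mapI)
    fix a b c d
    show "G (a + b) d z = G a d z + G b d z"
      by (induction z rule: T'.tensor_induct) (use lin in \<open>simp_all add: G_add G_t\<close>)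
    show "G (sA c a) d z = sC c (G a d z)"
      by (induction z rule: T'.tensor_induct) (use lin in \<open>simp_all add: G_add G_t C.scale_right_distrib\<close>)
  next
    fix a b c d
    show "G d (a + b) z = G d a z + G d b z"
      by (induction z rule: T'.tensor_induct) (use lin in \<open>simp_all add: G_add G_t\<close>)
    show "G d (sB c a) z = sC c (G d a z)"
      by (induction z rule: T'.tensor_induct) (use lin in \<open>simp_all add: G_add G_t C.scale_right_distrib\<close>)
  qed (rule T.A.vector_space_axioms T.B.vector_space_axioms C.vector_space_axioms)+
  have I': "I x y = induced sT t sC (\<lambda>a b. G a b y) x" for x y
    by (simp add: I G_def)
  have I_t: "I (t a b) z = G a b z" for a b z
    unfolding I' by (rule T.induced_t[OF bil])
  have I_add: "I (x + y) z = I x z + I y z" for x y z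
    unfolding I' by (rule T.induced_add[OF bil])
  then show "I (x + y) z = I x z + I y z" .
  show "I (sT c x) z = sC c (I x z)"
    unfolding I' by (rule T.induced_scale[OF bil])
  show "I (t a b) (t' a' b') = F a b a' b'"
    by (simp add: I_t G_t)
  show "I x (z + z') = I x z + I x z'"
    by (induction x rule: T.tensor_induct) (simp_all add: I_add I_t G_add)
qed

locale algebra_tensor = tensor_product sA sB sT t
  for sA :: "'k::field \<Rightarrow> 'a::comm_ring_1 \<Rightarrow> 'a" and sB :: "'k \<Rightarrow> 'b::ab_group_add \<Rightarrow> 'b"
    and sT :: "'k \<Rightarrow> 't::ab_group_add \<Rightarrow> 't" and t :: "'a \<Rightarrow> 'b \<Rightarrow> 't" +
  assumes algebra: "k_algebra sA"
begin

lemma sA_mult_left: "sA c x * y = sA c (x * y)"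
  and sA_mult_right: "y * sA c x = sA c (y * x)"
  using algebra by (simp_all add: k_algebra_def mult.commute[of y])

lemma bilinear_tensor_action: "bilinear_map sA sB sT (\<lambda>g b. t (f * g) b)"
  by (rule bilinear_mapI)
    (simp_all add: A.vector_space_axioms B.vector_space_axioms T.vector_space_axioms distrib_left
      t_add_left t_add_right t_scale_left t_scale_right sA_mult_right)

lemma tensor_action_t [simp]: "tensor_action sT t f (t g b) = t (f * g) b"
  unfolding tensor_action_def by (rule induced_t[OF bilinear_tensor_action])

lemma tensor_action_add_right: "tensor_action sT t f (x + y) = tensor_action sT t f x + tensor_action sT t f y"
  unfolding tensor_action_def by (rule induced_add[OF bilinear_tensor_action])

lemma tensor_action_add_left: "tensor_action sT t (f + g) x = tensor_action sT t f x + tensor_action sT t g x"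
  by (induction x rule: tensor_induct)
    (simp_all add: tensor_action_add_right distrib_right t_add_left)

lemma tensor_action_one: "tensor_action sT t 1 x = x"
  by (induction x rule: tensor_induct) (simp_all add: tensor_action_add_right)

lemma tensor_action_mult: "tensor_action sT t f (tensor_action sT t g x) = tensor_action sT t (f * g) x"
  by (induction x rule: tensor_induct) (simp_all add: tensor_action_add_right mult.assoc)

lemma module_tensor_action: "module (tensor_action sT t)"
  by unfold_locales
    (simp_all add: tensor_action_add_right tensor_action_add_left tensor_action_one tensor_action_mult)

lemma scale_eq_tensor_action: "sT c x = tensor_action sT t (sA c 1) x"
  by (induction x rule: tensor_induct)
    (simp_all add: tensor_action_add_right T.scale_right_distrib sA_mult_left t_scale_left)

end

section \<open>Maps out of the symmetric algebra\<close>

locale symmetric_algebra = vector_space sL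
  for sL :: "'k::field \<Rightarrow> 'l::ab_group_add \<Rightarrow> 'l" +
  fixes Z :: "'l set" and sR :: "'k \<Rightarrow> 'r::comm_ring_1 \<Rightarrow> 'r" and \<iota> :: "'l \<Rightarrow> 'r"
  assumes symmetric_algebra: "is_symmetric_algebra sL Z sR \<iota>"
begin

sublocale R: vector_space sR
  using symmetric_algebra by (simp add: is_symmetric_algebra_def k_algebra_def)

lemma sR_mult_left: "sR c x * y = sR c (x * y)"
  using symmetric_algebra by (simp add: is_symmetric_algebra_def k_algebra_def)

abbreviation mono_val :: "'l multiset \<Rightarrow> 'r" where
  "mono_val M \<equiv> \<Prod>z\<in>#M. \<iota> z"

text \<open>The defining equivalence of the symmetric algebra speaks only about polynomials in
  elements of Z; that Z is a subspace keeps the relations among these.\<close>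

lemma sym_relations_free: "sym_relations sL Z \<subseteq> free_comm_algebra Z" if "subspace Z"
proof -
  have *: "p - q \<in> free_comm_algebra Z" if "p \<in> free_comm_algebra Z" "q \<in> free_comm_algebra Z" for p q
    using that keys_diff[of p q] unfolding free_comm_algebra_def by fast
  have "Poly_Mapping.single M c \<in> free_comm_algebra Z" if "set_mset M \<subseteq> Z" for M and c :: 'k
    using that by (simp add: free_comm_algebra_def)
  then show ?thesis
    unfolding sym_relations_def using that by (auto intro!: * simp: subspace_add subspace_scale)
qed

lemma relation_zero:
  assumes "subspace Z" "r \<in> sym_relations sL Z"
  shows "lin_ext sR mono_val r = 0"
proof -
  interpret F: vector_space "free_scale :: 'k \<Rightarrow> ('l multiset \<Rightarrow>\<^sub>0 'k) \<Rightarrow> _" by (rule vector_space_free_scale)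
  have "r \<in> F.span (sym_relations sL Z)" using assms(2) by (rule F.span_base)
  moreover have "r \<in> free_comm_algebra Z" using sym_relations_free assms by blast
  ultimately show ?thesis using symmetric_algebra by (simp add: is_symmetric_algebra_def)
qed

lemma \<iota>_add: 
  assumes "subspace Z" "z \<in> Z" "z' \<in> Z"
  shows "\<iota> (z + z') = \<iota> z + \<iota> z'"
proof -
  have "lin_ext sR mono_val (Poly_Mapping.single (add_mset (z + z') {#}) 1 - Poly_Mapping.single (add_mset z {#}) 1
        - Poly_Mapping.single (add_mset z' {#}) 1) = 0"
    by (rule relation_zero[OF assms(1)], unfold sym_relations_def, rule UnI1, rule CollectI, intro exI conjI, rule refl)
      (use assms(2,3) in auto)
  then have "\<iota> (z + z') - \<iota> z - \<iota> z' = 0" by (simp add: R.lin_ext_diff)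
  then show ?thesis by (simp add: algebra_simps)
qed

lemma \<iota>_scale:
  assumes "subspace Z" "z \<in> Z"
  shows "\<iota> (sL c z) = sR c (\<iota> z)"
proof -
  have "lin_ext sR mono_val (Poly_Mapping.single (add_mset (sL c z) {#}) 1 - Poly_Mapping.single (add_mset z {#}) c) = 0"
    by (rule relation_zero[OF assms(1)], unfold sym_relations_def, rule UnI2, rule CollectI, intro exI conjI, rule refl)
      (use assms(2) in auto)
  then show ?thesis by (simp add: R.lin_ext_diff)
qed

lemma representative:
  obtains p where "p \<in> free_comm_algebra Z" "lin_ext sR mono_val p = f"
  using symmetric_algebra unfolding is_symmetric_algebra_def by (metis UNIV_I imageE)

lemma mono_val_induct [case_names add mono]:
  assumes add: "\<And>f g. P f \<Longrightarrow> P g \<Longrightarrow> P (f + g)"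
    and mono: "\<And>c M. set_mset M \<subseteq> Z \<Longrightarrow> P (sR c (mono_val M))"
  shows "P f"
proof -
  obtain p where p: "p \<in> free_comm_algebra Z" "lin_ext sR mono_val p = f" by (rule representative)
  have "P (\<Sum>M\<in>A. sR (Poly_Mapping.lookup p M) (mono_val M))" if "finite A" "A \<subseteq> Poly_Mapping.keys p" for A
    using that
  proof (induction A)
    case empty
    show ?case using mono[of "{#}" 0] by simp
  next
    case (insert M A)
    then show ?case using p(1) by (auto intro!: add mono simp: free_comm_algebra_def)
  qed
  then show ?thesis unfolding p(2)[symmetric] lin_ext_def by simp
qed

text \<open>Each monomial is built by multiplying generators onto a scalar, so a property that
  respects sums needs to be propagated along one generator at a time.\<close>

lemma symmetric_algebra_induct [case_names add scalar mult]:
  assumes add: "\<And>f g. P f \<Longrightarrow> P g \<Longrightarrow> P (f + g)" and scalar: "\<And>c. P (sR c 1)"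
    and mult: "\<And>z f. z \<in> Z \<Longrightarrow> P f \<Longrightarrow> P (\<iota> z * f)"
  shows "P f"
proof (rule mono_val_induct[of P])
  fix c M assume "set_mset M \<subseteq> Z"
  then show "P (sR c (mono_val M))"
  proof (induction M)
    case (add z M)
    then have "P (\<iota> z * sR c (mono_val M))" by (intro mult) auto
    then show ?case by (simp add: sR_mult_left mult.commute[of "\<iota> z"])
  qed (simp add: scalar)
qed (rule add)

lemma free_add: "p \<in> free_comm_algebra Z \<Longrightarrow> q \<in> free_comm_algebra Z \<Longrightarrow> p + q \<in> free_comm_algebra Z"
  using Poly_Mapping.keys_add[of p q] unfolding free_comm_algebra_def by fast

lemma free_diff: "p \<in> free_comm_algebra Z \<Longrightarrow> q \<in> free_comm_algebra Z \<Longrightarrow> p - q \<in> free_comm_algebra Z"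
  for p q :: "'l multiset \<Rightarrow>\<^sub>0 'k"
  using keys_diff[of p q] unfolding free_comm_algebra_def by fast

lemma free_scale_free: "p \<in> free_comm_algebra Z \<Longrightarrow> free_scale c p \<in> free_comm_algebra Z"
  by (auto simp: free_comm_algebra_def in_keys_iff)

text \<open>Only meaningful if the linear extension of \<open>G\<close> kills \<open>sym_relations sL Z\<close>.\<close>

definition sym_ext :: "('k \<Rightarrow> 'c::ab_group_add \<Rightarrow> 'c) \<Rightarrow> ('l multiset \<Rightarrow> 'c) \<Rightarrow> 'r \<Rightarrow> 'c" where
  "sym_ext sC G f = lin_ext sC G (SOME p. p \<in> free_comm_algebra Z \<and> lin_ext sR mono_val p = f)"

lemma sym_ext_eq:
  assumes "vector_space sC" and G: "\<And>r. r \<in> sym_relations sL Z \<Longrightarrow> lin_ext sC G r = 0"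
    and p: "p \<in> free_comm_algebra Z" "lin_ext sR mono_val p = f"
  shows "sym_ext sC G f = lin_ext sC G p"
proof -
  interpret C: vector_space sC by (rule assms)
  define q where "q = (SOME p. p \<in> free_comm_algebra Z \<and> lin_ext sR mono_val p = f)"
  have q: "q \<in> free_comm_algebra Z" "lin_ext sR mono_val q = f"
    using someI[of "\<lambda>p. p \<in> free_comm_algebra Z \<and> lin_ext sR mono_val p = f" p] p
    unfolding q_def by simp_all
  have "lin_ext sR mono_val (q - p) = 0" by (simp add: R.lin_ext_diff p q)
  then have "q - p \<in> module.span free_scale (sym_relations sL Z)"
    using symmetric_algebra free_diff[OF q(1) p(1)] by (simp add: is_symmetric_algebra_def)
  then have "lin_ext sC G (q - p) = 0" using G by (rule C.lin_ext_span)
  then show ?thesis by (simp add: C.lin_ext_diff sym_ext_def q_def)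
qed

lemma sym_ext_linear:
  assumes "vector_space sC" and G: "\<And>r. r \<in> sym_relations sL Z \<Longrightarrow> lin_ext sC G r = 0"
  shows sym_ext_add: "sym_ext sC G (f + g) = sym_ext sC G f + sym_ext sC G g"
    and sym_ext_scale: "sym_ext sC G (sR c f) = sC c (sym_ext sC G f)"
    and sym_ext_mono: "set_mset M \<subseteq> Z \<Longrightarrow> sym_ext sC G (mono_val M) = G M"
proof -
  interpret C: vector_space sC by (rule assms)
  obtain p where p: "p \<in> free_comm_algebra Z" "lin_ext sR mono_val p = f" by (rule representative)
  obtain q where q: "q \<in> free_comm_algebra Z" "lin_ext sR mono_val q = g" by (rule representative)
  have eq: "sym_ext sC G f = lin_ext sC G p" if "p \<in> free_comm_algebra Z" "lin_ext sR mono_val p = f" for p f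
    using assms that by (rule sym_ext_eq)
  show "sym_ext sC G (f + g) = sym_ext sC G f + sym_ext sC G g"
    using eq[OF free_add[OF p(1) q(1)], of "f + g"] eq[OF p] eq[OF q] p(2) q(2)
    by (simp add: R.lin_ext_add C.lin_ext_add)
  show "sym_ext sC G (sR c f) = sC c (sym_ext sC G f)"
    using eq[OF free_scale_free[OF p(1)], of c "sR c f"] eq[OF p] p(2)
    by (simp add: R.lin_ext_scale C.lin_ext_scale)
  show "sym_ext sC G (mono_val M) = G M" if "set_mset M \<subseteq> Z"
    using eq[of "Poly_Mapping.single M 1" "mono_val M"] that by (simp add: free_comm_algebra_def)
qed

end

section \<open>The crossed product\<close>

lemma sum_mset_hom:
  assumes "T 0 = 0" "\<And>x y. T (x + y) = T x + T y"
  shows "T (\<Sum>z\<in>#M. g z) = (\<Sum>z\<in>#M. T (g z))"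
  by (induction M) (simp_all add: assms)

locale crossed_product = leibniz_algebra sL br
  for sL :: "'k::field \<Rightarrow> 'l::ab_group_add \<Rightarrow> 'l" and br +
  fixes sR :: "'k \<Rightarrow> 'r::comm_ring_1 \<Rightarrow> 'r" and \<iota> :: "'l \<Rightarrow> 'r"
    and sM :: "'k \<Rightarrow> 'm::ab_group_add \<Rightarrow> 'm" and t :: "'r \<Rightarrow> 'l \<Rightarrow> 'm"
  assumes sym_alg: "is_symmetric_algebra sL (left_center br) sR \<iota>"
    and tensor: "is_tensor_product sR sL sM t"
begin

sublocale S: symmetric_algebra sL "left_center br" sR \<iota>
  by unfold_locales (rule sym_alg)

sublocale M: algebra_tensor sR sL sM t
  by unfold_locales (use tensor sym_alg in \<open>simp_all add: is_symmetric_algebra_def\<close>)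

abbreviation rM :: "'r \<Rightarrow> 'm \<Rightarrow> 'm" where "rM \<equiv> tensor_action sM t"
abbreviation form :: "'m \<Rightarrow> 'm \<Rightarrow> 'r" where "form \<equiv> crossed_form br sR \<iota> sM t"
abbreviation der :: "'r \<Rightarrow> 'm" where "der \<equiv> crossed_der br sR \<iota> sM t"
abbreviation cbr :: "'m \<Rightarrow> 'm \<Rightarrow> 'm" where "cbr \<equiv> crossed_bracket br sR \<iota> sM t"
abbreviation Z :: "'l set" where "Z \<equiv> left_center br"
abbreviation mono_val :: "'l multiset \<Rightarrow> 'r" where "mono_val M \<equiv> \<Prod>z\<in>#M. \<iota> z"

sublocale RM: module rM by (rule M.module_tensor_action)

lemmas \<iota>_add = S.\<iota>_add[OF subspace_left_center]
lemmas \<iota>_scale = S.\<iota>_scale[OF subspace_left_center]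

lemma \<iota>_zero [simp]: "\<iota> 0 = 0"
  using \<iota>_scale[OF subspace_0[OF subspace_left_center], of 0] by simp

lemma rM_scale_left: "rM (sR c f) x = sM c (rM f x)"
  by (simp add: M.scale_eq_tensor_action M.sA_mult_left)

lemma rM_scale_right: "rM f (sM c x) = sM c (rM f x)"
  by (simp add: M.scale_eq_tensor_action mult.commute)

section \<open>The derivation\<close>

definition der_mono :: "'l multiset \<Rightarrow> 'm" where
  "der_mono M = (\<Sum>z\<in>#M. rM (\<Prod>w\<in>#M - {#z#}. \<iota> w) (t 1 z))"

lemma der_mono_empty [simp]: "der_mono {#} = 0"
  by (simp add: der_mono_def)

text \<open>Removing a from the enlarged multiset gives the first term; removing any other element
  leaves the factor \<open>\<iota> a\<close>.\<close>

lemma der_mono_add_mset: "der_mono (add_mset a M) = t (mono_val M) a + rM (\<iota> a) (der_mono M)"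
proof -
  have "(\<Sum>z\<in>#M. rM (mono_val (add_mset a M - {#z#})) (t 1 z)) =
      (\<Sum>z\<in>#M. rM (\<iota> a) (rM (mono_val (M - {#z#})) (t 1 z)))"
    by (rule arg_cong[of _ _ sum_mset], rule image_mset_cong) simp
  then show ?thesis
    unfolding der_mono_def
    by (subst sum_mset_hom[of "rM (\<iota> a)"]) (simp_all add: M.tensor_action_add_right)
qed

lemma der_eq: "der f = S.sym_ext sM der_mono f"
  by (simp add: crossed_der_def S.sym_ext_def der_mono_def[abs_def])

text \<open>This makes \<partial> well defined: by \<open>der_mono_add_mset\<close> the value on a
  monomial is linear in the element added, which is what the relations of the symmetric algebra
  require.\<close>

lemma der_mono_relations:
  assumes "r \<in> sym_relations sL Z"
  shows "lin_ext sM der_mono r = 0"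
proof -
  have 1: "der_mono (add_mset (z + z') M) - der_mono (add_mset z M) - der_mono (add_mset z' M) = 0"
    if "z \<in> Z" "z' \<in> Z" for z z' M
    using that by (simp add: der_mono_add_mset \<iota>_add RM.scale_left_distrib M.t_add_right)
  have 2: "der_mono (add_mset (sL c z) M) = sM c (der_mono (add_mset z M))" if "z \<in> Z" for c z M
    using that by (simp add: der_mono_add_mset \<iota>_scale rM_scale_left M.t_scale_right M.T.scale_right_distrib)
  show ?thesis
    using assms 1 2 unfolding sym_relations_def by (auto simp: M.T.lin_ext_diff)
qed

lemmas sym_ext_der_mono = S.sym_ext_linear[OF M.T.vector_space_axioms der_mono_relations, folded der_eq]

lemma der_add: "der (f + g) = der f + der g"
  and der_scale: "der (sR c f) = sM c (der f)"
  and der_mono_val: "set_mset M \<subseteq> Z \<Longrightarrow> der (mono_val M) = der_mono M"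
  by (simp_all add: sym_ext_der_mono)

lemma der_one [simp]: "der 1 = 0"
  using der_mono_val[of "{#}"] by simp

lemma der_scalar [simp]: "der (sR c 1) = 0"
  by (simp add: der_scale)

lemma der_\<iota>: "z \<in> Z \<Longrightarrow> der (\<iota> z) = t 1 z"
  using der_mono_val[of "{#z#}"] by (simp add: der_mono_add_mset)

lemma der_\<iota>_mult:
  assumes "z \<in> Z"
  shows "der (\<iota> z * f) = t f z + rM (\<iota> z) (der f)"
proof (induction f rule: S.mono_val_induct)
  case (mono c M)
  have "der (mono_val (add_mset z M)) = t (mono_val M) z + rM (\<iota> z) (der (mono_val M))"
    using mono assms by (subst (1 2) der_mono_val) (simp_all add: der_mono_add_mset)
  then show ?case
    by (simp add: M.sA_mult_right der_scale M.t_scale_left rM_scale_right M.T.scale_right_distrib)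
qed (simp add: distrib_left der_add M.t_add_left RM.scale_right_distrib)

lemma der_mult: "der (f * g) = rM f (der g) + rM g (der f)"
proof (induction f rule: S.symmetric_algebra_induct)
  case (scalar c)
  have "der (sR c 1 * g) = sM c (der g)" by (simp add: S.sR_mult_left der_scale)
  then show ?case using M.scale_eq_tensor_action[of c "der g"] by simp
next
  case (mult z f)
  have "der (\<iota> z * f * g) = t (f * g) z + rM (\<iota> z) (der (f * g))"
    using mult(1) by (simp add: mult.assoc der_\<iota>_mult)
  then show ?case
    unfolding der_\<iota>_mult[OF mult(1), of f] mult(2) by (simp add: RM.scale_right_distrib ac_simps)
qed (simp add: distrib_right der_add RM.scale_left_distrib RM.scale_right_distrib)

section \<open>Submodules generated by subspaces of L\<close>

lemma t_in_extended_ideal: "h \<in> U \<Longrightarrow> t f h \<in> extended_ideal sM t U"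
  unfolding extended_ideal_def by (rule M.T.span_base) auto

lemma subspace_extended_ideal: "M.T.subspace (extended_ideal sM t U)"
  unfolding extended_ideal_def by (rule M.T.subspace_span)

lemmas extended_ideal_zero = M.T.subspace_0[OF subspace_extended_ideal]
lemmas extended_ideal_add = M.T.subspace_add[OF subspace_extended_ideal]

lemma extended_ideal_induct [consumes 1, case_names zero add gen]:
  assumes "x \<in> extended_ideal sM t U" "P 0"
    and add: "\<And>x y. x \<in> extended_ideal sM t U \<Longrightarrow> y \<in> extended_ideal sM t U \<Longrightarrow> P x \<Longrightarrow> P y \<Longrightarrow> P (x + y)"
    and gen: "\<And>f h. h \<in> U \<Longrightarrow> P (t f h)"
  shows "P x"
proof -
  have "x \<in> extended_ideal sM t U \<and> P x"
    using assms(1) unfolding extended_ideal_def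
  proof (induction rule: M.T.span_induct_alt)
    case base
    show ?case using assms(2) by (simp add: M.T.span_zero)
  next
    case (step c x y)
    then obtain f h where x: "x = t f h" "h \<in> U" by auto
    then have "P (sM c x)" "sM c x \<in> extended_ideal sM t U"
      using gen[of h "sR c f"] t_in_extended_ideal[of h U "sR c f"] by (simp_all add: M.t_scale_left)
    then show ?case using step add extended_ideal_add unfolding extended_ideal_def by blast
  qed
  then show ?thesis ..
qed

lemma extended_ideal_mono: "U \<subseteq> U' \<Longrightarrow> extended_ideal sM t U \<subseteq> extended_ideal sM t U'"
  unfolding extended_ideal_def by (rule M.T.span_mono) auto

lemma rM_extended_ideal: "x \<in> extended_ideal sM t U \<Longrightarrow> rM f x \<in> extended_ideal sM t U"
  by (induction rule: extended_ideal_induct)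
    (simp_all add: extended_ideal_zero extended_ideal_add
      RM.scale_right_distrib t_in_extended_ideal)

text \<open>By the product rule \<partial> yields only elements of Z with coefficients in R. Hence
  \<partial>R lies in the extension of any H above Z, and it pairs to zero with f z for z \<in> Z,
  because (z, z') = 0 in Z.\<close>

lemma der_in_extended_center: "der f \<in> extended_ideal sM t Z"
proof (induction f rule: S.symmetric_algebra_induct)
  case (mult z f)
  then show ?case
    by (simp add: der_\<iota>_mult extended_ideal_add t_in_extended_ideal rM_extended_ideal)
qed (simp_all add: der_add extended_ideal_zero extended_ideal_add)

section \<open>The pairing\<close>

lemma sym_bracket_add_left: "sym_bracket br (x + y) z = sym_bracket br x z + sym_bracket br y z"
  and sym_bracket_add_right: "sym_bracket br z (x + y) = sym_bracket br z x + sym_bracket br z y"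
  and sym_bracket_scale_left: "sym_bracket br (sL c x) z = sL c (sym_bracket br x z)"
  and sym_bracket_scale_right: "sym_bracket br z (sL c x) = sL c (sym_bracket br z x)"
  by (simp_all add: sym_bracket_def br_add_left br_add_right br_scale_left br_scale_right scale_right_distrib)

lemmas \<iota>_sym_simps = sym_bracket_add_left sym_bracket_add_right sym_bracket_scale_left sym_bracket_scale_right
  \<iota>_add \<iota>_scale sym_bracket_in_left_center

lemmas spaces = vector_space_axioms S.R.vector_space_axioms M.T.vector_space_axioms

lemma bilinear_form_inner: "bilinear_map sR sL sR (\<lambda>f\<^sub>2 e\<^sub>2. f\<^sub>1 * f\<^sub>2 * \<iota> (sym_bracket br e\<^sub>1 e\<^sub>2))"
  by (rule bilinear_mapI) (simp_all add: spaces \<iota>_sym_simps algebra_simps M.sA_mult_left M.sA_mult_right)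

lemma bilinear_form_outer: "bilinear_map sR sL sR (\<lambda>f\<^sub>1 e\<^sub>1. f\<^sub>1 * f\<^sub>2 * \<iota> (sym_bracket br e\<^sub>1 e\<^sub>2))"
  by (rule bilinear_mapI) (simp_all add: spaces \<iota>_sym_simps algebra_simps M.sA_mult_left M.sA_mult_right)

lemmas form_induced = M.tensor_product_axioms M.tensor_product_axioms bilinear_form_inner bilinear_form_outer
  crossed_form_def[of br sR \<iota> sM t]
lemmas form_t = induced2_t[OF form_induced]
lemmas form_add_left = induced2_add_left[OF form_induced]
lemmas form_add_right = induced2_add_right[OF form_induced]

lemma form_commute: "form x y = form y x"
proof (induction x rule: M.tensor_induct)
  case (tensor a b)
  show ?case
    by (induction y rule: M.tensor_induct)
      (simp_all add: form_add_right form_add_left form_t sym_bracket_commute mult.commute)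
qed (simp add: form_add_left form_add_right)

lemma form_rM_left: "form (rM f x) y = f * form x y"
proof (induction x rule: M.tensor_induct)
  case (tensor a b)
  show ?case
    by (induction y rule: M.tensor_induct) (simp_all add: form_add_right form_t algebra_simps)
qed (simp add: RM.scale_right_distrib form_add_left distrib_left)

lemma form_rM_right: "form y (rM f x) = f * form y x"
  unfolding form_commute[of y "rM f x"] form_commute[of y x] by (rule form_rM_left)

lemma form_scale_left: "form (sM c x) y = sR c (form x y)"
  and form_scale_right: "form y (sM c x) = sR c (form y x)"
  by (simp_all add: M.scale_eq_tensor_action form_rM_left form_rM_right M.sA_mult_left)

lemma form_zero_left [simp]: "form 0 y = 0"
  and form_zero_right [simp]: "form y 0 = 0"
  using form_rM_left[of 0 0 y] form_rM_right[of y 0 0] by simp_all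

lemma form_diff_left: "form (x - y) z = form x z - form y z"
  using form_add_left[of "x - y" y z] by simp

lemma form_diff_right: "form z (x - y) = form z x - form z y"
  using form_add_right[of z "x - y" y] by simp

lemma t_eq_rM: "t f e = rM f (t 1 e)"
  by simp

lemma form_t_left: "form (t f e) y = f * form (t 1 e) y"
  by (subst t_eq_rM) (rule form_rM_left)

lemma form_extended_zero:
  assumes "x \<in> extended_ideal sM t U" "y \<in> extended_ideal sM t U"
    and "\<And>h h'. h \<in> U \<Longrightarrow> h' \<in> U \<Longrightarrow> sym_bracket br h h' = 0"
  shows "form x y = 0"
  using assms(1)
proof (induction rule: extended_ideal_induct)
  case (gen f h)
  show ?case using assms(2)
    by (induction rule: extended_ideal_induct) (simp_all add: form_add_right form_t assms(3) gen)
qed (simp_all add: form_add_left)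

lemma sym_bracket_center: "z \<in> Z \<Longrightarrow> z' \<in> Z \<Longrightarrow> sym_bracket br z z' = 0"
  by (simp add: sym_bracket_def left_center_def)

lemma form_der_center: "z \<in> Z \<Longrightarrow> form (t f z) (der g) = 0"
  by (rule form_extended_zero[OF t_in_extended_ideal der_in_extended_center sym_bracket_center])

section \<open>The bracket and the axioms of a Courant-Dorfman algebra\<close>

abbreviation bracket_gen :: "'r \<Rightarrow> 'l \<Rightarrow> 'r \<Rightarrow> 'l \<Rightarrow> 'm" where
  "bracket_gen f\<^sub>1 e\<^sub>1 f\<^sub>2 e\<^sub>2 \<equiv> t (f\<^sub>1 * f\<^sub>2) (br e\<^sub>1 e\<^sub>2) + rM (form (t 1 e\<^sub>1) (t 1 e\<^sub>2) * f\<^sub>2) (der f\<^sub>1)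
    + t (form (t 1 e\<^sub>1) (der f\<^sub>2) * f\<^sub>1) e\<^sub>2 - t (form (t 1 e\<^sub>2) (der f\<^sub>1) * f\<^sub>2) e\<^sub>1"

lemmas t_simps = M.t_add_left M.t_add_right M.t_scale_left M.t_scale_right M.t_diff_left M.t_minus_left

lemma bilinear_bracket_gen_right: "bilinear_map sR sL sM (bracket_gen f\<^sub>1 e\<^sub>1)"
  by (rule bilinear_mapI)
    (simp_all add: spaces t_simps br_add_right br_scale_right der_add der_scale form_add_left form_add_right form_scale_left
      form_scale_right rM_scale_left M.sA_mult_left M.sA_mult_right RM.scale_left_distrib distrib_left distrib_right
      M.T.scale_right_distrib M.T.scale_right_diff_distrib)

lemma bilinear_bracket_gen_left: "bilinear_map sR sL sM (\<lambda>f\<^sub>1 e\<^sub>1. bracket_gen f\<^sub>1 e\<^sub>1 f\<^sub>2 e\<^sub>2)"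
  by (rule bilinear_mapI)
    (simp_all add: spaces t_simps br_add_left br_scale_left der_add der_scale form_add_left form_add_right form_scale_left
      form_scale_right rM_scale_left rM_scale_right M.sA_mult_left M.sA_mult_right RM.scale_left_distrib RM.scale_right_distrib
      distrib_left distrib_right M.T.scale_right_distrib M.T.scale_right_diff_distrib)

lemmas cbr_induced = M.tensor_product_axioms M.tensor_product_axioms bilinear_bracket_gen_right bilinear_bracket_gen_left
  crossed_bracket_def[of br sR \<iota> sM t]
lemmas cbr_t = induced2_t[OF cbr_induced]
lemmas cbr_add_left = induced2_add_left[OF cbr_induced]
lemmas cbr_add_right = induced2_add_right[OF cbr_induced]
lemmas cbr_scale_left = induced2_scale_left[OF cbr_induced]

lemma cbr_zero_left [simp]: "cbr 0 y = 0"
  using cbr_scale_left[of 0 0 y] by simp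

lemma cbr_rM_right: "cbr x (rM f y) = rM f (cbr x y) + rM (form x (der f)) y"
proof (induction x rule: M.tensor_induct)
  case (tensor f1 e1)
  show ?case
  proof (induction y rule: M.tensor_induct)
    case (tensor f2 e2)
    show ?case
      unfolding form_t_left[of f1 e1 "der f"]
      by (simp add: cbr_t der_mult form_add_right form_rM_right t_simps RM.scale_right_distrib
          RM.scale_right_diff_distrib algebra_simps)
  qed (simp add: RM.scale_right_distrib cbr_add_right)
qed (simp add: cbr_add_left form_add_left RM.scale_right_distrib RM.scale_left_distrib)

lemma cbr_sym: "cbr x y + cbr y x = der (form x y)"
proof (induction x rule: M.tensor_induct)
  case (tensor f1 e1)
  show ?case
  proof (induction y rule: M.tensor_induct)
    case (tensor f2 e2)
    have "t (f1 * f2) (br e1 e2) + t (f2 * f1) (br e2 e1) = t (f1 * f2) (sym_bracket br e1 e2)"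
      by (simp add: sym_bracket_def t_simps mult.commute)
    then show ?case
      by (simp add: cbr_t form_t der_mult der_\<iota> sym_bracket_in_left_center sym_bracket_commute[of e2]
          RM.scale_right_distrib algebra_simps)
  next
    case (add x y)
    then show ?case by (simp add: cbr_add_left cbr_add_right form_add_right der_add algebra_simps)
  qed
next
  case (add x z)
  then show ?case by (simp add: cbr_add_left cbr_add_right form_add_left der_add algebra_simps)
qed

lemma cbr_rM_left: "cbr (rM f x) y = rM f (cbr x y) - rM (form y (der f)) x + rM (form x y) (der f)"
proof -
  have 1: "cbr (rM f x) y = der (form (rM f x) y) - cbr y (rM f x)"
    by (simp add: cbr_sym[symmetric])
  show ?thesis
    unfolding 1 by (simp add: form_rM_left der_mult cbr_rM_right cbr_sym[symmetric] RM.scale_right_distrib)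
qed

text \<open>The bracket is not R-linear in its first argument, but in \<partial>(z f) = f z + z
  \<partial>f the defects of the two summands cancel. It remains that a generator z acts by zero,
  which uses that z is left central and pairs to zero with \<partial>R.\<close>

lemma cbr_der_left: "cbr (der f) y = 0"
proof (induction f rule: S.symmetric_algebra_induct)
  case (mult z f)
  have "cbr (t 1 z) y = 0"
  proof (induction y rule: M.tensor_induct)
    case (tensor f2 e2)
    show ?case using mult(1) by (simp add: cbr_t form_der_center left_center_def)
  qed (simp add: cbr_add_right)
  then show ?case
    using mult by (simp add: der_mult der_\<iota> cbr_add_left cbr_rM_left t_eq_rM[of f z]
        form_commute[of y] del: M.tensor_action_t)
qed (simp_all add: der_add cbr_add_left)

lemma cbr_der_right: "cbr x (der f) = der (form x (der f))"
  using cbr_sym[of x "der f"] by (simp add: cbr_der_left)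

lemma form_invariant: "form x (der (form y z)) = form (cbr x y) z + form y (cbr x z)"
proof (induction x rule: M.tensor_induct)
  case x: (tensor f1 e1)
  show ?case
  proof (induction y rule: M.tensor_induct)
    case y: (tensor f2 e2)
    show ?case
    proof (induction z rule: M.tensor_induct)
      case z: (tensor f3 e3)
      let ?s = "sym_bracket br"
      \<comment> \<open>The element (e2, e3) is left central, so multiplying it by e1 from the left
        is the same as taking its symmetric bracket with e1; under \<iota> the latter is
        \<langle>e1, \<partial>\<langle>e2, e3\<rangle>\<rangle>.\<close>
      have "br e1 (?s e2 e3) = ?s e1 (?s e2 e3)"
        by (simp add: sym_bracket_def[of br e1] sym_bracket_left_center)
      then have "?s e1 (?s e2 e3) = ?s (br e1 e2) e3 + ?s e2 (br e1 e3)"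
        using br_sym_bracket[of e1 e2 e3] by simp
      then have "\<iota> (?s e1 (?s e2 e3)) = \<iota> (?s (br e1 e2) e3) + \<iota> (?s e2 (br e1 e3))"
        by (simp only: \<iota>_add sym_bracket_in_left_center)
      moreover have "form (t 1 e1) (der (\<iota> (?s e2 e3))) = \<iota> (?s e1 (?s e2 e3))"
        by (simp add: der_\<iota> sym_bracket_in_left_center form_t)
      moreover have "form (der f1) (t f3 e3) = f3 * form (t 1 e3) (der f1)"
        "form (t f2 e2) (der f1) = f2 * form (t 1 e2) (der f1)"
        using form_t_left[of f3 e3 "der f1"] form_t_left[of f2 e2 "der f1"]
        by (simp_all add: form_commute[of "der f1"])
      ultimately show ?case
        unfolding form_t form_t_left[of f1 e1 "der _"]
        by (simp add: cbr_t form_t form_add_left form_add_right form_diff_left form_diff_right form_rM_left form_rM_right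
            der_mult sym_bracket_commute[of e2 e1] algebra_simps)
    qed (simp add: form_add_right der_add cbr_add_right)
  qed (simp add: form_add_left form_add_right der_add cbr_add_right)
qed (simp add: form_add_left form_add_right cbr_add_left)

text \<open>Invariance against \<partial>f; it says that \<rho>(x \<circ> y) is the commutator of
  \<rho>(x) and \<rho>(y) on R.\<close>

lemma form_cbr_der: "form (cbr x y) (der f) = form x (der (form y (der f))) - form y (der (form x (der f)))"
  using form_invariant[of x y "der f"] by (simp add: cbr_der_right)

text \<open>
  The Jacobiator is alternating and linear over the symmetric algebra in its last argument, so it is
  determined by its values on generators.
\<close>

definition jacobiator :: "'m \<Rightarrow> 'm \<Rightarrow> 'm \<Rightarrow> 'm" where
  "jacobiator x y z = cbr x (cbr y z) - cbr (cbr x y) z - cbr y (cbr x z)"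

lemma cbr_diff_right: "cbr x (y - z) = cbr x y - cbr x z"
  using cbr_add_right[of x "y - z" z] by simp

lemma jacobiator_add:
  "jacobiator (x + x') y z = jacobiator x y z + jacobiator x' y z"
  "jacobiator x (y + y') z = jacobiator x y z + jacobiator x y' z"
  "jacobiator x y (z + z') = jacobiator x y z + jacobiator x y z'"
  by (simp_all add: jacobiator_def cbr_add_left cbr_add_right)

text \<open>x \<circ> y + y \<circ> x is exact, and exact elements act by zero from the
  left.\<close>

lemma jacobiator_swap_12: "jacobiator y x z = - jacobiator x y z"
proof -
  have "cbr (cbr y x) z + cbr (cbr x y) z = 0"
    by (simp add: cbr_add_left[symmetric] cbr_sym cbr_der_left)
  then have "cbr (cbr y x) z = - cbr (cbr x y) z" by (simp only: eq_neg_iff_add_eq_0)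
  then show ?thesis by (simp add: jacobiator_def)
qed

text \<open>Exchanging factors in the products leaves exact terms; they add up to \<partial> of the
  invariance identity of the pairing and vanish.\<close>

lemma jacobiator_swap_23: "jacobiator x z y = - jacobiator x y z"
proof -
  have 1: "cbr z y = der (form y z) - cbr y z" "cbr z (cbr x y) = der (form (cbr x y) z) - cbr (cbr x y) z"
    "cbr (cbr x z) y = der (form y (cbr x z)) - cbr y (cbr x z)"
    by (simp_all add: cbr_sym[symmetric])
  show ?thesis
    unfolding jacobiator_def 1 cbr_diff_right cbr_der_right form_invariant by (simp add: der_add)
qed

text \<open>The terms in which f is differentiated cancel because \<rho> respects brackets.\<close>

lemma jacobiator_rM: "jacobiator x y (rM f z) = rM f (jacobiator x y z)"
  by (simp add: jacobiator_def cbr_rM_right cbr_add_right form_cbr_der RM.scale_right_diff_distrib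
      RM.scale_left_diff_distrib algebra_simps)

text \<open>The alternating property brings each argument in turn to the last position, where
  scalars can be pulled out; on elements 1 \<otimes> e the bracket is that of L.\<close>

lemma jacobiator_zero: "jacobiator x y z = 0"
proof -
  have gen: "jacobiator (t 1 a) (t 1 b) (t 1 c) = 0" for a b c
    using left_leibniz[of a b c] by (simp add: jacobiator_def cbr_t t_simps)
  have 3: "jacobiator (t 1 a) (t 1 b) z = 0" for a b z
  proof (induction z rule: M.tensor_induct)
    case (tensor f c)
    show ?case by (subst t_eq_rM) (simp add: jacobiator_rM gen del: M.tensor_action_t)
  qed (simp add: jacobiator_add)
  have 2: "jacobiator (t 1 a) y z = 0" for a y z
  proof (induction y rule: M.tensor_induct)
    case (tensor f c)
    have "jacobiator (t 1 a) (rM f (t 1 c)) z = - jacobiator (t 1 a) z (rM f (t 1 c))"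
      by (rule jacobiator_swap_23)
    also have "\<dots> = - rM f (- jacobiator (t 1 a) (t 1 c) z)"
      unfolding jacobiator_rM jacobiator_swap_23[of _ z "t 1 c"] ..
    finally show ?case by (simp add: 3)
  qed (simp add: jacobiator_add)
  show ?thesis
  proof (induction x rule: M.tensor_induct)
    case (tensor f c)
    have "jacobiator (rM f (t 1 c)) y z = - jacobiator y (rM f (t 1 c)) z"
      by (rule jacobiator_swap_12)
    also have "\<dots> = jacobiator y z (rM f (t 1 c))"
      by (simp add: jacobiator_swap_23[of y z])
    also have "\<dots> = rM f (jacobiator (t 1 c) y z)"
      unfolding jacobiator_rM jacobiator_swap_23[of y z] jacobiator_swap_12[of y "t 1 c"] by simp
    finally show ?case by (simp add: 2)
  qed (simp add: jacobiator_add)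
qed

lemma leibniz_algebra_cbr: "leibniz_algebra sM cbr"
proof unfold_locales
  show "bilinear_map sM sM sM cbr"
  proof (rule bilinear_mapI)
    show "cbr z (sM c x) = sM c (cbr z x)" for z c x
      by (simp add: M.scale_eq_tensor_action cbr_rM_right)
  qed (simp_all add: spaces cbr_add_left cbr_add_right cbr_scale_left)
  show "cbr x (cbr y z) = cbr (cbr x y) z + cbr y (cbr x z)" for x y z
    using jacobiator_zero[of x y z] by (simp add: jacobiator_def algebra_simps)
qed

end

section \<open>The induced representation\<close>

locale crossed_representation = crossed_product sL br sR \<iota> sM t
  for sL :: "'k::field \<Rightarrow> 'l::ab_group_add \<Rightarrow> 'l" and br
    and sR :: "'k \<Rightarrow> 'r::comm_ring_1 \<Rightarrow> 'r" and \<iota>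
    and sM :: "'k \<Rightarrow> 'm::ab_group_add \<Rightarrow> 'm" and t +
  fixes H :: "'l set" and sV :: "'k \<Rightarrow> 'v::ab_group_add \<Rightarrow> 'v" and \<tau> :: "'l \<Rightarrow> 'v \<Rightarrow> 'v"
    and sW :: "'k \<Rightarrow> 'w::ab_group_add \<Rightarrow> 'w" and tV :: "'r \<Rightarrow> 'v \<Rightarrow> 'w"
  assumes ideal: "isotropic_ideal sL br H" and center: "left_center br \<subseteq> H"
    and rep: "leibniz_representation sL br H sV \<tau>"
    and tensor_V: "is_tensor_product sR sV sW tV"
begin

sublocale V: algebra_tensor sR sV sW tV
  by unfold_locales (use tensor_V sym_alg in \<open>simp_all add: is_symmetric_algebra_def\<close>)

abbreviation rW :: "'r \<Rightarrow> 'w \<Rightarrow> 'w" where "rW \<equiv> tensor_action sW tV"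
abbreviation nab :: "'m \<Rightarrow> 'w \<Rightarrow> 'w" where "nab \<equiv> extended_action br sR \<iota> sM t \<tau> sW tV"
abbreviation HM :: "'m set" where "HM \<equiv> extended_ideal sM t H"

sublocale RW: module rW by (rule V.module_tensor_action)

lemma rW_scale_left: "rW (sR c f) x = sW c (rW f x)"
  by (simp add: V.scale_eq_tensor_action V.sA_mult_left)

lemma rW_scale_right: "rW f (sW c x) = sW c (rW f x)"
  by (simp add: V.scale_eq_tensor_action mult.commute)

lemma \<tau>_add_left: "\<tau> (x + y) v = \<tau> x v + \<tau> y v"
  and \<tau>_add_right: "\<tau> x (v + w) = \<tau> x v + \<tau> x w"
  and \<tau>_scale_left: "\<tau> (sL c x) v = sV c (\<tau> x v)"
  and \<tau>_scale_right: "\<tau> x (sV c v) = sV c (\<tau> x v)"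
  and \<tau>_br: "\<tau> (br x y) v = \<tau> x (\<tau> y v) - \<tau> y (\<tau> x v)"
  and \<tau>_H: "h \<in> H \<Longrightarrow> \<tau> h v = 0"
  using rep by (simp_all add: leibniz_representation_def bilinear_map_def Vector_Spaces.linear_iff)

lemma H_subspace: "subspace H"
  and H_br_right: "h \<in> H \<Longrightarrow> br e h \<in> H"
  and H_isotropic: "h \<in> H \<Longrightarrow> h' \<in> H \<Longrightarrow> sym_bracket br h h' = 0"
  using ideal by (auto simp: isotropic_ideal_def)

lemma der_in_HM: "der f \<in> HM"
  using der_in_extended_center extended_ideal_mono[OF center] by blast

lemma form_HM: "x \<in> HM \<Longrightarrow> y \<in> HM \<Longrightarrow> form x y = 0"
  by (rule form_extended_zero[OF _ _ H_isotropic])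

lemmas HM_diff = M.T.subspace_diff[OF subspace_extended_ideal]

lemma cbr_HM_right: "h \<in> HM \<Longrightarrow> cbr e h \<in> HM"
proof (induction e rule: M.tensor_induct)
  case (tensor f e)
  from tensor.prems show ?case
  proof (induction rule: extended_ideal_induct)
    case (gen g h)
    have "form (t 1 h) (der f) = 0" by (rule form_HM[OF t_in_extended_ideal[OF gen] der_in_HM])
    then show ?case
      using gen by (simp add: cbr_t extended_ideal_add t_in_extended_ideal H_br_right rM_extended_ideal der_in_HM)
  next
    case zero
    show ?case using cbr_add_right[of "t f e" 0 0] by (simp add: extended_ideal_zero)
  qed (simp add: cbr_add_right extended_ideal_add)
qed (simp add: cbr_add_left extended_ideal_add)

text \<open>The sum of the two products is exact, hence in the ideal.\<close>

lemma cbr_HM_left: "h \<in> HM \<Longrightarrow> cbr h e \<in> HM"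
  using cbr_sym[of h e] cbr_HM_right[of h e] der_in_HM[of "form h e"] HM_diff
  by (metis add_diff_cancel_right')

lemmas V_spaces = spaces V.B.vector_space_axioms V.T.vector_space_axioms
lemmas tV_simps = V.t_add_left V.t_add_right V.t_scale_left V.t_scale_right

lemma bilinear_nab_right: "bilinear_map sR sV sW (\<lambda>g v. rW f (tV (form (t 1 e) (der g)) v + tV g (\<tau> e v)))"
  by (rule bilinear_mapI)
    (simp_all add: V_spaces tV_simps form_add_right der_add der_scale form_scale_right \<tau>_add_right \<tau>_scale_right
      rW_scale_right RW.scale_right_distrib V.T.scale_right_distrib V.sA_mult_right distrib_left)

lemma bilinear_nab_left: "bilinear_map sR sL sW (\<lambda>f e. rW f (tV (form (t 1 e) (der g)) v + tV g (\<tau> e v)))"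
  by (rule bilinear_mapI)
    (simp_all add: V_spaces tV_simps form_add_left M.t_add_right M.t_scale_right form_scale_left \<tau>_add_left \<tau>_scale_left
      rW_scale_right rW_scale_left RW.scale_right_distrib RW.scale_left_distrib V.T.scale_right_distrib
      V.sA_mult_left V.sA_mult_right distrib_left distrib_right)

lemmas nab_induced = M.tensor_product_axioms V.tensor_product_axioms bilinear_nab_right bilinear_nab_left
  extended_action_def[of br sR \<iota> sM t \<tau> sW tV]
lemmas nab_t = induced2_t[OF nab_induced]
lemmas nab_add_left = induced2_add_left[OF nab_induced]
lemmas nab_add_right = induced2_add_right[OF nab_induced]
lemmas nab_scale_left = induced2_scale_left[OF nab_induced]

lemma nab_rM: "nab (rM f x) w = rW f (nab x w)"
proof (induction x rule: M.tensor_induct)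
  case (tensor g e)
  show ?case
    by (induction w rule: V.tensor_induct) (simp_all add: nab_add_right RW.scale_right_distrib nab_t mult.assoc)
qed (simp add: RM.scale_right_distrib nab_add_left RW.scale_right_distrib)

lemma nab_rW: "nab x (rW f w) = rW (form x (der f)) w + rW f (nab x w)"
proof (induction x rule: M.tensor_induct)
  case (tensor g e)
  show ?case
    unfolding form_t_left[of g e "der f"]
    by (induction w rule: V.tensor_induct)
      (simp_all add: nab_add_right RW.scale_right_distrib nab_t der_mult form_add_right form_rM_right tV_simps algebra_simps)
qed (simp add: nab_add_left form_add_left RW.scale_right_distrib RW.scale_left_distrib)

lemma nab_zero_right [simp]: "nab x 0 = 0"
  using nab_add_right[of x 0 0] by simp

lemma nab_HM: "x \<in> HM \<Longrightarrow> nab x w = 0"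
proof (induction rule: extended_ideal_induct)
  case zero
  show ?case using nab_add_left[of 0 0 w] by simp
next
  case (gen f h)
  have "form (t 1 h) (der g) = 0" for g by (rule form_HM[OF t_in_extended_ideal[OF gen] der_in_HM])
  then show ?case
    by (induction w rule: V.tensor_induct) (simp_all add: nab_add_right nab_t \<tau>_H gen)
qed (simp add: nab_add_left)

text \<open>The defect of \<nabla> from being a representation. Unlike its individual terms it is
  linear over R in all three arguments, so it is enough to see it vanish on 1 \<otimes> a, 1
  \<otimes> b and 1 \<otimes> v.\<close>

definition curvature :: "'m \<Rightarrow> 'm \<Rightarrow> 'w \<Rightarrow> 'w" where
  "curvature x y w = nab (cbr x y) w - (nab x (nab y w) - nab y (nab x w))"

lemma curvature_add:
  "curvature (x + x') y w = curvature x y w + curvature x' y w"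
  "curvature x (y + y') w = curvature x y w + curvature x y' w"
  "curvature x y (w + w') = curvature x y w + curvature x y w'"
  by (simp_all add: curvature_def cbr_add_left cbr_add_right nab_add_left nab_add_right)

text \<open>Exact elements lie in the extended ideal, on which \<nabla> vanishes.\<close>

lemma curvature_swap: "curvature y x w = - curvature x y w"
proof -
  have "nab (cbr y x) w + nab (cbr x y) w = 0"
    by (simp add: nab_add_left[symmetric] cbr_sym nab_HM der_in_HM)
  then have "nab (cbr y x) w = - nab (cbr x y) w" by (simp only: eq_neg_iff_add_eq_0)
  then show ?thesis by (simp add: curvature_def)
qed

lemma curvature_rW: "curvature x y (rW f w) = rW f (curvature x y w)"
  by (simp add: curvature_def nab_rW nab_add_right form_cbr_der RW.scale_right_diff_distrib
      RW.scale_left_diff_distrib algebra_simps)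

lemma curvature_rM: "curvature x (rM f y) w = rW f (curvature x y w)"
  by (simp add: curvature_def cbr_rM_right nab_add_left nab_rM nab_rW RW.scale_right_diff_distrib algebra_simps)

lemma curvature_zero: "curvature x y w = 0"
proof -
  have gen: "curvature (t 1 a) (t 1 b) (tV 1 v) = 0" for a b v
    using V.t_add_right[of 1 "\<tau> (br a b) v" "\<tau> b (\<tau> a v)"] by (simp add: curvature_def cbr_t nab_t \<tau>_br)
  have 3: "curvature (t 1 a) (t 1 b) w = 0" for a b w
  proof (induction w rule: V.tensor_induct)
    case (tensor f v)
    have "tV f v = rW f (tV 1 v)" by simp
    then show ?case by (simp only: curvature_rW gen RW.scale_zero_right)
  qed (simp add: curvature_add)
  have 2: "curvature (t 1 a) y w = 0" for a y w
  proof (induction y rule: M.tensor_induct)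
    case (tensor f b)
    show ?case by (subst t_eq_rM) (simp only: curvature_rM 3 RW.scale_zero_right)
  qed (simp add: curvature_add)
  show ?thesis
  proof (induction x rule: M.tensor_induct)
    case (tensor f a)
    have "curvature (rM f (t 1 a)) y w = - curvature y (rM f (t 1 a)) w" by (rule curvature_swap)
    also have "\<dots> = 0" unfolding curvature_rM curvature_swap[of y "t 1 a"] 2 by simp
    finally show ?case by simp
  qed (simp add: curvature_add)
qed

lemma nab_cbr: "nab (cbr x y) w = nab x (nab y w) - nab y (nab x w)"
  using curvature_zero[of x y w] by (simp add: curvature_def)

lemma cbr_t_1: "cbr (t 1 a) (t 1 b) = t 1 (br a b)"
  by (simp add: cbr_t)

lemma isotropic_HM: "isotropic_ideal sM cbr HM"
  \<comment> \<open>Symmetric brackets within the ideal are \<partial>\<langle>h, h'\<rangle> =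
    \<partial>0; the instance of \<open>der_scalar\<close> is \<partial>0 = 0.\<close>
  by (simp add: isotropic_ideal_def subspace_extended_ideal cbr_HM_left cbr_HM_right sym_bracket_def cbr_sym form_HM
      der_scalar[of 0, simplified])

lemma representation_nab: "leibniz_representation sM cbr HM sW nab"
  unfolding leibniz_representation_def
proof (intro conjI allI ballI)
  show "bilinear_map sM sW sW nab"
  proof (rule bilinear_mapI)
    show "nab z (sW c x) = sW c (nab z x)" for z c x
      by (simp add: V.scale_eq_tensor_action nab_rW)
  qed (simp_all add: V_spaces nab_add_left nab_add_right nab_scale_left)
qed (simp_all add: nab_cbr nab_HM)

lemma representation_nab_L: "leibniz_representation sL br H sW (\<lambda>e. nab (t 1 e))"
  unfolding leibniz_representation_def
proof (intro conjI allI ballI)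
  show "bilinear_map sL sW sW (\<lambda>e. nab (t 1 e))"
  proof (rule bilinear_mapI)
    show "nab (t 1 z) (sW c x) = sW c (nab (t 1 z) x)" for z c x
      by (simp add: V.scale_eq_tensor_action nab_rW)
  qed (simp_all add: V_spaces M.t_add_right M.t_scale_right nab_add_left nab_add_right nab_scale_left)
qed (simp_all add: cbr_t_1[symmetric] nab_cbr nab_HM t_in_extended_ideal)

sublocale L: leibniz_complex sL br H sW "\<lambda>e. nab (t 1 e)"
  by unfold_locales (use ideal center sym_bracket_in_left_center representation_nab_L in auto)

sublocale C: courant_dorfman_complex sM cbr HM sW nab "\<lambda>c. sR c 1" rM rW form der
proof -
  interpret leibniz_algebra sM cbr by (rule leibniz_algebra_cbr)
  show "courant_dorfman_complex sM cbr HM sW nab (\<lambda>c. sR c 1) rM rW form der"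
  proof unfold_locales
    show "form x y = form y x" for x y by (rule form_commute)
  qed (simp_all add: isotropic_HM representation_nab sym_bracket_def cbr_sym der_in_HM M.module_tensor_action[unfolded module_def]
        V.module_tensor_action[unfolded module_def] M.scale_eq_tensor_action[symmetric] V.scale_eq_tensor_action[symmetric]
        form_add_left form_add_right form_rM_left form_rM_right der_add der_mult cbr_rM_right form_invariant cbr_der_left rM_extended_ideal
        form_HM nab_rM nab_rW RM.scale_right_distrib RM.scale_left_distrib RW.scale_right_distrib RW.scale_left_distrib)
qed

end

section \<open>Extension and restriction of cochains\<close>

lemma hsum_map: "hsum F (map g hs) = hsum (\<lambda>x r. F (g x) (map g r)) hs"
  by (induction hs arbitrary: F) simp_all

context crossed_representation
begin

text \<open>
  Elements of \<open>HM\<close> need not be handled separately from the other elements of the crossed product: composing with a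
  projection onto \<open>H\<close> makes the values of a cochain on arguments from \<open>H\<close> multilinear on all of \<open>L\<close>.
\<close>

definition proj :: "'l \<Rightarrow> 'l" where
  "proj = (SOME g. range g \<subseteq> H \<and> Vector_Spaces.linear sL sL g \<and> (\<forall>h\<in>H. g h = h))"

lemma proj: "range proj \<subseteq> H \<and> Vector_Spaces.linear sL sL proj \<and> (\<forall>h\<in>H. proj h = h)"
proof -
  interpret P: vector_space_pair sL sL ..
  have "Vector_Spaces.linear sL sL id" by (rule linear_id)
  then have "\<exists>g. range g \<subseteq> H \<and> Vector_Spaces.linear sL sL g \<and> (\<forall>h\<in>H. g (id h) = h)"
    by (rule P.linear_exists_left_inverse_on) (simp_all add: H_subspace)
  then have "\<exists>g. range g \<subseteq> H \<and> Vector_Spaces.linear sL sL g \<and> (\<forall>h\<in>H. g h = h)" by simp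
  then show ?thesis unfolding proj_def by (rule someI_ex)
qed

lemma proj_in_H [simp]: "proj x \<in> H"
  and proj_H: "h \<in> H \<Longrightarrow> proj h = h"
  and proj_add: "proj (x + y) = proj x + proj y"
  and proj_scale: "proj (sL c x) = sL c (proj x)"
  using proj by (auto simp: Vector_Spaces.linear_iff)

lemma map_proj_H: "set hs \<subseteq> H \<Longrightarrow> map proj hs = hs"
  by (induction hs) (simp_all add: proj_H)

section \<open>Extension in the arguments from H\<close>

definition sym_multilinear :: "('l list \<Rightarrow> 'w) \<Rightarrow> bool" where
  "sym_multilinear b \<longleftrightarrow> (\<forall>ls ls'. mset ls = mset ls' \<longrightarrow> b ls = b ls') \<and>
     (\<forall>x y ls. b ((x + y) # ls) = b (x # ls) + b (y # ls)) \<and> (\<forall>c x ls. b (sL c x # ls) = sW c (b (x # ls)))"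

lemma sym_multilinear_tail:
  assumes "sym_multilinear b"
  shows "sym_multilinear (\<lambda>ls. b (l # ls))"
proof -
  have sw: "b (l # x # ls) = b (x # l # ls)" for x ls
  proof -
    have "mset (l # x # ls) = mset (x # l # ls)" by (simp add: add_mset_commute)
    then show ?thesis using assms unfolding sym_multilinear_def by blast
  qed
  have "b (l # ls) = b (l # ls')" if "mset ls = mset ls'" for ls ls'
  proof -
    have "mset (l # ls) = mset (l # ls')" using that by simp
    then show ?thesis using assms unfolding sym_multilinear_def by blast
  qed
  then show ?thesis using assms unfolding sym_multilinear_def sw by simp
qed

text \<open>For \<open>sym_multilinear b\<close> this is the R-multilinear extension: on pure
  tensors f1 l1, ..., fn ln its value is f1 ... fn times b(l1, ..., ln). Extending slot by slot
  avoids tensor powers.\<close>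

primrec mext :: "('l list \<Rightarrow> 'w) \<Rightarrow> 'm list \<Rightarrow> 'w" where
  "mext b [] = b []"
| "mext b (x # xs) = induced sM t sW (\<lambda>f l. rW f (mext (\<lambda>ls. b (l # ls)) xs)) x"

lemma mext_add: "mext (\<lambda>ls. b ls + b' ls) xs = mext b xs + mext b' xs"
  by (induction xs arbitrary: b b')
    (simp_all add: RW.scale_right_distrib induced_add_fun[OF V.T.vector_space_axioms])

lemma induced_rW: "rW g (induced sM t sW b x) = induced sM t sW (\<lambda>f l. rW g (b f l)) x"
  by (rule induced_hom) (simp_all add: RW.scale_right_distrib rW_scale_right)

lemma induced_sW: "sW c (induced sM t sW b x) = induced sM t sW (\<lambda>f l. sW c (b f l)) x"
  by (rule induced_hom) (simp_all add: V.T.scale_right_distrib mult.commute)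

lemma mext_scale: "mext (\<lambda>ls. sW c (b ls)) xs = sW c (mext b xs)"
  by (induction xs arbitrary: b) (simp_all add: rW_scale_right induced_sW)

lemma mext_zero: "mext (\<lambda>ls. 0) xs = 0"
  using mext_scale[of 0 "\<lambda>ls. 0" xs] by simp

lemma bilinear_mext:
  assumes "sym_multilinear b"
  shows "bilinear_map sR sL sW (\<lambda>f l. rW f (mext (\<lambda>ls. b (l # ls)) xs))"
  using assms unfolding sym_multilinear_def
  by (intro bilinear_mapI)
    (simp_all add: V_spaces RW.scale_left_distrib RW.scale_right_distrib rW_scale_left rW_scale_right mext_add mext_scale)

lemma mext_t: "sym_multilinear b \<Longrightarrow> mext b (t f l # xs) = rW f (mext (\<lambda>ls. b (l # ls)) xs)"
  by (simp add: M.induced_t[OF bilinear_mext])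

lemma mext_head_add: "sym_multilinear b \<Longrightarrow> mext b ((x + y) # xs) = mext b (x # xs) + mext b (y # xs)"
  by (simp add: M.induced_add[OF bilinear_mext])

lemma mext_head_rM:
  assumes b: "sym_multilinear b"
  shows "mext b (rM f x # xs) = rW f (mext b (x # xs))"
proof (induction x rule: M.tensor_induct)
  case (add x y)
  then show ?case
    using mext_head_add[OF b, of "rM f x" "rM f y" xs] mext_head_add[OF b, of x y xs]
    by (simp only: RM.scale_right_distrib RW.scale_right_distrib)
next
  case (tensor g l)
  show ?case
    using mext_t[OF b, of "f * g" l xs] mext_t[OF b, of g l xs] by (simp del: mext.simps)
qed

lemma mext_second_add:
  assumes b: "sym_multilinear b"
  shows "mext b (a # (x + y) # xs) = mext b (a # x # xs) + mext b (a # y # xs)"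
proof (induction a rule: M.tensor_induct)
  case (add u v)
  then show ?case by (simp add: mext_head_add[OF b] del: mext.simps)
next
  case (tensor f l)
  show ?case
    by (simp add: mext_t[OF b] mext_head_add[OF sym_multilinear_tail[OF b]] RW.scale_right_distrib del: mext.simps)
qed

text \<open>Additivity in the first two slots reduces the exchange to pure tensors, where it is the
  symmetry of \<open>b\<close> and the commutativity of R.\<close>

lemma mext_swap:
  assumes b: "sym_multilinear b"
  shows "mext b (x # y # xs) = mext b (y # x # xs)"
proof (induction x rule: M.tensor_induct)
  case (add u v)
  then show ?case by (simp add: mext_head_add[OF b] mext_second_add[OF b] del: mext.simps)
next
  case (tensor f l)
  show ?case
  proof (induction y rule: M.tensor_induct)
    case (add u v)
    then show ?case by (simp add: mext_head_add[OF b] mext_second_add[OF b] del: mext.simps)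
  next
    case (tensor g l')
    have "b (l # l' # ls) = b (l' # l # ls)" for ls
    proof -
      have "mset (l # l' # ls) = mset (l' # l # ls)" by (simp add: add_mset_commute)
      then show ?thesis using b unfolding sym_multilinear_def by blast
    qed
    then show ?case
      by (simp add: mext_t[OF b] mext_t[OF sym_multilinear_tail[OF b]] mult.commute del: mext.simps)
  qed
qed

lemma mext_move:
  assumes "sym_multilinear b"
  shows "mext b (us @ x # vs) = mext b (x # us @ vs)"
  using assms
proof (induction us arbitrary: b)
  case (Cons u us)
  have "mext (\<lambda>ls. b (l # ls)) (us @ x # vs) = mext (\<lambda>ls. b (l # ls)) (x # us @ vs)" for l
    using sym_multilinear_tail[OF Cons.prems] by (rule Cons.IH)
  then have "mext b (u # us @ x # vs) = mext b (u # x # us @ vs)" by simp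
  then show ?case using mext_swap[OF Cons.prems, of u x "us @ vs"] by simp
qed simp

lemma mext_perm:
  assumes "sym_multilinear b" "mset xs = mset ys"
  shows "mext b xs = mext b ys"
  using assms
proof (induction xs arbitrary: b ys)
  case (Cons x xs)
  then have "x \<in> set ys" by (metis list.set_intros(1) mset_eq_setD)
  then obtain us vs where ys: "ys = us @ x # vs" by (meson split_list)
  have "mext (\<lambda>ls. b (l # ls)) xs = mext (\<lambda>ls. b (l # ls)) (us @ vs)" for l
    by (rule Cons.IH[OF sym_multilinear_tail[OF Cons.prems(1)]]) (use Cons.prems(2) ys in simp)
  then have "mext b (x # xs) = mext b (x # us @ vs)" by simp
  then show ?case unfolding ys mext_move[OF Cons.prems(1)] .
qed simp

section \<open>Extension of cochains\<close>

text \<open>Each call shortens \<open>es\<close>, while \<open>k\<close> and \<open>hs\<close> may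
  grow; hence the measure. The sum is the wedge term of the second axiom, written out because its
  values are themselves recursive calls.\<close>

function extend_raw :: "('l, 'w) family \<Rightarrow> nat \<Rightarrow> 'm list \<Rightarrow> 'm list \<Rightarrow> 'w" where
  "extend_raw \<omega> k [] hs = mext (\<lambda>ls. \<omega> k [] (map proj ls)) hs"
| "extend_raw \<omega> k (x # es) hs = induced sM t sW (\<lambda>f e. rW f (extend_raw (contr e \<omega>) k es hs) +
     (\<Sum>b<length es. rW ((-1) ^ Suc b * form (t 1 e) (es ! b)) (extend_raw \<omega> (Suc k) (omit b es) (der f # hs)))) x"
  by pat_completeness auto
termination
  by (relation "measure (\<lambda>(\<omega>, k, es, hs). length es)") (auto simp: le_imp_less_Suc[OF length_omit_le])

lemma extend_raw_add: "extend_raw (\<omega> + \<eta>) k es hs = extend_raw \<omega> k es hs + extend_raw \<eta> k es hs"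
proof (induction es arbitrary: \<omega> \<eta> k hs rule: measure_induct_rule[of length])
  case (less es)
  show ?case
  proof (cases es)
    case Nil
    then show ?thesis by (simp add: mext_add)
  next
    case (Cons x xs)
    have 1: "extend_raw (contr e (\<omega> + \<eta>)) k xs hs = extend_raw (contr e \<omega>) k xs hs + extend_raw (contr e \<eta>) k xs hs" for e
      unfolding contr_add by (rule less.IH) (simp add: Cons)
    have 2: "extend_raw (\<omega> + \<eta>) (Suc k) (omit b xs) hs' = extend_raw \<omega> (Suc k) (omit b xs) hs' + extend_raw \<eta> (Suc k) (omit b xs) hs'" for b hs'
      by (rule less.IH) (simp add: Cons le_imp_less_Suc[OF length_omit_le])
    show ?thesis
      unfolding Cons extend_raw.simps 1 2 RW.scale_right_distrib sum.distrib
      by (simp add: induced_add_fun[OF V.T.vector_space_axioms, symmetric] ac_simps)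
  qed
qed

lemma extend_raw_scale: "extend_raw (family_scale sW c \<omega>) k es hs = sW c (extend_raw \<omega> k es hs)"
proof (induction es arbitrary: \<omega> k hs rule: measure_induct_rule[of length])
  case (less es)
  show ?case
  proof (cases es)
    case Nil
    then show ?thesis by (simp add: mext_scale)
  next
    case (Cons x xs)
    have 1: "extend_raw (contr e (family_scale sW c \<omega>)) k xs hs = sW c (extend_raw (contr e \<omega>) k xs hs)" for e
      unfolding contr_scale by (rule less.IH) (simp add: Cons)
    have 2: "extend_raw (family_scale sW c \<omega>) (Suc k) (omit b xs) hs' = sW c (extend_raw \<omega> (Suc k) (omit b xs) hs')" for b hs'
      by (rule less.IH) (simp add: Cons le_imp_less_Suc[OF length_omit_le])
    show ?thesis
      unfolding Cons extend_raw.simps 1 2 induced_sW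
      by (simp add: V.T.scale_right_distrib V.T.scale_sum_right rW_scale_right)
  qed
qed

lemma extend_raw_zero: "extend_raw 0 k es hs = 0"
  using extend_raw_add[of 0 0 k es hs] by simp

lemma sym_multilinear_cochain:
  assumes c: "\<omega> \<in> L.cochains n"
  shows "sym_multilinear (\<lambda>ls. \<omega> k [] (map proj ls))"
  unfolding sym_multilinear_def
proof (intro conjI allI impI)
  fix ls ls' :: "'l list" assume "mset ls = mset ls'"
  then show "\<omega> k [] (map proj ls) = \<omega> k [] (map proj ls')"
    by (intro L.cochain_sym[OF c]) simp
qed (simp_all add: proj_add proj_scale L.cochain_hadd[OF c] L.cochain_hscale[OF c])

lemma extend_raw_sym:
  "\<omega> \<in> L.cochains n \<Longrightarrow> mset hs = mset hs' \<Longrightarrow> extend_raw \<omega> k es hs = extend_raw \<omega> k es hs'"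
proof (induction es arbitrary: \<omega> n k hs hs' rule: measure_induct_rule[of length])
  case (less es)
  note c = less.prems(1) and m = less.prems(2)
  show ?case
  proof (cases es)
    case Nil
    then show ?thesis using mext_perm[OF sym_multilinear_cochain[OF c] m] by simp
  next
    case (Cons x xs)
    have 1: "extend_raw (contr e \<omega>) k xs hs = extend_raw (contr e \<omega>) k xs hs'" for e
      by (rule less.IH[OF _ L.contr_cochains'[OF c] m]) (simp add: Cons)
    have 2: "extend_raw \<omega> (Suc k) (omit b xs) (z # hs) = extend_raw \<omega> (Suc k) (omit b xs) (z # hs')" for b z
      by (rule less.IH[OF _ c]) (simp_all add: Cons m le_imp_less_Suc[OF length_omit_le])
    show ?thesis unfolding Cons extend_raw.simps 1 2 ..
  qed
qed

lemma extend_raw_hswap: "\<omega> \<in> L.cochains n \<Longrightarrow> extend_raw \<omega> k es (a # b # hs) = extend_raw \<omega> k es (b # a # hs)"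
  by (erule extend_raw_sym) (simp add: add_mset_commute)

lemma extend_raw_hadd:
  "\<omega> \<in> L.cochains n \<Longrightarrow> extend_raw \<omega> k es ((x + y) # hs) = extend_raw \<omega> k es (x # hs) + extend_raw \<omega> k es (y # hs)"
proof (induction es arbitrary: \<omega> n k hs rule: measure_induct_rule[of length])
  case (less es)
  note c = less.prems
  show ?case
  proof (cases es)
    case Nil
    then show ?thesis using mext_head_add[OF sym_multilinear_cochain[OF c]] by (simp del: mext.simps)
  next
    case (Cons z xs)
    have 1: "extend_raw (contr e \<omega>) k xs ((x + y) # hs) = extend_raw (contr e \<omega>) k xs (x # hs) + extend_raw (contr e \<omega>) k xs (y # hs)" for e
      by (rule less.IH[OF _ L.contr_cochains'[OF c]]) (simp add: Cons)
    \<comment> \<open>The wedge term puts \<partial>f in front of \<open>hs\<close>, whereas the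
      induction hypothesis speaks of the head; the two arguments are therefore exchanged.\<close>
    have "extend_raw \<omega> (Suc k) (omit b xs) ((x + y) # z # hs) =
        extend_raw \<omega> (Suc k) (omit b xs) (x # z # hs) + extend_raw \<omega> (Suc k) (omit b xs) (y # z # hs)" for b z
      by (rule less.IH[OF _ c]) (simp_all add: Cons le_imp_less_Suc[OF length_omit_le])
    then have 2: "extend_raw \<omega> (Suc k) (omit b xs) (z # (x + y) # hs) =
        extend_raw \<omega> (Suc k) (omit b xs) (z # x # hs) + extend_raw \<omega> (Suc k) (omit b xs) (z # y # hs)" for b z
      unfolding extend_raw_hswap[OF c, of "Suc k" _ z] .
    show ?thesis
      unfolding Cons extend_raw.simps 1 2 RW.scale_right_distrib sum.distrib
      by (simp add: induced_add_fun[OF V.T.vector_space_axioms, symmetric] ac_simps)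
  qed
qed

lemma extend_raw_hrM:
  "\<omega> \<in> L.cochains n \<Longrightarrow> extend_raw \<omega> k es (rM g x # hs) = rW g (extend_raw \<omega> k es (x # hs))"
proof (induction es arbitrary: \<omega> n k hs rule: measure_induct_rule[of length])
  case (less es)
  note c = less.prems
  show ?case
  proof (cases es)
    case Nil
    then show ?thesis using mext_head_rM[OF sym_multilinear_cochain[OF c]] by (simp del: mext.simps)
  next
    case (Cons z xs)
    have 1: "extend_raw (contr e \<omega>) k xs (rM g x # hs) = rW g (extend_raw (contr e \<omega>) k xs (x # hs))" for e
      by (rule less.IH[OF _ L.contr_cochains'[OF c]]) (simp add: Cons)
    have "extend_raw \<omega> (Suc k) (omit b xs) (rM g x # z # hs) = rW g (extend_raw \<omega> (Suc k) (omit b xs) (x # z # hs))" for b z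
      by (rule less.IH[OF _ c]) (simp_all add: Cons le_imp_less_Suc[OF length_omit_le])
    then have 2: "extend_raw \<omega> (Suc k) (omit b xs) (z # rM g x # hs) = rW g (extend_raw \<omega> (Suc k) (omit b xs) (z # x # hs))" for b z
      unfolding extend_raw_hswap[OF c, of "Suc k" _ z] .
    show ?thesis
      unfolding Cons extend_raw.simps 1 2 induced_rW
      by (simp add: RW.scale_right_distrib RW.scale_sum_right mult.commute mult.left_commute)
  qed
qed

lemma extend_raw_hscale: "\<omega> \<in> L.cochains n \<Longrightarrow> extend_raw \<omega> k es (sM c x # hs) = sW c (extend_raw \<omega> k es (x # hs))"
  by (simp add: M.scale_eq_tensor_action V.scale_eq_tensor_action extend_raw_hrM)

text \<open>On H the projection is the identity, so inserting 1 \<otimes> h after extending agrees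
  with inserting h before. This supplies a cochain of smaller degree for each generator of the
  ideal.\<close>

lemma extend_raw_hcontr:
  "\<omega> \<in> L.cochains n \<Longrightarrow> h \<in> H \<Longrightarrow> extend_raw \<omega> (Suc k) es (t 1 h # hs) = extend_raw (hcontr h \<omega>) k es hs"
proof (induction es arbitrary: \<omega> n k hs rule: measure_induct_rule[of length])
  case (less es)
  note c = less.prems(1) and h = less.prems(2)
  show ?case
  proof (cases es)
    case Nil
    then show ?thesis
      using mext_t[OF sym_multilinear_cochain[OF c], of "Suc k" 1 h hs] h
      by (simp add: proj_H del: mext.simps)
  next
    case (Cons z xs)
    have 1: "extend_raw (contr e \<omega>) (Suc k) xs (t 1 h # hs) = extend_raw (contr e (hcontr h \<omega>)) k xs hs" for e
      unfolding contr_hcontr by (rule less.IH[OF _ L.contr_cochains'[OF c] h]) (simp add: Cons)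
    have "extend_raw \<omega> (Suc (Suc k)) (omit b xs) (t 1 h # z # hs) = extend_raw (hcontr h \<omega>) (Suc k) (omit b xs) (z # hs)" for b z
      by (rule less.IH[OF _ c h]) (simp add: Cons le_imp_less_Suc[OF length_omit_le])
    then have 2: "extend_raw \<omega> (Suc (Suc k)) (omit b xs) (z # t 1 h # hs) = extend_raw (hcontr h \<omega>) (Suc k) (omit b xs) (z # hs)" for b z
      unfolding extend_raw_hswap[OF c, of "Suc (Suc k)" _ z] .
    show ?thesis unfolding Cons extend_raw.simps 1 2 ..
  qed
qed

text \<open>Here e enters through the insertion and the pairing, f through the coefficient and
  through \<partial>f as an argument from the ideal. So this rests on linearity of the extension
  both in the cochain and in the arguments from the ideal.\<close>

lemma bilinear_ext:
  assumes c: "\<omega> \<in> L.cochains n"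
  shows "bilinear_map sR sL sW (\<lambda>f e. rW f (extend_raw (contr e \<omega>) k es hs) +
     (\<Sum>b<length es. rW ((-1) ^ Suc b * form (t 1 e) (es ! b)) (extend_raw \<omega> (Suc k) (omit b es) (der f # hs))))"
  by (rule bilinear_mapI)
    (simp_all add: V_spaces RW.scale_left_distrib RW.scale_right_distrib RW.scale_left_diff_distrib
      rW_scale_left rW_scale_right der_add der_scale
      extend_raw_hadd[OF c] extend_raw_hscale[OF c] L.contr_add_left[OF c] L.contr_scale_left[OF c] extend_raw_add extend_raw_scale
      M.t_add_right M.t_scale_right form_add_left form_scale_left V.sA_mult_right sum.distrib sum_subtractf sum_negf
      V.T.scale_sum_right V.T.scale_right_distrib V.T.scale_right_diff_distrib distrib_left)

lemma extend_raw_Cons_t: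
  "\<omega> \<in> L.cochains n \<Longrightarrow> extend_raw \<omega> k (t f e # es) hs = rW f (extend_raw (contr e \<omega>) k es hs) +
     (\<Sum>b<length es. rW ((-1) ^ Suc b * form (t 1 e) (es ! b)) (extend_raw \<omega> (Suc k) (omit b es) (der f # hs)))"
  unfolding extend_raw.simps by (rule M.induced_t[OF bilinear_ext])

lemma extend_raw_head_add: "\<omega> \<in> L.cochains n \<Longrightarrow> extend_raw \<omega> k ((x + y) # es) hs = extend_raw \<omega> k (x # es) hs + extend_raw \<omega> k (y # es) hs"
  unfolding extend_raw.simps by (rule M.induced_add[OF bilinear_ext])

lemma extend_raw_head_scale: "\<omega> \<in> L.cochains n \<Longrightarrow> extend_raw \<omega> k (sM c x # es) hs = sW c (extend_raw \<omega> k (x # es) hs)"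
  unfolding extend_raw.simps by (rule M.induced_scale[OF bilinear_ext])

text \<open>The raw recursion may be nonzero on arguments outside the ideal, because of the
  projection; the condition removes these values.\<close>

definition extend :: "('l, 'w) family \<Rightarrow> ('m, 'w) family" where
  "extend \<omega> = (\<lambda>k es hs. if C.ok k hs then extend_raw \<omega> k es hs else 0)"

lemma extend_add: "extend (\<omega> + \<eta>) = extend \<omega> + extend \<eta>"
  by (intro ext) (simp add: extend_def extend_raw_add)

lemma extend_scale: "extend (family_scale sW c \<omega>) = family_scale sW c (extend \<omega>)"
  by (intro ext) (simp add: extend_def extend_raw_scale)

lemma extend_zero [simp]: "extend 0 = 0"
  by (intro ext) (simp add: extend_def extend_raw_zero)

lemma extend_minus: "extend (- \<omega>) = - extend \<omega>"
  using extend_scale[of "- 1" \<omega>] by (simp add: L.family_scale_minus_one C.family_scale_minus_one)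

lemma contr_extend_t:
  assumes c: "\<omega> \<in> L.cochains n"
  shows "contr (t f e) (extend \<omega>) = C.mul f (extend (contr e \<omega>)) + C.wedge (t 1 e) (hcontr (der f) (extend \<omega>))"
proof (intro ext)
  fix k es hs
  show "contr (t f e) (extend \<omega>) k es hs =
      (C.mul f (extend (contr e \<omega>)) + C.wedge (t 1 e) (hcontr (der f) (extend \<omega>))) k es hs"
    by (cases "length hs = k"; cases "set hs \<subseteq> HM")
      (simp_all add: extend_def C.wedge_conv_rW_sum extend_raw_Cons_t[OF c] der_in_HM del: extend_raw.simps)
qed

lemma contr_extend_add:
  assumes c: "\<omega> \<in> L.cochains n"
  shows "contr (x + y) (extend \<omega>) = contr x (extend \<omega>) + contr y (extend \<omega>)"
  by (intro ext) (simp add: extend_def extend_raw_head_add[OF c] del: extend_raw.simps)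

lemma contr_extend_scale:
  assumes c: "\<omega> \<in> L.cochains n"
  shows "contr (sM a x) (extend \<omega>) = family_scale sW a (contr x (extend \<omega>))"
  by (intro ext) (simp add: extend_def extend_raw_head_scale[OF c] del: extend_raw.simps)

lemma hcontr_extend_add:
  assumes c: "\<omega> \<in> L.cochains n" and "x \<in> HM" "y \<in> HM"
  shows "hcontr (x + y) (extend \<omega>) = hcontr x (extend \<omega>) + hcontr y (extend \<omega>)"
  by (intro ext) (simp add: extend_def extend_raw_hadd[OF c] assms(2,3) extended_ideal_add)

lemma hcontr_extend_rM:
  assumes c: "\<omega> \<in> L.cochains n" and "x \<in> HM"
  shows "hcontr (rM g x) (extend \<omega>) = C.mul g (hcontr x (extend \<omega>))"
  by (intro ext) (simp add: extend_def extend_raw_hrM[OF c] assms(2) rM_extended_ideal)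

lemma hcontr_extend_zero:
  assumes c: "\<omega> \<in> L.cochains n"
  shows "hcontr 0 (extend \<omega>) = 0"
  using hcontr_extend_rM[OF c extended_ideal_zero, of 0] by (simp add: fun_eq_iff)

lemma hcontr_extend_t_1:
  assumes c: "\<omega> \<in> L.cochains n" and h: "h \<in> H"
  shows "hcontr (t 1 h) (extend \<omega>) = extend (hcontr h \<omega>)"
  by (intro ext) (simp add: extend_def extend_raw_hcontr[OF c h] t_in_extended_ideal h)

lemma hcontr_extend_t:
  assumes c: "\<omega> \<in> L.cochains n" and h: "h \<in> H"
  shows "hcontr (t g h) (extend \<omega>) = C.mul g (extend (hcontr h \<omega>))"
  using hcontr_extend_rM[OF c t_in_extended_ideal[OF h, of 1], of g] by (simp add: hcontr_extend_t_1[OF c h])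

lemma hcontr_extend_commute:
  assumes c: "\<omega> \<in> L.cochains n"
  shows "hcontr x (hcontr y (extend \<omega>)) = hcontr y (hcontr x (extend \<omega>))"
  by (intro ext) (auto simp: extend_def extend_raw_hswap[OF c, of _ _ x])

text \<open>When (f, e) and (g, e') are exchanged and the results added, the mixed wedge terms
  cancel crosswise and the double wedge by anticommutation; the remaining terms are, up to sign, the
  insertion of \<partial>\<langle>f e, g e'\<rangle>.\<close>

lemma contr_contr_extend_t:
  assumes c: "\<omega> \<in> L.cochains n"
  shows "contr (t g e') (contr (t f e) (extend \<omega>)) =
    C.mul (f * g) (extend (contr e' (contr e \<omega>)))
    + C.mul f (C.wedge (t 1 e') (hcontr (der g) (extend (contr e \<omega>))))
    - C.mul (g * \<iota> (sym_bracket br e e')) (hcontr (der f) (extend \<omega>))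
    - C.mul g (C.wedge (t 1 e) (hcontr (der f) (extend (contr e' \<omega>))))
    - C.wedge (t 1 e) (C.wedge (t 1 e') (hcontr (der f) (hcontr (der g) (extend \<omega>))))"
proof -
  have "contr (t g e') (hcontr (der f) (extend \<omega>)) = C.mul g (hcontr (der f) (extend (contr e' \<omega>)))
      + C.wedge (t 1 e') (hcontr (der f) (hcontr (der g) (extend \<omega>)))"
    by (simp add: contr_hcontr contr_extend_t[OF c] hcontr_add hcontr_scale C.hcontr_wedge)
  then show ?thesis
    by (simp add: contr_extend_t[OF c] contr_extend_t[OF L.contr_cochains'[OF c]] contr_add contr_scale C.contr_wedge
        form_t C.mul_add C.mul_mul C.wedge_add C.wedge_mul)
qed

text \<open>Inserting f e into the extension leaves a wedge term with \<partial>f, so insertions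
  from the ideal must be cochains as well. These reduce to multiples of extensions of
  \<open>hcontr h \<omega>\<close>, whose degree is lower by two. The identities between insertions
  are additive in the inserted elements and are checked on pure tensors.\<close>

lemma extend_cd: "\<omega> \<in> L.cochains n \<Longrightarrow> extend \<omega> \<in> C.cd n"
proof (induction n arbitrary: \<omega> rule: less_induct)
  case (less n \<omega>)
  let ?E = "extend \<omega>"
  note c = less.prems
  \<comment> \<open>Degrees 0 and 1 are separate: \<open>wedge\<close> raises the degree by one, so
    a cochain in the truncated degree would not do and the insertion must be known to
    vanish.\<close>
  have J0: "hcontr x ?E = 0" if "n < 2" "x \<in> HM" for x
    using that(2)
  proof (induction rule: extended_ideal_induct)
    case (add x y)
    have "hcontr x ?E = 0" "hcontr y ?E = 0" by (rule add(3), rule add(4))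
    with add(1,2) show ?case by (simp add: hcontr_extend_add[OF c])
  qed (simp_all add: hcontr_extend_zero[OF c] hcontr_extend_t[OF c] L.hcontr_cochains_0[OF c that(1)])
  have J: "hcontr x ?E \<in> C.cd p" if n: "n = Suc (Suc p)" and "x \<in> HM" for x p
    using that(2)
  proof (induction rule: extended_ideal_induct)
    case (add x y)
    have "hcontr x ?E \<in> C.cd p" "hcontr y ?E \<in> C.cd p" by (rule add(3), rule add(4))
    with add(1,2) show ?case unfolding hcontr_extend_add[OF c add(1,2)] by (intro C.add_cd)
  next
    case (gen f h)
    have "p < n" using n by simp
    moreover have "hcontr h \<omega> \<in> L.cochains p"
      using L.hcontr_cochains[OF c gen] n by simp
    ultimately have "extend (hcontr h \<omega>) \<in> C.cd p" by (rule less.IH)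
    then show ?case unfolding hcontr_extend_t[OF c gen] by (rule C.mul_cd)
  next
    case zero
    show ?case unfolding hcontr_extend_zero[OF c] by (rule C.zero_cd)
  qed
  have step0: "contr x ?E = 0" if "n = 0" for x
  proof (induction x rule: M.tensor_induct)
    case (tensor f e)
    have "contr e \<omega> = 0" using c that by (simp add: L.contr_cochains_0)
    then show ?case by (simp add: contr_extend_t[OF c] J0 that der_in_HM)
  next
    case (add x y)
    have "contr x ?E = 0" "contr y ?E = 0" by (rule add(1), rule add(2))
    then show ?case by (simp add: contr_extend_add[OF c])
  qed
  have step: "contr x ?E \<in> C.cd m" if n: "n = Suc m" for x m
  proof (induction x rule: M.tensor_induct)
    case (tensor f e)
    have "extend (contr e \<omega>) \<in> C.cd m"
      using c n by (intro less.IH L.contr_cochains) simp_all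
    moreover have "C.wedge (t 1 e) (hcontr (der f) ?E) \<in> C.cd m"
    proof (cases m)
      case 0
      then show ?thesis by (simp add: J0 n der_in_HM C.zero_cd)
    next
      case (Suc p)
      then show ?thesis using J[of p "der f"] n by (simp add: C.wedge_cd der_in_HM)
    qed
    ultimately show ?case unfolding contr_extend_t[OF c] by (intro C.add_cd C.mul_cd)
  next
    case (add x y)
    then show ?case unfolding contr_extend_add[OF c] by (rule C.add_cd)
  qed
  have coch: "?E \<in> C.cochains n"
  proof (rule C.cochains_I)
    fix k es hs assume a: "\<not> args n HM k es hs"
    show "?E k es hs = 0"
    proof (cases es)
      case Nil
      have "2 * k \<noteq> n \<or> \<not> C.ok k hs" using a Nil by (auto simp: args_def)
      moreover have "\<omega> k [] hs' = 0" if "2 * k \<noteq> n" for hs'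
        by (rule L.cochain_zero_outside[OF c]) (use that in \<open>simp add: args_def\<close>)
      ultimately show ?thesis using Nil by (auto simp: extend_def mext_zero)
    next
      case (Cons x xs)
      have "contr x ?E k xs hs = 0"
      proof (cases n)
        case 0
        then show ?thesis using step0[of x] by simp
      next
        case (Suc m)
        show ?thesis
          by (rule C.cochain_zero_outside[OF C.cd_cochain[OF step[OF Suc]]])
            (use a Cons Suc in \<open>auto simp: args_def\<close>)
      qed
      then show ?thesis using Cons by simp
    qed
  next
    fix k hs hs' assume ok: "C.ok k hs" and m: "mset hs' = mset hs"
    have "C.ok k hs'" using ok mset_eq_setD[OF m] mset_eq_length[OF m] by simp
    then show "?E k [] hs' = ?E k [] hs"
      using ok extend_raw_sym[OF c m] by (simp add: extend_def del: extend_raw.simps)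
  next
    fix k h h' hs assume "h \<in> HM" "h' \<in> HM" "C.ok k hs"
    then show "?E (Suc k) [] ((h + h') # hs) = ?E (Suc k) [] (h # hs) + ?E (Suc k) [] (h' # hs)"
      by (simp add: extend_def extend_raw_hadd[OF c] extended_ideal_add del: extend_raw.simps)
  next
    fix k a h hs assume "h \<in> HM" "C.ok k hs"
    then show "?E (Suc k) [] (sM a h # hs) = sW a (?E (Suc k) [] (h # hs))"
      by (simp add: extend_def extend_raw_hscale[OF c] M.T.subspace_scale[OF subspace_extended_ideal] del: extend_raw.simps)
  next
    fix x y
    show "contr (x + y) ?E = contr x ?E + contr y ?E"
      by (rule contr_extend_add[OF c])
  next
    fix a x
    show "contr (sM a x) ?E = family_scale sW a (contr x ?E)"
      by (rule contr_extend_scale[OF c])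
  next
    fix m x assume "n = Suc m"
    then show "contr x ?E \<in> C.cochains m" by (intro C.cd_cochain step)
  next
    fix x y
    show "contr y (contr x ?E) + contr x (contr y ?E) = - hcontr (sym_bracket cbr x y) ?E"
      unfolding C.sym_bracket_eq
    proof (induction x rule: M.tensor_induct)
      case (add x x')
      have l: "contr y (contr (x + x') ?E) = contr y (contr x ?E) + contr y (contr x' ?E)"
        by (simp add: contr_extend_add[OF c] contr_add)
      \<comment> \<open>Here the sum is inserted into \<open>contr y ?E\<close>, whose linearity is
        available because \<open>step\<close> has already made it a cochain.\<close>
      have r: "contr (x + x') (contr y ?E) = contr x (contr y ?E) + contr x' (contr y ?E)"
      proof (cases n)
        case 0
        then show ?thesis by (simp add: step0)
      next
        case (Suc m)
        then show ?thesis using C.contr_add_left[OF C.cd_cochain[OF step]] by blast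
      qed
      have h: "hcontr (der (form (x + x') y)) ?E = hcontr (der (form x y)) ?E + hcontr (der (form x' y)) ?E"
        by (simp add: form_add_left der_add hcontr_extend_add[OF c] der_in_HM)
      have "contr y (contr x ?E) + contr x (contr y ?E) = - hcontr (der (form x y)) ?E"
        "contr y (contr x' ?E) + contr x' (contr y ?E) = - hcontr (der (form x' y)) ?E"
        by (rule add(1), rule add(2))
      then have "contr y (contr x ?E) = - hcontr (der (form x y)) ?E - contr x (contr y ?E)"
        "contr y (contr x' ?E) = - hcontr (der (form x' y)) ?E - contr x' (contr y ?E)"
        by (simp_all only: eq_diff_eq)
      then show ?case unfolding l r h by simp
    next
      case x: (tensor f e)
      show ?case
      proof (induction y rule: M.tensor_induct)
        case (add y y')
        have l: "contr (y + y') (contr (t f e) ?E) = contr y (contr (t f e) ?E) + contr y' (contr (t f e) ?E)"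
        proof (cases n)
          case 0
          then show ?thesis by (simp add: step0)
        next
          case (Suc m)
          then show ?thesis using C.contr_add_left[OF C.cd_cochain[OF step]] by blast
        qed
        have r: "contr (t f e) (contr (y + y') ?E) = contr (t f e) (contr y ?E) + contr (t f e) (contr y' ?E)"
          by (simp add: contr_extend_add[OF c] contr_add)
        have h: "hcontr (der (form (t f e) (y + y'))) ?E =
            hcontr (der (form (t f e) y)) ?E + hcontr (der (form (t f e) y')) ?E"
          by (simp add: form_add_right der_add hcontr_extend_add[OF c] der_in_HM)
        have "contr y (contr (t f e) ?E) + contr (t f e) (contr y ?E) = - hcontr (der (form (t f e) y)) ?E"
          "contr y' (contr (t f e) ?E) + contr (t f e) (contr y' ?E) = - hcontr (der (form (t f e) y')) ?E"
          by (rule add(1), rule add(2))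
        then have "contr y (contr (t f e) ?E) = - hcontr (der (form (t f e) y)) ?E - contr (t f e) (contr y ?E)"
          "contr y' (contr (t f e) ?E) = - hcontr (der (form (t f e) y')) ?E - contr (t f e) (contr y' ?E)"
          by (simp_all only: eq_diff_eq)
        then show ?case unfolding l r h by simp
      next
        case (tensor g e')
        let ?s = "sym_bracket br e e'"
        have s: "?s \<in> H" using sym_bracket_in_left_center center by blast
        have "der (form (t f e) (t g e')) = rM (f * g) (t 1 ?s) + rM (\<iota> ?s * f) (der g) + rM (\<iota> ?s * g) (der f)"
          by (simp add: form_t der_mult der_\<iota> sym_bracket_in_left_center RM.scale_right_distrib algebra_simps)
        then have 1: "hcontr (der (form (t f e) (t g e'))) ?E = C.mul (f * g) (extend (hcontr ?s \<omega>))
            + C.mul (\<iota> ?s * f) (hcontr (der g) ?E) + C.mul (\<iota> ?s * g) (hcontr (der f) ?E)"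
          using s by (simp add: hcontr_extend_add[OF c] hcontr_extend_rM[OF c] hcontr_extend_t_1[OF c] extended_ideal_add rM_extended_ideal
              t_in_extended_ideal der_in_HM hcontr_extend_t[OF c])
        have 2: "extend (contr e' (contr e \<omega>)) = - extend (hcontr ?s \<omega>) - extend (contr e (contr e' \<omega>))"
          using extend_add[of "- hcontr ?s \<omega>" "- contr e (contr e' \<omega>)"] by (simp add: L.contr_swap[OF c, of e' e] extend_minus)
        show ?case
          unfolding contr_contr_extend_t[OF c] 1 2 C.wedge_anticommute[of "t 1 e'" "t 1 e"]
            hcontr_extend_commute[OF c, of "der g" "der f"]
          by (simp add: C.mul_diff C.mul_minus sym_bracket_commute[of e' e] mult.commute algebra_simps)
      qed
    qed
  qed
  show ?case
  proof (rule C.cd_I[OF coch])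
    fix f x
    show "contr (rM f x) ?E = C.mul f (contr x ?E) + C.wedge x (hcontr (der f) ?E)"
    proof (induction x rule: M.tensor_induct)
      case (tensor g e)
      have "C.wedge (t g e) \<eta> = C.mul g (C.wedge (t 1 e) \<eta>)" for \<eta>
        using C.wedge_rE_left[of g "t 1 e" \<eta>] by simp
      \<comment> \<open>Both sides agree since \<partial>(f g) = f \<partial>g + g \<partial>f and
        insertion from the ideal is linear over R.\<close>
      then have "contr (rM f (t g e)) ?E =
          C.mul f (contr (t g e) ?E) + C.wedge (t g e) (hcontr (der f) ?E)"
        by (simp add: contr_extend_t[OF c] der_mult hcontr_extend_add[OF c] hcontr_extend_rM[OF c] rM_extended_ideal der_in_HM
            C.wedge_add C.wedge_mul C.mul_add C.mul_mul)
      then show ?case .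
    next
      case (add x y)
      show ?case
        unfolding RM.scale_right_distrib contr_extend_add[OF c] C.mul_add C.wedge_add_left add by (simp add: algebra_simps)
    qed
  next
    fix k h hs f assume "h \<in> HM" "C.ok k hs"
    then show "?E (Suc k) [] (rM f h # hs) = rW f (?E (Suc k) [] (h # hs))"
      by (simp add: extend_def extend_raw_hrM[OF c] rM_extended_ideal del: extend_raw.simps)
  qed (rule step)
qed

section \<open>Restriction to L\<close>

text \<open>The condition \<open>L.ok\<close> makes the restriction vanish outside H without a proof
  that 1 \<otimes> h in the extended ideal forces h \<in> H.\<close>

definition restr :: "('m, 'w) family \<Rightarrow> ('l, 'w) family" where
  "restr \<omega> = (\<lambda>k es hs. if L.ok k hs then \<omega> k (map (t 1) es) (map (t 1) hs) else 0)"

lemma restr_add: "restr (\<omega> + \<eta>) = restr \<omega> + restr \<eta>"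
  and restr_diff: "restr (\<omega> - \<eta>) = restr \<omega> - restr \<eta>"
  and restr_minus: "restr (- \<omega>) = - restr \<omega>"
  and restr_scale: "restr (family_scale sW c \<omega>) = family_scale sW c (restr \<omega>)"
  and restr_zero [simp]: "restr 0 = 0"
  by (auto simp: restr_def fun_eq_iff)

lemma contr_restr: "contr e (restr \<omega>) = restr (contr (t 1 e) \<omega>)"
  by (auto simp: restr_def fun_eq_iff)

lemma hcontr_restr: "h \<in> H \<Longrightarrow> hcontr h (restr \<omega>) = restr (hcontr (t 1 h) \<omega>)"
  by (auto simp: restr_def fun_eq_iff)

lemma map_t_HM: "set hs \<subseteq> H \<Longrightarrow> set (map (t 1) hs) \<subseteq> HM"
  by (auto intro: t_in_extended_ideal)

lemma restr_cochains: "\<omega> \<in> C.cochains n \<Longrightarrow> restr \<omega> \<in> L.cochains n"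
proof (induction n arbitrary: \<omega> rule: less_induct)
  case (less n \<omega>)
  note c = less.prems
  show ?case
  proof (rule L.cochains_I)
    fix k es hs assume "\<not> args n H k es hs"
    then show "restr \<omega> k es hs = 0"
      by (auto simp: restr_def args_def intro!: C.cochain_zero_outside[OF c])
  next
    fix k hs hs' assume ok: "L.ok k hs" and m: "mset hs' = mset hs"
    have "L.ok k hs'" using ok mset_eq_setD[OF m] mset_eq_length[OF m] by simp
    moreover have "\<omega> k [] (map (t 1) hs') = \<omega> k [] (map (t 1) hs)"
      by (rule C.cochain_sym[OF c]) (simp add: m)
    ultimately show "restr \<omega> k [] hs' = restr \<omega> k [] hs" using ok by (simp add: restr_def)
  next
    fix x y
    have "sym_bracket cbr (t 1 x) (t 1 y) = t 1 (sym_bracket br x y)"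
      by (simp add: sym_bracket_def cbr_t_1 M.t_add_right)
    then show "contr y (contr x (restr \<omega>)) + contr x (contr y (restr \<omega>)) = - hcontr (sym_bracket br x y) (restr \<omega>)"
      using arg_cong[OF C.contr_anticommute[OF c, of "t 1 y" "t 1 x"], of restr]
      by (simp add: contr_restr hcontr_restr L.sym_bracket_in_H restr_add restr_minus)
  next
    fix m x assume "n = Suc m"
    then show "contr x (restr \<omega>) \<in> L.cochains m"
      using c by (auto simp: contr_restr intro!: less.IH C.contr_cochains)
  qed (simp_all add: contr_restr M.t_add_right M.t_scale_right C.contr_add_left[OF c] C.contr_scale_left[OF c] restr_add restr_scale,
      simp_all add: restr_def M.t_add_right M.t_scale_right C.cochain_hadd[OF c] C.cochain_hscale[OF c] t_in_extended_ideal
        subspace_add[OF H_subspace] subspace_scale[OF H_subspace])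
qed

lemma restr_extend:
  assumes "\<omega> \<in> L.cochains n"
  shows "restr (extend \<omega>) = \<omega>"
  using assms
proof (rule L.cochain_op_eqI[where G = "\<lambda>\<omega>. \<omega>"])
  fix \<omega> n k hs assume c: "\<omega> \<in> L.cochains n"
  show "restr (extend \<omega>) k [] hs = \<omega> k [] hs"
  proof (cases "L.ok k hs")
    case True
    have m: "mext b (map (t 1) ls) = b ls" if "sym_multilinear b" for b ls
      using that
    proof (induction ls arbitrary: b)
      case (Cons l ls)
      then show ?case using mext_t[OF Cons.prems, of 1 l "map (t 1) ls"] Cons.IH[OF sym_multilinear_tail[OF Cons.prems]]
        by (simp del: mext.simps)
    qed simp
    show ?thesis
      using True map_t_HM[of hs] by (simp add: restr_def extend_def m[OF sym_multilinear_cochain[OF c]] map_proj_H)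
  next
    case False
    then have "restr (extend \<omega>) k [] hs = 0" by (auto simp: restr_def)
    then show ?thesis using L.cochain_zero_not_ok[OF c False, of "[]"] by simp
  qed
next
  fix \<omega> n y assume c: "\<omega> \<in> L.cochains n" and IH: "restr (extend (contr y \<omega>)) = contr y \<omega>"
  have "C.mul 1 \<eta> = \<eta>" for \<eta> :: "('m, 'w) family" by (simp add: fun_eq_iff)
  \<comment> \<open>On 1 \<otimes> y the wedge term is absent because \<partial>1 = 0.\<close>
  then show "contr y (restr (extend \<omega>)) = contr y \<omega>"
    by (simp add: contr_restr contr_extend_t[OF c] hcontr_extend_zero[OF c] IH)
next
  show "restr (extend 0) = 0" by simp
qed

text \<open>Insertions of 1 \<otimes> e and of 1 \<otimes> h again restrict to zero and have smaller
  degree, so they vanish by induction; the two axioms over R carry this to all of the crossed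
  product and of the ideal. The lemma serves both for bijectivity of the extension and for its
  compatibility with d.\<close>

lemma restr_eq_zero: "\<omega> \<in> C.cd n \<Longrightarrow> restr \<omega> = 0 \<Longrightarrow> \<omega> = 0"
proof (induction n arbitrary: \<omega> rule: less_induct)
  case (less n \<omega>)
  note c = less.prems(1)
  note c' = C.cd_cochain[OF c]
  have z: "restr \<omega> = 0" by (rule less.prems(2))
  have J1: "hcontr (t 1 h) \<omega> = 0" if "h \<in> H" for h
  proof (cases "n < 2")
    case True
    then show ?thesis by (rule C.hcontr_cochains_0[OF c'])
  next
    case False
    show ?thesis
    proof (rule less.IH[of "n - 2"])
      show "restr (hcontr (t 1 h) \<omega>) = 0" using hcontr_restr[OF that, of \<omega>] z by simp
      show "hcontr (t 1 h) \<omega> \<in> C.cd (n - 2)" by (rule C.hcontr_cd[OF c t_in_extended_ideal[OF that]])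
    qed (use False in simp)
  qed
  have J: "hcontr x \<omega> = 0" if "x \<in> HM" for x
    using that
  proof (induction rule: extended_ideal_induct)
    case zero
    show ?case by (rule C.hcontr_zero_left[OF c'])
  next
    case (gen f h)
    then show ?case
      using C.cd_hcontr_rE[OF c t_in_extended_ideal[OF gen, of 1], of f] by (simp add: J1)
  next
    case (add x y)
    have "hcontr x \<omega> = 0" "hcontr y \<omega> = 0" by (rule add(3), rule add(4))
    then show ?case by (simp add: C.hcontr_add_left[OF c' add(1,2)])
  qed
  have contr1: "contr (t 1 e) \<omega> = 0" for e
  proof (cases n)
    case 0
    then show ?thesis using c' by (simp add: C.contr_cochains_0)
  next
    case (Suc m)
    show ?thesis
    proof (rule less.IH[of m])
      show "restr (contr (t 1 e) \<omega>) = 0" using contr_restr[of e \<omega>] z by simp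
      show "contr (t 1 e) \<omega> \<in> C.cd m" using Suc c C.contr_cd by blast
    qed (use Suc in simp)
  qed
  show ?case
  proof (rule family_ext)
    fix k hs
    show "\<omega> k [] hs = 0 k [] hs"
    proof (cases "C.ok k hs")
      case ok: True
      show ?thesis
      proof (cases hs)
        case Nil
        then have "restr \<omega> k [] [] = \<omega> k [] hs" using ok by (simp add: restr_def)
        then show ?thesis using z by simp
      next
        case (Cons h hs')
        then have "hcontr h \<omega> = 0" using ok J by simp
        from family_apply[OF this, of "k - 1" "[]" hs']
        show ?thesis using ok Cons by auto
      qed
    qed (simp add: C.cochain_zero_not_ok[OF c'])
  next
    fix x
    show "contr x \<omega> = contr x 0"
    proof (induction x rule: M.tensor_induct)
      case (tensor f e)
      show ?case
        using C.cd_contr_rE[OF c, of f "t 1 e"] by (simp add: contr1 J der_in_HM)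
    next
      case (add x y)
      have "contr x \<omega> = 0" "contr y \<omega> = 0" using add by (simp_all only: contr_zero)
      then show ?case by (simp add: C.contr_add_left[OF c'])
    qed
  qed
qed

section \<open>Restriction and the differentials\<close>

text \<open>Arbitrary families are allowed, so the insertion in the recursive step needs no cochain
  condition. Since \<open>restr\<close> is cut off, each rewritten list must be seen to stay in
  H.\<close>

lemma lie_raw_restr:
  assumes ok: "L.ok k hs"
  shows "C.lie_raw (t 1 e) (map (t 1) es) \<omega> k (map (t 1) hs) = L.lie_raw e es (restr \<omega>) k hs"
proof (induction es arbitrary: \<omega>)
  case Nil
  have "hsum (\<lambda>x r. \<omega> k [] (t 1 (br e x) # map (t 1) r)) hs = hsum (\<lambda>x r. restr \<omega> k [] (br e x # r)) hs"
  proof (rule hsum_cong)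
    fix x r assume "mset hs = add_mset x (mset r)"
    from L.mset_ok[OF this ok] have "L.ok k (br e x # r)" by (auto simp: H_br_right)
    then show "\<omega> k [] (t 1 (br e x) # map (t 1) r) = restr \<omega> k [] (br e x # r)" by (simp add: restr_def)
  qed
  moreover have "restr \<omega> k [] hs = \<omega> k [] (map (t 1) hs)" using ok by (simp add: restr_def)
  ultimately show ?case by (simp add: hsum_map cbr_t_1)
next
  case (Cons y es)
  have "C.lie_raw (t 1 e) (map (t 1) es) (contr (t 1 y) \<omega>) k (map (t 1) hs) = L.lie_raw e es (restr (contr (t 1 y) \<omega>)) k hs"
    by (rule Cons.IH)
  moreover have "restr \<omega> k (br e y # es) hs = \<omega> k (t 1 (br e y) # map (t 1) es) (map (t 1) hs)"
    using ok by (simp add: restr_def)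
  ultimately show ?case by (simp add: contr_restr cbr_t_1)
qed

lemma dif_raw_restr:
  assumes ok: "L.ok k hs"
  shows "C.dif_raw (map (t 1) es) \<omega> k (map (t 1) hs) = L.dif_raw es (restr \<omega>) k hs"
proof (induction es arbitrary: \<omega>)
  case Nil
  have "hsum (\<lambda>x r. \<omega> (k - 1) [t 1 x] (map (t 1) r)) hs = hsum (\<lambda>x r. restr \<omega> (k - 1) [x] r) hs"
  proof (rule hsum_cong)
    fix x r assume "mset hs = add_mset x (mset r)"
    from L.mset_ok[OF this ok] have "L.ok (k - 1) r" by simp
    then show "\<omega> (k - 1) [t 1 x] (map (t 1) r) = restr \<omega> (k - 1) [x] r" by (simp add: restr_def)
  qed
  then show ?case by (simp add: hsum_map)
next
  case (Cons y es)
  have "C.dif_raw (map (t 1) es) (contr (t 1 y) \<omega>) k (map (t 1) hs) = L.dif_raw es (restr (contr (t 1 y) \<omega>)) k hs"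
    by (rule Cons.IH)
  then show ?case by (simp add: contr_restr lie_raw_restr[OF ok])
qed

lemma restr_dif: "restr (C.dif \<omega>) = L.dif (restr \<omega>)"
proof (intro ext)
  fix k es hs
  show "restr (C.dif \<omega>) k es hs = L.dif (restr \<omega>) k es hs"
  proof (cases "L.ok k hs")
    case True
    then have "C.ok k (map (t 1) hs)" using map_t_HM[of hs] by simp
    then have "C.dif \<omega> k (map (t 1) es) (map (t 1) hs) = C.dif_raw (map (t 1) es) \<omega> k (map (t 1) hs)"
      by (simp add: C.dif_def)
    moreover have "restr (C.dif \<omega>) k es hs = C.dif \<omega> k (map (t 1) es) (map (t 1) hs)"
      using True by (simp add: restr_def)
    moreover have "L.dif (restr \<omega>) k es hs = L.dif_raw es (restr \<omega>) k hs"
      using True by (simp add: L.dif_def)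
    ultimately show ?thesis using dif_raw_restr[OF True, of es \<omega>] by simp
  next
    case False
    then have "restr (C.dif \<omega>) k es hs = 0" by (auto simp: restr_def)
    then show ?thesis using L.dif_not_ok[OF False] by simp
  qed
qed

lemma isomorphic_complexes_crossed:
  "isomorphic_complexes (family_scale sW) (leibniz_cochains sL br H sW)
      (standard_d br H (\<lambda>e. nab (t 1 e)) sW)
    (family_scale sW) (courant_dorfman_cochains sM rM form der HM sW rW) (standard_d cbr HM nab sW)"
  unfolding isomorphic_complexes_def
proof (intro conjI)
  show "cochain_complex (family_scale sW) L.cochains (standard_d br H (\<lambda>e. nab (t 1 e)) sW)"
    by (rule L.cochain_complex)
  show "cochain_complex (family_scale sW) C.cd (standard_d cbr HM nab sW)"
    by (rule C.cochain_complex_cd)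
  have bij: "bij_betw extend (L.cochains n) (C.cd n)" for n
  proof (rule bij_betw_byWitness[where f' = restr])
    show "\<forall>\<omega>\<in>C.cd n. extend (restr \<omega>) = \<omega>"
    proof
      fix \<omega> assume w: "\<omega> \<in> C.cd n"
      note r = restr_cochains[OF C.cd_cochain[OF w]]
      \<comment> \<open>Both terms are Courant-Dorfman cochains with restriction
        \<open>restr \<omega>\<close>.\<close>
      have "extend (restr \<omega>) - \<omega> = 0"
        by (rule restr_eq_zero[OF C.diff_cd[OF extend_cd[OF r] w]]) (simp add: restr_diff restr_extend[OF r])
      then show "extend (restr \<omega>) = \<omega>" by simp
    qed
  qed (auto simp: restr_extend extend_cd restr_cochains C.cd_cochain)
  have comm: "extend (standard_d br H (\<lambda>e. nab (t 1 e)) sW n \<omega>) = standard_d cbr HM nab sW n (extend \<omega>)"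
    if w: "\<omega> \<in> L.cochains n" for n \<omega>
  proof -
    note e = extend_cd[OF w]
    \<comment> \<open>Both terms restrict to \<open>L.dif \<omega>\<close>: one because restriction
      undoes extension, the other because restriction commutes with the differentials.\<close>
    have "extend (L.dif \<omega>) - C.dif (extend \<omega>) = 0"
      by (rule restr_eq_zero[OF C.diff_cd[OF extend_cd[OF L.dif_cochains[OF w]] C.dif_cd[OF e]]])
        (simp add: restr_diff restr_dif restr_extend[OF w] restr_extend[OF L.dif_cochains[OF w]])
    then show ?thesis
      by (simp add: L.standard_d_eq_dif[OF w] C.standard_d_eq_dif[OF C.cd_cochain[OF e]])
  qed
  show "\<exists>\<phi>. \<forall>n. linear_on (family_scale sW) (family_scale sW) (L.cochains n) (\<phi> n) \<and>
      bij_betw (\<phi> n) (L.cochains n) (C.cd n) \<and>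
      (\<forall>x\<in>L.cochains n. \<phi> (Suc n) (standard_d br H (\<lambda>e. nab (t 1 e)) sW n x) = standard_d cbr HM nab sW n (\<phi> n x))"
    by (rule exI[of _ "\<lambda>n. extend"]) (simp add: linear_on_def extend_add extend_scale bij comm)
qed

end

theorem theorem5p3:
  fixes sL :: "'k::real_normed_field \<Rightarrow> 'l::ab_group_add \<Rightarrow> 'l" and br :: "'l \<Rightarrow> 'l \<Rightarrow> 'l"
    and H :: "'l set"
    and sV :: "'k \<Rightarrow> 'v::ab_group_add \<Rightarrow> 'v" and \<tau> :: "'l \<Rightarrow> 'v \<Rightarrow> 'v"
    and sR :: "'k \<Rightarrow> 'r::comm_ring_1 \<Rightarrow> 'r" and \<iota> :: "'l \<Rightarrow> 'r"
    and sM :: "'k \<Rightarrow> 'm::ab_group_add \<Rightarrow> 'm" and t :: "'r \<Rightarrow> 'l \<Rightarrow> 'm"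
    and sW :: "'k \<Rightarrow> 'w::ab_group_add \<Rightarrow> 'w" and tV :: "'r \<Rightarrow> 'v \<Rightarrow> 'w"
  assumes "leibniz_algebra sL br"
    and "isotropic_ideal sL br H" and "left_center br \<subseteq> H"
    and "leibniz_representation sL br H sV \<tau>"
    and "is_symmetric_algebra sL (left_center br) sR \<iota>"
    and "is_tensor_product sR sL sM t"
    and "is_tensor_product sR sV sW tV"
  shows "isomorphic_complexes
    (family_scale sW)
      (leibniz_cochains sL br H sW)
      (standard_d br H (\<lambda>e. extended_action br sR \<iota> sM t \<tau> sW tV (t 1 e)) sW)
    (family_scale sW)
      (courant_dorfman_cochains sM (tensor_action sM t) (crossed_form br sR \<iota> sM t)
        (crossed_der br sR \<iota> sM t) (extended_ideal sM t H) sW (tensor_action sW tV))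
      (standard_d (crossed_bracket br sR \<iota> sM t) (extended_ideal sM t H)
        (extended_action br sR \<iota> sM t \<tau> sW tV) sW)"
proof -
  interpret leibniz_algebra sL br by (rule assms(1))
  interpret crossed_representation sL br sR \<iota> sM t H sV \<tau> sW tV
    by unfold_locales (use assms in auto)
  show ?thesis by (rule isomorphic_complexes_crossed)
qed

end
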